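(* For every $c \in \mathbb{R}$, the \textsc{Clique} problem admits a polynomial-size OR kernel using $O(n/\log^{c} n)$ queries, where $n$ is the encoding length of the input instance, for each of the following parameterizations: bandwidth; cutwidth; degeneracy; distance to bounded degree; edge bipartization number; feedback vertex set number; $k$ + distance to chordal graphs; $k$ + distance to interval graphs; maximum degree; odd cycle transversal number; treedepth; vertex cover number; length of the longest odd cycle; pathwidth; treewidth.
   Context: \textsc{Clique}: given a graph $G$ and a positive integer $k$, decide whether $G$ contains $k$ pairwise adjacent vertices. Graphs are encoded by adjacency lists; with $n_G$ vertices and $m_G$ edges, the encoding length (size) of an instance $(G,k)$ is $n = O(n_G + m_G\log n_G)$. A parameterized problem is a set $L\subseteq\{0,1\}^*\times\mathbb{N}$; for an instance $(y,p)$, $|(y,p)|:=|y|+p+c_0$ for a fixed constant $c_0$. An OR kernel for $L$ is an algorithm that, given $(x,p)$, outputs in polynomial time instances $(y_1,p_1),\dots,(y_t,p_t)$ such that $\max_i |y_i|+p_i\le f(p)$ for some function $f$ (the size of the kernel), and $(x,p)\in L$ iff $(y_i,p_i)\in L$ for some $i$; $t=t(n,p)$ is the number of queries. It is polynomial-size if $f$ is a polynomial. Parameters: distance to bounded degree $d$ (for a fixed $d$) is the minimum number of vertices whose deletion leaves a graph of maximum degree at most $d$; edge bipartization number is the minimum number of edges whose deletion makes the graph bipartite; odd cycle transversal number is the minimum number of vertices whose deletion makes the graph bipartite; distance to chordal (resp. interval) graphs is the minimum number of vertex deletions to obtain a chordal (resp. interval) graph, and "$k$ + distance to chordal" is the sum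 of the clique size $k$ and this distance; the remaining parameters are the standard graph width/degree parameters. *)

theory Defs
  imports
    "HOL-Library.Landau_Symbols"
    "HOL-Computational_Algebra.Polynomial"
begin

section \<open>Polynomial time\<close>

text \<open>
  The machine model is the imperative language WHILE of N. D. Jones (Computability and Complexity
  from a Programming Perspective, MIT Press 1997): finitely many registers hold binary trees and
  every tree operation costs one step. With trees stored as shared cells each operation takes
  constant time on a pointer machine, and a Turing machine step is simulated by constantly many
  operations, so on bit string inputs and outputs the polynomial-time functions of this model are
  exactly those of Turing machines.
\<close>

datatype dtree = Leaf | Node dtree dtree

fun head :: "dtree \<Rightarrow> dtree" where
  "head Leaf = Leaf"
| "head (Node s t) = s"

fun tail :: "dtree \<Rightarrow> dtree" where
  "tail Leaf = Leaf"
| "tail (Node s t) = t"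

datatype expr = Reg nat | Const_Leaf | Mk_Node expr expr | Head expr | Tail expr

type_synonym store = "nat \<Rightarrow> dtree"

fun eval_expr :: "expr \<Rightarrow> store \<Rightarrow> dtree" where
  "eval_expr (Reg i) s = s i"
| "eval_expr Const_Leaf s = Leaf"
| "eval_expr (Mk_Node a b) s = Node (eval_expr a s) (eval_expr b s)"
| "eval_expr (Head a) s = head (eval_expr a s)"
| "eval_expr (Tail a) s = tail (eval_expr a s)"

fun cost_expr :: "expr \<Rightarrow> nat" where
  "cost_expr (Reg i) = 1"
| "cost_expr Const_Leaf = 1"
| "cost_expr (Mk_Node a b) = cost_expr a + cost_expr b + 1"
| "cost_expr (Head a) = cost_expr a + 1"
| "cost_expr (Tail a) = cost_expr a + 1"

datatype prog =
    Skip
  | Assign nat expr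
  | Seq prog prog
  | If expr prog prog
  | While expr prog

text \<open>In tests, \<open>Leaf\<close> is false and every other tree is true. In \<open>exec P s n s'\<close>,
  \<open>n\<close> is the running time.\<close>

inductive exec :: "prog \<Rightarrow> store \<Rightarrow> nat \<Rightarrow> store \<Rightarrow> bool" where
  exec_Skip: "exec Skip s 1 s"
| exec_Assign: "exec (Assign i a) s (cost_expr a + 1) (s(i := eval_expr a s))"
| exec_Seq: "exec P s m s' \<Longrightarrow> exec Q s' n s'' \<Longrightarrow> exec (Seq P Q) s (m + n) s''"
| exec_If_True: "eval_expr a s \<noteq> Leaf \<Longrightarrow> exec P s n s' \<Longrightarrow>
    exec (If a P Q) s (cost_expr a + n + 1) s'"
| exec_If_False: "eval_expr a s = Leaf \<Longrightarrow> exec Q s n s' \<Longrightarrow>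
    exec (If a P Q) s (cost_expr a + n + 1) s'"
| exec_While_True: "eval_expr a s \<noteq> Leaf \<Longrightarrow> exec P s m s' \<Longrightarrow> exec (While a P) s' n s'' \<Longrightarrow>
    exec (While a P) s (cost_expr a + m + n + 1) s''"
| exec_While_False: "eval_expr a s = Leaf \<Longrightarrow> exec (While a P) s (cost_expr a + 1) s"

fun tree_of_list :: "('a \<Rightarrow> dtree) \<Rightarrow> 'a list \<Rightarrow> dtree" where
  "tree_of_list h [] = Leaf"
| "tree_of_list h (x # xs) = Node (h x) (tree_of_list h xs)"

definition tree_of_bit :: "bool \<Rightarrow> dtree" where
  "tree_of_bit b = (if b then Node Leaf Leaf else Leaf)"

text \<open>An instance of a parameterized problem is a bit string with a parameter; the parameter is
  handed over in unary, in accordance with the size \<open>length x + p\<close> (up to an additive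
  constant) of an instance \<open>(x, p)\<close>.\<close>

type_synonym pinstance = "bool list \<times> nat"

fun tree_of_pinstance :: "pinstance \<Rightarrow> dtree" where
  "tree_of_pinstance (x, p) =
     Node (tree_of_list tree_of_bit x) (tree_of_list (\<lambda>_. Leaf) (replicate p ()))"

definition polytime :: "(pinstance \<Rightarrow> pinstance list) \<Rightarrow> bool" where
  "polytime K \<longleftrightarrow> (\<exists>(P :: prog) (q :: nat poly). \<forall>x p. \<exists>n s.
      exec P ((\<lambda>_. Leaf)(0 := tree_of_pinstance (x, p))) n s \<and>
      s 0 = tree_of_list tree_of_pinstance (K (x, p)) \<and>
      n \<le> poly q (length x + p))"


section \<open>OR kernels\<close>

text \<open>
  \<open>L\<close> is a parameterized problem and \<open>I\<close> a promise: nothing but termination in polynomial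
  time is required outside \<open>I\<close>, and all queries have to fulfil the promise themselves.
  The number of queries is \<open>O(g n)\<close>, with \<open>n\<close> the length of the input string, uniformly in
  the parameter.
\<close>

definition poly_OR_kernel ::
    "pinstance set \<Rightarrow> pinstance set \<Rightarrow> (nat \<Rightarrow> real) \<Rightarrow> (pinstance \<Rightarrow> pinstance list) \<Rightarrow> bool" where
  "poly_OR_kernel L I g K \<longleftrightarrow>
     polytime K \<and>
     (\<exists>f :: nat poly. \<forall>(x, p) \<in> I. \<forall>(y, q) \<in> set (K (x, p)). length y + q \<le> poly f p) \<and>
     (\<forall>(x, p) \<in> I. set (K (x, p)) \<subseteq> I) \<and>
     (\<forall>(x, p) \<in> I. (x, p) \<in> L \<longleftrightarrow> (\<exists>(y, q) \<in> set (K (x, p)). (y, q) \<in> L)) \<and>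
     (\<exists>t :: nat \<Rightarrow> real. t \<in> O(g) \<and> (\<forall>(x, p) \<in> I. real (length (K (x, p))) \<le> t (length x)))"


section \<open>Graphs\<close>

text \<open>A graph is a pair of a vertex set and a set of two-element edges.\<close>

type_synonym 'a graph = "'a set \<times> 'a set set"

abbreviation verts :: "'a graph \<Rightarrow> 'a set" where "verts \<equiv> fst"
abbreviation edges :: "'a graph \<Rightarrow> 'a set set" where "edges \<equiv> snd"

definition simple_graph :: "'a graph \<Rightarrow> bool" where
  "simple_graph G \<longleftrightarrow> finite (verts G) \<and> (\<forall>e \<in> edges G. e \<subseteq> verts G \<and> card e = 2)"

definition has_clique :: "'a graph \<Rightarrow> nat \<Rightarrow> bool" where
  "has_clique G k \<longleftrightarrow>
     (\<exists>C \<subseteq> verts G. card C = k \<and> (\<forall>u \<in> C. \<forall>v \<in> C. u \<noteq> v \<longrightarrow> {u, v} \<in> edges G))"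

definition neighbours :: "'a graph \<Rightarrow> 'a \<Rightarrow> 'a set" where
  "neighbours G v = {u. {v, u} \<in> edges G}"

definition vdegree :: "'a graph \<Rightarrow> 'a \<Rightarrow> nat" where
  "vdegree G v = card (neighbours G v)"

definition subgraph :: "'a graph \<Rightarrow> 'a graph \<Rightarrow> bool" where
  "subgraph H G \<longleftrightarrow> simple_graph H \<and> verts H \<subseteq> verts G \<and> edges H \<subseteq> edges G"

definition del_verts :: "'a graph \<Rightarrow> 'a set \<Rightarrow> 'a graph" where
  "del_verts G S = (verts G - S, {e \<in> edges G. e \<inter> S = {}})"

definition induced :: "'a graph \<Rightarrow> 'a set \<Rightarrow> 'a graph" where
  "induced G W = (W, {e \<in> edges G. e \<subseteq> W})"

definition del_edges :: "'a graph \<Rightarrow> 'a set set \<Rightarrow> 'a graph" where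
  "del_edges G F = (verts G, edges G - F)"

definition cycle_edges :: "'a list \<Rightarrow> 'a set set" where
  "cycle_edges c = {{c ! i, c ! (Suc i mod length c)} | i. i < length c}"

definition is_cycle :: "'a graph \<Rightarrow> 'a list \<Rightarrow> bool" where
  "is_cycle G c \<longleftrightarrow> 3 \<le> length c \<and> distinct c \<and> cycle_edges c \<subseteq> edges G"

definition forest :: "'a graph \<Rightarrow> bool" where
  "forest G \<longleftrightarrow> (\<nexists>c. is_cycle G c)"

definition connected_graph :: "'a graph \<Rightarrow> bool" where
  "connected_graph G \<longleftrightarrow> verts G \<noteq> {} \<and>
     (\<forall>u \<in> verts G. \<forall>v \<in> verts G. (u, v) \<in> {(x, y). {x, y} \<in> edges G}\<^sup>*)"

definition tree_graph :: "'a graph \<Rightarrow> bool" where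
  "tree_graph G \<longleftrightarrow> simple_graph G \<and> connected_graph G \<and> forest G"

definition bipartite :: "'a graph \<Rightarrow> bool" where
  "bipartite G \<longleftrightarrow> (\<exists>f :: 'a \<Rightarrow> bool. \<forall>u v. {u, v} \<in> edges G \<longrightarrow> f u \<noteq> f v)"

definition chordal :: "'a graph \<Rightarrow> bool" where
  "chordal G \<longleftrightarrow> (\<forall>c. is_cycle G c \<and> 4 \<le> length c \<longrightarrow>
     (\<exists>u \<in> set c. \<exists>v \<in> set c. {u, v} \<in> edges G \<and> {u, v} \<notin> cycle_edges c))"

definition interval_graph :: "'a graph \<Rightarrow> bool" where
  "interval_graph G \<longleftrightarrow> (\<exists>l r :: 'a \<Rightarrow> real.
     (\<forall>v \<in> verts G. l v \<le> r v) \<and>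
     (\<forall>u \<in> verts G. \<forall>v \<in> verts G. u \<noteq> v \<longrightarrow>
        ({u, v} \<in> edges G \<longleftrightarrow> {l u..r u} \<inter> {l v..r v} \<noteq> {})))"


section \<open>Graph parameters\<close>

text \<open>Each \<open>LEAST\<close> below ranges over a nonempty set of numbers if the graph is finite and
  simple.\<close>

definition max_degree :: "'a graph \<Rightarrow> nat" where
  "max_degree G = Max (insert 0 (vdegree G ` verts G))"

definition degeneracy :: "'a graph \<Rightarrow> nat" where
  "degeneracy G = (LEAST d. \<forall>H. subgraph H G \<and> verts H \<noteq> {} \<longrightarrow> (\<exists>v \<in> verts H. vdegree H v \<le> d))"

definition bandwidth :: "'a graph \<Rightarrow> nat" where
  "bandwidth G = (LEAST b. \<exists>\<pi> :: 'a \<Rightarrow> nat. bij_betw \<pi> (verts G) {..<card (verts G)} \<and>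
     (\<forall>u v. {u, v} \<in> edges G \<longrightarrow> \<bar>int (\<pi> u) - int (\<pi> v)\<bar> \<le> int b))"

definition cutwidth :: "'a graph \<Rightarrow> nat" where
  "cutwidth G = (LEAST w. \<exists>\<pi> :: 'a \<Rightarrow> nat. bij_betw \<pi> (verts G) {..<card (verts G)} \<and>
     (\<forall>i. card {e \<in> edges G. \<exists>u \<in> e. \<exists>v \<in> e. \<pi> u \<le> i \<and> i < \<pi> v} \<le> w))"

definition vertex_deletion_distance :: "('a graph \<Rightarrow> bool) \<Rightarrow> 'a graph \<Rightarrow> nat" where
  "vertex_deletion_distance Q G =
     (LEAST s. \<exists>S \<subseteq> verts G. card S = s \<and> Q (del_verts G S))"

definition distance_to_bounded_degree :: "nat \<Rightarrow> 'a graph \<Rightarrow> nat" where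
  "distance_to_bounded_degree d = vertex_deletion_distance (\<lambda>H. max_degree H \<le> d)"

definition feedback_vertex_set_number :: "'a graph \<Rightarrow> nat" where
  "feedback_vertex_set_number = vertex_deletion_distance forest"

definition odd_cycle_transversal_number :: "'a graph \<Rightarrow> nat" where
  "odd_cycle_transversal_number = vertex_deletion_distance bipartite"

definition distance_to_chordal :: "'a graph \<Rightarrow> nat" where
  "distance_to_chordal = vertex_deletion_distance chordal"

definition distance_to_interval :: "'a graph \<Rightarrow> nat" where
  "distance_to_interval = vertex_deletion_distance interval_graph"

definition edge_bipartization_number :: "'a graph \<Rightarrow> nat" where
  "edge_bipartization_number G =
     (LEAST s. \<exists>F \<subseteq> edges G. card F = s \<and> bipartite (del_edges G F))"

definition vertex_cover_number :: "'a graph \<Rightarrow> nat" where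
  "vertex_cover_number G =
     (LEAST s. \<exists>S \<subseteq> verts G. card S = s \<and> (\<forall>e \<in> edges G. e \<inter> S \<noteq> {}))"

text \<open>The value is 0 for graphs without odd cycles.\<close>

definition longest_odd_cycle :: "'a graph \<Rightarrow> nat" where
  "longest_odd_cycle G = Max (insert 0 {length c | c. is_cycle G c \<and> odd (length c)})"

definition tree_decomposition :: "'a graph \<Rightarrow> nat graph \<Rightarrow> (nat \<Rightarrow> 'a set) \<Rightarrow> bool" where
  "tree_decomposition G T B \<longleftrightarrow> tree_graph T \<and>
     (\<Union>t \<in> verts T. B t) = verts G \<and>
     (\<forall>e \<in> edges G. \<exists>t \<in> verts T. e \<subseteq> B t) \<and>
     (\<forall>v \<in> verts G. connected_graph (induced T {t \<in> verts T. v \<in> B t}))"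

definition treewidth :: "'a graph \<Rightarrow> nat" where
  "treewidth G = (LEAST w. \<exists>T B. tree_decomposition G T B \<and> (\<forall>t \<in> verts T. card (B t) \<le> w + 1))"

definition path_decomposition :: "'a graph \<Rightarrow> 'a set list \<Rightarrow> bool" where
  "path_decomposition G Bs \<longleftrightarrow>
     (\<Union>B \<in> set Bs. B) = verts G \<and>
     (\<forall>e \<in> edges G. \<exists>B \<in> set Bs. e \<subseteq> B) \<and>
     (\<forall>i j l. i \<le> j \<and> j \<le> l \<and> l < length Bs \<longrightarrow> Bs ! i \<inter> Bs ! l \<subseteq> Bs ! j)"

definition pathwidth :: "'a graph \<Rightarrow> nat" where
  "pathwidth G = (LEAST w. \<exists>Bs. path_decomposition G Bs \<and> (\<forall>B \<in> set Bs. card B \<le> w + 1))"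

text \<open>\<open>P\<close> is the parent-child relation of a rooted forest on the vertices of \<open>G\<close>; its height is
  the maximum number of vertices on a path from a root.\<close>

definition elimination_forest :: "'a graph \<Rightarrow> ('a \<times> 'a) set \<Rightarrow> bool" where
  "elimination_forest G P \<longleftrightarrow>
     P \<subseteq> verts G \<times> verts G \<and> single_valued (P\<inverse>) \<and> acyclic P \<and>
     (\<forall>u v. {u, v} \<in> edges G \<longrightarrow> (u, v) \<in> P\<^sup>+ \<or> (v, u) \<in> P\<^sup>+)"

definition treedepth :: "'a graph \<Rightarrow> nat" where
  "treedepth G = (LEAST h. \<exists>P. elimination_forest G P \<and>
     (\<forall>v \<in> verts G. card {u. (u, v) \<in> P\<^sup>*} \<le> h))"


section \<open>The Clique problem\<close>

text \<open>\<open>A ! u\<close> lists the neighbours of \<open>u\<close>, in any order; the vertices are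
  \<open>0, \<dots>, length A - 1\<close>.\<close>

definition adjacency_lists :: "nat list list \<Rightarrow> bool" where
  "adjacency_lists A \<longleftrightarrow> (\<forall>u < length A. distinct (A ! u) \<and>
     (\<forall>v \<in> set (A ! u). v < length A \<and> v \<noteq> u \<and> u \<in> set (A ! v)))"

definition graph_of :: "nat list list \<Rightarrow> nat graph" where
  "graph_of A = ({..<length A}, {{u, v} | u v. u < length A \<and> v \<in> set (A ! u)})"

text \<open>
  A self-delimiting binary encoding: each list element is preceded by 1 and each list is closed
  by 0. A number below \<open>N > 1\<close> takes \<open>O(log N)\<close> bits, and every edge occurs in two adjacency
  lists, so a graph with \<open>N\<close> vertices and \<open>M\<close> edges takes \<open>O(N + M log N)\<close> bits, and so does
  the whole instance if \<open>k \<le> N\<close>.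
\<close>

fun enc_list :: "('a \<Rightarrow> bool list) \<Rightarrow> 'a list \<Rightarrow> bool list" where
  "enc_list h [] = [False]"
| "enc_list h (x # xs) = True # h x @ enc_list h xs"

fun bits :: "nat \<Rightarrow> bool list" where
  "bits n = (if n = 0 then [] else odd n # bits (n div 2))"

declare bits.simps [simp del]

definition enc_nat :: "nat \<Rightarrow> bool list" where
  "enc_nat n = enc_list (\<lambda>b. [b]) (bits n)"

definition encode :: "nat list list \<Rightarrow> nat \<Rightarrow> bool list" where
  "encode A k = enc_list (enc_list enc_nat) A @ enc_nat k"

definition encodes_instance :: "bool list \<Rightarrow> nat graph \<Rightarrow> nat \<Rightarrow> bool" where
  "encodes_instance x G k \<longleftrightarrow>
     (\<exists>A. adjacency_lists A \<and> k > 0 \<and> G = graph_of A \<and> x = encode A k)"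

text \<open>
  Most of the parameters are NP-hard to compute. As usual, the number \<open>p\<close> given with an instance
  is therefore only promised to be an upper bound on the parameter of \<open>(G, k)\<close>. Strings that do not
  encode an instance fulfil the promise and are no-instances.
\<close>

definition Clique :: "(nat graph \<Rightarrow> nat \<Rightarrow> nat) \<Rightarrow> pinstance set" where
  "Clique \<kappa> = {(x, p). \<exists>G k. encodes_instance x G k \<and> \<kappa> G k \<le> p \<and> has_clique G k}"

definition Clique_promise :: "(nat graph \<Rightarrow> nat \<Rightarrow> nat) \<Rightarrow> pinstance set" where
  "Clique_promise \<kappa> = {(x, p). \<forall>G k. encodes_instance x G k \<longrightarrow> \<kappa> G k \<le> p}"

end

theory Submission
  imports Defs
begin

text \<open>
  Call a graph \<open>D\<close>-community degenerate if every nonempty set of its edges contains an edge whose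
  ends have at most \<open>D\<close> common neighbours with respect to this set. For each of the parameters, a
  graph is \<open>D\<close>-community degenerate with \<open>D\<close> linear in the parameter, unless the parameter is one of
  the distances to chordal and to interval graphs and there is a clique of the requested size.
  Deleting such edges one by one produces at most one set of \<open>D + 2\<close> vertices for every edge, and
  every clique with at least two vertices is contained in the set of its first deleted edge.

  The kernel queries the subgraphs induced by these sets. To save queries, it either removes
  duplicates, or it merges \<open>g = (p + 1) ^ e\<close> consecutive sets into one, and it takes the shorter of the
  two lists of queries. If \<open>p ^ 3\<close> is small compared to \<open>log n\<close>, there are at most \<open>\<surd>n\<close> different
  queries of the first kind; otherwise \<open>g\<close> exceeds a constant multiple of \<open>log n ^ c\<close> if
  \<open>e \<ge> 3 * c\<close>. The parameter of a query may be any bound that is polynomial in \<open>p\<close>, so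
  the square of its length serves for all parameters and they need not be monotone.
\<close>

text \<open>Edges are peeled off instead of vertices because a small odd cycle transversal or edge
  bipartization number says nothing about degrees: complete bipartite graphs have unbounded
  degeneracy, but no edge of theirs lies in a triangle. The parameter itself is never computed. If
  peeling gets stuck at the threshold derived from \<open>p\<close>, the promise implies that the
  clique exists, and a trivial yes-instance is returned.

  Neither way to save queries suffices alone. For bounded \<open>p\<close> the groups have bounded
  size and gain only a constant factor; for large \<open>p\<close> all sets may induce different
  graphs. The power \<open>p ^ 3\<close> at which they meet comes from the encoding: a graph with
  \<open>D\<close> vertices takes at most \<open>O(D ^ 3)\<close> bits, so for fixed
  \<open>d\<close> there are at most \<open>2 ^ O((p + 1) ^ 3)\<close> different queries of the
  first kind.

  For the running time, functions are shown to be polynomial-time by closure properties; the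
  kernelization is then written as an ordinary function and never as a program.\<close>

section \<open>Tree encodings of data types\<close>

class tree_code =
  fixes tc :: "'a \<Rightarrow> dtree"

instantiation bool :: tree_code
begin
definition "tc = tree_of_bit"
instance ..
end

text \<open>Unary, like the parameter in \<open>tree_of_pinstance\<close>. Hence the size of a
  number is its value, and all numbers that occur in the computation have to stay polynomially small
  in value.\<close>

instantiation nat :: tree_code
begin
definition "tc (n::nat) = tree_of_list (\<lambda>_. Leaf) (replicate n ())"
instance ..
end

instantiation list :: (tree_code) tree_code
begin
definition "tc xs = tree_of_list tc xs"
instance ..
end

instantiation prod :: (tree_code, tree_code) tree_code
begin
definition "tc p = Node (tc (fst p)) (tc (snd p))"
instance ..
end

lemma tc_simps [simp]:
  "tc True = Node Leaf Leaf" "tc False = Leaf"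
  "tc (0::nat) = Leaf" "tc (Suc n) = Node Leaf (tc n)"
  "tc ([]::'a::tree_code list) = Leaf" "tc (x # xs) = Node (tc x) (tc xs)"
  "tc (y, z) = Node (tc y) (tc z)"
  by (simp_all add: tc_bool_def tc_nat_def tc_list_def tc_prod_def tree_of_bit_def)

lemma tc_pinstance: "tree_of_pinstance (x, p) = tc (x, p)"
  by (simp add: tc_bool_def tc_nat_def tc_list_def)

lemma tc_pinstance_list: "tree_of_list tree_of_pinstance ys = tc ys"
  by (induction ys) (use tc_pinstance in auto)

abbreviation sz :: "'a::tree_code \<Rightarrow> nat" where "sz x \<equiv> size (tc x)"

lemma sz_nat [simp]: "sz (n::nat) = n"
  by (induction n) auto

lemma sz_append [simp]: "sz (xs @ ys) = sz xs + sz ys"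
  by (induction xs) auto

lemma length_le_sz: "length xs \<le> sz xs"
  by (induction xs) auto

lemma sz_elem_le: "x \<in> set xs \<Longrightarrow> sz x \<le> sz xs"
  by (induction xs) auto

lemma sz_filter_le: "sz (filter P xs) \<le> sz xs"
  by (induction xs) auto

lemma sz_list_le: "(\<And>x. x \<in> set xs \<Longrightarrow> sz x \<le> b) \<Longrightarrow> sz xs \<le> length xs * Suc b"
proof (induction xs)
  case (Cons x xs)
  then have "sz x \<le> b" "sz xs \<le> length xs * Suc b" by auto
  then show ?case by simp
qed auto

lemma sz_bool_le: "sz (b::bool) \<le> 1"
  by (cases b) auto

lemma sz_bits: "sz (bs :: bool list) \<le> 2 * length bs"
  using sz_list_le[of bs 1] sz_bool_le by simp

lemma tc_list_eq_Leaf [simp]: "tc xs = Leaf \<longleftrightarrow> xs = []"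
  by (cases xs) auto

section \<open>Polynomially bounded functions\<close>

lemma poly_nat_mono: "m \<le> n \<Longrightarrow> poly q m \<le> poly q (n::nat)"
  by (induction q) (auto intro!: mult_le_mono add_mono)

definition poly_bounded :: "(nat \<Rightarrow> nat) \<Rightarrow> bool" where
  "poly_bounded f \<longleftrightarrow> (\<exists>q :: nat poly. \<forall>n. f n \<le> poly q n)"

lemma poly_boundedI: "(\<And>n. f n \<le> poly q n) \<Longrightarrow> poly_bounded f"
  unfolding poly_bounded_def by blast

lemma poly_bounded_poly: "poly_bounded (poly q)"
  by (rule poly_boundedI[of _ q]) simp

lemma poly_bounded_const: "poly_bounded (\<lambda>n. c)"
  by (rule poly_boundedI[of _ "[:c:]"]) simp

lemma poly_bounded_id: "poly_bounded (\<lambda>n. n)"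
  by (rule poly_boundedI[of _ "[:0, 1:]"]) simp

lemma poly_bounded_add: "poly_bounded f \<Longrightarrow> poly_bounded g \<Longrightarrow> poly_bounded (\<lambda>n. f n + g n)"
  unfolding poly_bounded_def by (metis add_mono poly_add)

lemma poly_bounded_mult: "poly_bounded f \<Longrightarrow> poly_bounded g \<Longrightarrow> poly_bounded (\<lambda>n. f n * g n)"
  unfolding poly_bounded_def by (metis mult_le_mono poly_mult)

lemma poly_bounded_Suc: "poly_bounded f \<Longrightarrow> poly_bounded (\<lambda>n. Suc (f n))"
  using poly_bounded_add[OF _ poly_bounded_const[of 1]] by simp

lemma poly_bounded_power: "poly_bounded f \<Longrightarrow> poly_bounded (\<lambda>n. f n ^ k)"
  by (induction k) (auto intro: poly_bounded_const poly_bounded_mult)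

lemma poly_bounded_comp: "poly_bounded f \<Longrightarrow> poly_bounded (\<lambda>n. poly q (f n))"
  unfolding poly_bounded_def by (metis poly_nat_mono poly_pcompose)

lemmas poly_bounded_intros =
  poly_bounded_poly poly_bounded_id poly_bounded_const poly_bounded_Suc poly_bounded_add
  poly_bounded_mult poly_bounded_power poly_bounded_comp

section \<open>Polynomial-time functions\<close>

text \<open>Register 0 holds argument and result; register 1 holds a stack that a program must restore;
  register 2 is scratch space.\<close>

definition computes :: "prog \<Rightarrow> nat poly \<Rightarrow> ('a::tree_code \<Rightarrow> 'b::tree_code) \<Rightarrow> 'a \<Rightarrow> bool" where
  "computes P q f x \<longleftrightarrow>
     (\<forall>s. s 0 = tc x \<longrightarrow> (\<exists>n s'. exec P s n s' \<and> s' 0 = tc (f x) \<and> s' 1 = s 1 \<and> n \<le> poly q (sz x)))"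

text \<open>The second conjunct does not follow from the first: as
  \<open>Mk_Node (Reg 0) (Reg 0)\<close> doubles a tree at constant cost, linear time can produce
  trees of exponential size. Composition needs a bound on the intermediate result.\<close>

definition pt :: "('a::tree_code \<Rightarrow> 'b::tree_code) \<Rightarrow> bool" where
  "pt f \<longleftrightarrow> (\<exists>P q. \<forall>x. computes P q f x) \<and> (\<exists>q :: nat poly. \<forall>x. sz (f x) \<le> poly q (sz x))"

lemma exec_AssignI: "n = cost_expr a + 1 \<Longrightarrow> s' = s(i := eval_expr a s) \<Longrightarrow> exec (Assign i a) s n s'"
  using exec_Assign by simp

lemma computesE:
  assumes "computes P q f x" "s 0 = tc x"
  obtains n s' where "exec P s n s'" "s' 0 = tc (f x)" "s' 1 = s 1" "n \<le> poly q (sz x)"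
  using assms unfolding computes_def by blast

lemma pt_sz: assumes "pt f" obtains q where "\<And>x. sz (f x) \<le> poly q (sz x)"
  using assms unfolding pt_def by blast

lemma ptE:
  assumes "pt f"
  obtains P q h where "\<And>x. computes P q f x" "\<And>x. sz (f x) \<le> poly h (sz x)"
  using assms unfolding pt_def by blast

lemma ptI:
  assumes "\<And>x s. s 0 = tc x \<Longrightarrow>
      \<exists>n s'. exec P s n s' \<and> s' 0 = tc (f x) \<and> s' 1 = s 1 \<and> n \<le> b (sz x)"
    and "poly_bounded b" and "\<And>x. sz (f x) \<le> b' (sz x)" and "poly_bounded b'"
  shows "pt f"
proof -
  obtain q q' where "\<And>n. b n \<le> poly q n" "\<And>n. b' n \<le> poly q' n"
    using assms(2,4) unfolding poly_bounded_def by blast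
  then show ?thesis
    unfolding pt_def computes_def using assms(1,3) by (meson le_trans)
qed

lemma pt_expr:
  assumes "\<And>x s. s 0 = tc x \<Longrightarrow> eval_expr e s = tc (f x)"
    and "\<And>x. sz (f x) \<le> sz x + c"
  shows "pt f"
proof (rule ptI[where P = "Assign 0 e" and b = "\<lambda>_. cost_expr e + 1" and b' = "\<lambda>n. n + c"])
  fix x :: 'a and s :: store
  assume "s 0 = tc x"
  then have "eval_expr e s = tc (f x)" by (rule assms(1))
  then show "\<exists>n s'. exec (Assign 0 e) s n s' \<and> s' 0 = tc (f x) \<and> s' 1 = s 1 \<and> n \<le> cost_expr e + 1"
    by (intro exI[of _ "cost_expr e + 1"] exI[of _ "s(0 := tc (f x))"] conjI exec_AssignI) auto
qed (use assms(2) in \<open>auto intro!: poly_bounded_intros\<close>)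

lemma pt_id: "pt (\<lambda>x. x)"
  by (rule pt_expr[where e = "Reg 0" and c = 0]) auto

fun const_expr :: "dtree \<Rightarrow> expr" where
  "const_expr Leaf = Const_Leaf"
| "const_expr (Node a b) = Mk_Node (const_expr a) (const_expr b)"

lemma eval_const_expr: "eval_expr (const_expr t) s = t"
  by (induction t) auto

lemma pt_const: "pt (\<lambda>x. c)"
  by (rule pt_expr[where e = "const_expr (tc c)" and c = "sz c"]) (auto simp: eval_const_expr)

lemma pt_comp:
  assumes "pt g" "pt f"
  shows "pt (\<lambda>x. g (f x))"
proof -
  obtain P q k where P: "\<And>x. computes P q g x" and k: "\<And>x. sz (g x) \<le> poly k (sz x)"
    using ptE[OF assms(1)] by blast
  obtain Q r h where Q: "\<And>x. computes Q r f x" and h: "\<And>x. sz (f x) \<le> poly h (sz x)"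
    using ptE[OF assms(2)] by blast
  show ?thesis
  proof (rule ptI[where P = "Seq Q P" and b = "\<lambda>n. poly r n + poly q (poly h n)"
        and b' = "\<lambda>n. poly k (poly h n)"])
    fix x :: 'c and s :: store
    assume "s 0 = tc x"
    then obtain n s' where 1: "exec Q s n s'" "s' 0 = tc (f x)" "s' 1 = s 1" "n \<le> poly r (sz x)"
      by (rule computesE[OF Q])
    then obtain m s'' where 2: "exec P s' m s''" "s'' 0 = tc (g (f x))" "s'' 1 = s' 1"
      "m \<le> poly q (sz (f x))"
      using computesE[OF P] by blast
    have "m \<le> poly q (poly h (sz x))" using 2(4) h poly_nat_mono le_trans by blast
    then show "\<exists>n s'. exec (Seq Q P) s n s' \<and> s' 0 = tc (g (f x)) \<and> s' 1 = s 1 \<and>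
        n \<le> poly r (sz x) + poly q (poly h (sz x))"
      using exec_Seq[OF 1(1) 2(1)] 1 2 by (metis add_mono)
  next
    fix x :: 'c
    show "sz (g (f x)) \<le> poly k (poly h (sz x))"
      using k h poly_nat_mono le_trans by blast
  qed (intro poly_bounded_intros; fail)+
qed

lemma pt_pair:
  assumes "pt f" "pt g"
  shows "pt (\<lambda>x. (f x, g x))"
proof -
  obtain P q h where P: "\<And>x. computes P q f x" and h: "\<And>x. sz (f x) \<le> poly h (sz x)"
    using ptE[OF assms(1)] by blast
  obtain Q r k where Q: "\<And>x. computes Q r g x" and k: "\<And>x. sz (g x) \<le> poly k (sz x)"
    using ptE[OF assms(2)] by blast
  \<comment> \<open>A run may destroy every register except the stack, so \<open>x\<close> is kept
    there during \<open>P\<close>, and \<open>f x\<close> takes its place during \<open>Q\<close>.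
    Register 2 holds \<open>x\<close> only for this exchange.\<close>
  define push where "push = Assign 1 (Mk_Node (Reg 0) (Reg 1))"
  define save where "save = Assign 2 (Head (Reg 1))"
  define swap where "swap = Assign 1 (Mk_Node (Reg 0) (Tail (Reg 1)))"
  define load where "load = Assign 0 (Reg 2)"
  define join where "join = Assign 0 (Mk_Node (Head (Reg 1)) (Reg 0))"
  define pop where "pop = Assign 1 (Tail (Reg 1))"
  define R where "R = Seq push (Seq P (Seq save (Seq swap (Seq load (Seq Q (Seq join pop))))))"
  show ?thesis
  proof (rule ptI[where P = R and b = "\<lambda>n. 40 + poly q n + poly r n"
        and b' = "\<lambda>n. Suc (poly h n + poly k n)"])
    fix x :: 'a and s :: store
    assume s: "s 0 = tc x"
    define s1 where "s1 = s(1 := Node (s 0) (s 1))"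
    have e1: "exec push s 4 s1"
      unfolding push_def by (intro exec_AssignI) (auto simp: s1_def)
    have "s1 0 = tc x" using s by (simp add: s1_def)
    then obtain n s2 where e2: "exec P s1 n s2" "s2 0 = tc (f x)" "s2 1 = s1 1" "n \<le> poly q (sz x)"
      by (rule computesE[OF P])
    define s3 where "s3 = s2(2 := tc x)"
    have e3: "exec save s2 3 s3"
      using e2(3) s unfolding save_def by (intro exec_AssignI) (auto simp: s3_def s1_def)
    define s4 where "s4 = s3(1 := Node (tc (f x)) (s 1))"
    have e4: "exec swap s3 5 s4"
      using e2(2,3) unfolding swap_def by (intro exec_AssignI) (auto simp: s4_def s3_def s1_def)
    define s5 where "s5 = s4(0 := tc x)"
    have e5: "exec load s4 2 s5"
      unfolding load_def by (intro exec_AssignI) (auto simp: s5_def s4_def s3_def)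
    have "s5 0 = tc x" by (simp add: s5_def)
    then obtain m s6 where e6: "exec Q s5 m s6" "s6 0 = tc (g x)" "s6 1 = s5 1" "m \<le> poly r (sz x)"
      by (rule computesE[OF Q])
    define s7 where "s7 = s6(0 := tc (f x, g x))"
    have e7: "exec join s6 5 s7"
      using e6(2,3) unfolding join_def by (intro exec_AssignI) (auto simp: s7_def s5_def s4_def)
    define s8 where "s8 = s7(1 := s 1)"
    have e8: "exec pop s7 3 s8"
      using e6(2,3) unfolding pop_def by (intro exec_AssignI) (auto simp: s8_def s7_def s5_def s4_def)
    have "exec R s (4 + (n + (3 + (5 + (2 + (m + (5 + 3))))))) s8"
      unfolding R_def
      by (rule exec_Seq[OF e1 exec_Seq[OF e2(1) exec_Seq[OF e3 exec_Seq[OF e4 exec_Seq[OF e5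
        exec_Seq[OF e6(1) exec_Seq[OF e7 e8]]]]]]])
    moreover have "s8 0 = tc (f x, g x)" "s8 1 = s 1" by (simp_all add: s8_def s7_def)
    ultimately show "\<exists>n s'. exec R s n s' \<and> s' 0 = tc (f x, g x) \<and> s' 1 = s 1 \<and>
        n \<le> 40 + poly q (sz x) + poly r (sz x)"
      using e2(4) e6(4) by (intro exI[of _ "4 + (n + (3 + (5 + (2 + (m + (5 + 3))))))"] exI[of _ s8]) auto
  next
    fix x :: 'a
    show "sz (f x, g x) \<le> Suc (poly h (sz x) + poly k (sz x))"
      using h[of x] k[of x] by simp
  qed (intro poly_bounded_intros; fail)+
qed

lemma pt_fst: "pt f \<Longrightarrow> pt (\<lambda>x. fst (f x))"
  by (rule pt_comp[OF pt_expr[where e = "Head (Reg 0)" and c = 0]]) (auto simp: tc_prod_def)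

lemma pt_snd: "pt f \<Longrightarrow> pt (\<lambda>x. snd (f x))"
  by (rule pt_comp[OF pt_expr[where e = "Tail (Reg 0)" and c = 0]]) (auto simp: tc_prod_def)

lemma pt_Cons: assumes "pt f" "pt g" shows "pt (\<lambda>x. f x # g x)"
proof -
  have "pt (\<lambda>p :: 'b \<times> 'b list. fst p # snd p)"
    by (rule pt_expr[where e = "Reg 0" and c = 0]) (auto simp: tc_prod_def)
  from pt_comp[OF this pt_pair[OF assms]] show ?thesis by simp
qed

lemma pt_Suc: "pt f \<Longrightarrow> pt (\<lambda>x. Suc (f x))"
proof (erule pt_comp[rotated])
  show "pt Suc"
    by (rule pt_expr[where e = "Mk_Node Const_Leaf (Reg 0)" and c = 1]) auto
qed

lemma pt_pred: "pt f \<Longrightarrow> pt (\<lambda>x. f x - Suc 0)"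
proof (erule pt_comp[rotated])
  show "pt (\<lambda>n. n - Suc 0)"
  proof (rule pt_expr[where e = "Tail (Reg 0)" and c = 0])
    show "s 0 = tc n \<Longrightarrow> eval_expr (Tail (Reg 0)) s = tc (n - Suc 0)" for n s
      by (cases n) auto
  qed auto
qed

lemma pt_tl: "pt f \<Longrightarrow> pt (\<lambda>x. tl (f x))"
proof (erule pt_comp[rotated])
  show "pt (tl :: 'b list \<Rightarrow> 'b list)"
  proof (rule pt_expr[where e = "Tail (Reg 0)" and c = 0])
    show "s 0 = tc x \<Longrightarrow> eval_expr (Tail (Reg 0)) s = tc (tl x)" for x :: "'b list" and s
      by (cases x) auto
    show "sz (tl x) \<le> sz x + 0" for x :: "'b list" by (cases x) auto
  qed
qed

lemma pt_if:
  assumes "pt b" "pt f" "pt g"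
  shows "pt (\<lambda>x. if b x then f x else g x)"
proof -
  obtain P q h where P: "\<And>x. computes P q f x" and h: "\<And>x. sz (f x) \<le> poly h (sz x)"
    using ptE[OF assms(2)] by blast
  obtain Q r k where Q: "\<And>x. computes Q r g x" and k: "\<And>x. sz (g x) \<le> poly k (sz x)"
    using ptE[OF assms(3)] by blast
  define arg where "arg = Assign 0 (Tail (Reg 0))"
  define R where "R = If (Head (Reg 0)) (Seq arg P) (Seq arg Q)"
  have "pt (\<lambda>z :: bool \<times> 'a. if fst z then f (snd z) else g (snd z))"
  proof (rule ptI[where P = R and b = "\<lambda>n. 10 + poly q n + poly r n"
        and b' = "\<lambda>n. poly h n + poly k n"])
    fix z :: "bool \<times> 'a" and s :: store
    assume s: "s 0 = tc z"
    obtain c x where z: "z = (c, x)" by force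
    define s1 where "s1 = s(0 := tc x)"
    have e1: "exec arg s 3 s1"
      using s unfolding arg_def by (intro exec_AssignI) (auto simp: s1_def z)
    have s1: "s1 0 = tc x" "s1 1 = s 1" by (simp_all add: s1_def)
    have le: "sz x \<le> sz z" by (simp add: z)
    show "\<exists>n s'. exec R s n s' \<and> s' 0 = tc (if fst z then f (snd z) else g (snd z)) \<and> s' 1 = s 1 \<and>
        n \<le> 10 + poly q (sz z) + poly r (sz z)"
    proof (cases c)
      case True
      obtain n s2 where e2: "exec P s1 n s2" "s2 0 = tc (f x)" "s2 1 = s1 1" "n \<le> poly q (sz x)"
        by (rule computesE[where s = s1, OF P s1(1)])
      have "exec R s (2 + (3 + n) + 1) s2"
        using exec_If_True[OF _ exec_Seq[OF e1 e2(1)], of "Head (Reg 0)"] True s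
        by (simp add: R_def z)
      moreover have "2 + (3 + n) + 1 \<le> 10 + poly q (sz z) + poly r (sz z)"
        using e2(4) poly_nat_mono[OF le, of q] by linarith
      ultimately show ?thesis using True e2 s1
        by (intro exI[of _ "2 + (3 + n) + 1"] exI[of _ s2]) (auto simp: z)
    next
      case False
      obtain n s2 where e2: "exec Q s1 n s2" "s2 0 = tc (g x)" "s2 1 = s1 1" "n \<le> poly r (sz x)"
        by (rule computesE[where s = s1, OF Q s1(1)])
      have "exec R s (2 + (3 + n) + 1) s2"
        using exec_If_False[OF _ exec_Seq[OF e1 e2(1)], of "Head (Reg 0)"] False s
        by (simp add: R_def z)
      moreover have "2 + (3 + n) + 1 \<le> 10 + poly q (sz z) + poly r (sz z)"
        using e2(4) poly_nat_mono[OF le, of r] by linarith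
      ultimately show ?thesis using False e2 s1
        by (intro exI[of _ "2 + (3 + n) + 1"] exI[of _ s2]) (auto simp: z)
    qed
  next
    fix z :: "bool \<times> 'a"
    have le: "sz (snd z) \<le> sz z" by (cases z) simp
    show "sz (if fst z then f (snd z) else g (snd z)) \<le> poly h (sz z) + poly k (sz z)"
      using h[of "snd z"] k[of "snd z"] poly_nat_mono[OF le, of h] poly_nat_mono[OF le, of k] by auto
  qed (intro poly_bounded_intros; fail)+
  from pt_comp[OF this pt_pair[OF assms(1) pt_id]] show ?thesis by (simp cong: if_cong)
qed

lemma exec_IfI:
  assumes "eval_expr a s \<noteq> Leaf \<Longrightarrow> exec P s n s'" "eval_expr a s = Leaf \<Longrightarrow> exec Q s n s'"
    and "m = cost_expr a + n + 1"
  shows "exec (If a P Q) s m s'"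
  using assms exec_If_True exec_If_False by metis

lemma pt_is_Nil: "pt f \<Longrightarrow> pt (\<lambda>x. f x = [])"
proof (erule pt_comp[rotated])
  define R where "R = If (Reg 0) (Assign 0 (Head (Mk_Node Const_Leaf Const_Leaf)))
    (Assign 0 (Mk_Node Const_Leaf Const_Leaf))"
  show "pt (\<lambda>l :: 'b list. l = [])"
  proof (rule ptI[where P = R and b = "\<lambda>n. 10" and b' = "\<lambda>n. 1"])
    fix l :: "'b list" and s :: store
    assume s: "s 0 = tc l"
    have "exec (Assign 0 (Head (Mk_Node Const_Leaf Const_Leaf))) s 5 (s(0 := tc (l = [])))" if "l \<noteq> []"
      using that by (intro exec_AssignI) auto
    moreover have "exec (Assign 0 (Mk_Node Const_Leaf Const_Leaf)) s 4 (s(0 := tc (l = [])))" if "l = []"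
      using that by (intro exec_AssignI) auto
    ultimately have "exec R s (if l = [] then 6 else 7) (s(0 := tc (l = [])))"
      unfolding R_def by (cases "l = []") (use s in \<open>auto intro!: exec_IfI\<close>)
    then show "\<exists>n s'. exec R s n s' \<and> s' 0 = tc (l = []) \<and> s' 1 = s 1 \<and> n \<le> 10"
      by (intro exI conjI, assumption) auto
  qed (rule sz_bool_le poly_bounded_const)+
qed

lemma pt_hd: "pt f \<Longrightarrow> pt (\<lambda>x. hd (f x))"
proof (erule pt_comp[rotated])
  \<comment> \<open>\<open>hd []\<close> is a fixed but unknown value. Its code becomes a constant
    of the program, which thus agrees with \<open>hd\<close> on the empty list as well.\<close>
  define d where "d = (hd [] :: 'b)"
  define c where "c = cost_expr (const_expr (tc d))"
  define R where "R = If (Reg 0) (Assign 0 (Head (Reg 0))) (Assign 0 (const_expr (tc d)))"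
  show "pt (hd :: 'b list \<Rightarrow> 'b)"
  proof (rule ptI[where P = R and b = "\<lambda>n. 10 + c" and b' = "\<lambda>n. n + sz d"])
    fix l :: "'b list" and s :: store
    assume s: "s 0 = tc l"
    have "exec R s (if l = [] then c + 3 else 5) (s(0 := tc (hd l)))"
    proof (cases "l = []")
      case True
      then have "exec (Assign 0 (const_expr (tc d))) s (c + 1) (s(0 := tc (hd l)))"
        by (intro exec_AssignI) (auto simp: c_def d_def eval_const_expr)
      then show ?thesis unfolding R_def using True s by (auto intro!: exec_IfI)
    next
      case False
      then have "exec (Assign 0 (Head (Reg 0))) s 3 (s(0 := tc (hd l)))"
        by (intro exec_AssignI) (use s in \<open>auto simp: neq_Nil_conv\<close>)
      then show ?thesis unfolding R_def using False s by (auto intro!: exec_IfI)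
    qed
    then show "\<exists>n s'. exec R s n s' \<and> s' 0 = tc (hd l) \<and> s' 1 = s 1 \<and> n \<le> 10 + c"
      by (intro exI conjI, assumption) auto
  next
    fix l :: "'b list"
    show "sz (hd l) \<le> sz l + sz d" by (cases l) (auto simp: d_def)
  qed (intro poly_bounded_intros; fail)+
qed

lemma pt_let:
  assumes "pt f" "pt (\<lambda>z. g (fst z) (snd z))"
  shows "pt (\<lambda>x. let y = f x in g x y)"
  using pt_comp[OF assms(2) pt_pair[OF pt_id assms(1)]] by (simp add: Let_def)

lemma pt_not: assumes "pt f" shows "pt (\<lambda>x. \<not> f x)"
  by (rule back_subst[of pt, OF pt_if[OF assms pt_const[of False] pt_const[of True]]]) auto

lemma pt_conj: assumes "pt f" "pt g" shows "pt (\<lambda>x. f x \<and> g x)"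
  by (rule back_subst[of pt, OF pt_if[OF assms pt_const[of False]]]) auto

lemma pt_disj: assumes "pt f" "pt g" shows "pt (\<lambda>x. f x \<or> g x)"
  by (rule back_subst[of pt, OF pt_if[OF assms(1) pt_const[of True] assms(2)]]) auto

section \<open>Loops over lists\<close>

text \<open>All other iterations reduce to this one loop. A polynomial-time \<open>step\<close>
  alone does not suffice, since a step that doubles its accumulator would reach exponential size;
  the bound \<open>b\<close> on the accumulators of all prefixes excludes this.\<close>

lemma pt_foldl:
  fixes step :: "'x::tree_code \<Rightarrow> 'acc::tree_code \<Rightarrow> 'a::tree_code \<Rightarrow> 'acc"
  assumes step: "pt (\<lambda>z. step (fst z) (fst (snd z)) (snd (snd z)))"
    and init: "pt init" and l: "pt l"
    and b: "poly_bounded b" "\<And>x i. sz (foldl (step x) (init x) (take i (l x))) \<le> b (sz x)"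
  shows "pt (\<lambda>x. foldl (step x) (init x) (l x))"
proof -
  define body where "body = (\<lambda>(r :: 'a list, x, acc). (tl r, x, step x acc (hd r)))"
  have "pt (\<lambda>z. (tl (fst z), fst (snd z), step (fst (snd z)) (snd (snd z)) (hd (fst z))))"
    by (intro pt_pair pt_tl pt_fst pt_snd pt_id)
      (use pt_comp[OF step, of "\<lambda>z. (fst (snd z), snd (snd z), hd (fst z))"] in
        \<open>simp add: pt_pair pt_fst pt_snd pt_hd pt_id\<close>)
  then have "pt body" by (simp add: body_def case_prod_unfold)
  then obtain P q where P: "\<And>x. computes P q body x" by (rule ptE) (rule that)
  obtain h where h: "\<And>x. sz (l x) \<le> poly h (sz x)" using pt_sz[OF l] by blast
  \<comment> \<open>The head of the state is the code of the remaining list, which is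
    \<open>Leaf\<close> exactly if the list is empty.\<close>
  define R where "R = While (Head (Reg 0)) P"
  have "pt (\<lambda>x. (l x, x, init x))" by (intro pt_pair pt_id l init)
  then obtain Q r where Q: "\<And>x. computes Q r (\<lambda>x. (l x, x, init x)) x" by (rule ptE) (rule that)
  \<comment> \<open>\<open>B\<close> bounds the sizes of the current and all later states, so every
    round costs at most \<open>poly q B\<close> plus a constant.\<close>
  have loop: "\<exists>n s'. exec R s n s' \<and> s' 0 = tc ([] :: 'a list, x, foldl (step x) acc k) \<and> s' 1 = s 1 \<and>
      n \<le> length k * (poly q B + 4) + 4"
    if "s 0 = tc (k, x, acc)"
      "\<And>i. sz (drop i k, x, foldl (step x) acc (take i k)) \<le> B" for s k x acc B
    using that
  proof (induction k arbitrary: s acc)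
    case Nil
    then have "exec R s (cost_expr (Head (Reg 0)) + 1) s"
      unfolding R_def by (intro exec_While_False) simp
    with Nil show ?case by (intro exI[of _ "cost_expr (Head (Reg 0)) + 1"] exI[of _ s]) auto
  next
    case (Cons a k)
    obtain n s' where 1: "exec P s n s'" "s' 0 = tc (k, x, step x acc a)" "s' 1 = s 1"
      "n \<le> poly q (sz (a # k, x, acc))"
      by (rule computesE[where s = s, OF P Cons.prems(1)]) (simp add: body_def)
    have "sz (drop i k, x, foldl (step x) (step x acc a) (take i k)) \<le> B" for i
      using Cons.prems(2)[of "Suc i"] by simp
    then obtain m s'' where 2: "exec R s' m s''"
      "s'' 0 = tc ([] :: 'a list, x, foldl (step x) (step x acc a) k)"
      "s'' 1 = s' 1" "m \<le> length k * (poly q B + 4) + 4"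
      using Cons.IH[of s' "step x acc a"] 1(2) by blast
    have "tc (a # k) \<noteq> Leaf" by simp
    then have "exec R s (cost_expr (Head (Reg 0)) + n + m + 1) s''"
      unfolding R_def using Cons.prems(1) 1(1) 2(1)
      by (intro exec_While_True) (auto simp: R_def)
    moreover have "n \<le> poly q B"
      using 1(4) Cons.prems(2)[of 0] poly_nat_mono[of "sz (a # k, x, acc)" B q] by simp
    ultimately show ?case
      using 1 2 by (intro exI[of _ "cost_expr (Head (Reg 0)) + n + m + 1"] exI[of _ s'']) auto
  qed
  have main: "pt (\<lambda>x. ([] :: 'a list, x, foldl (step x) (init x) (l x)))"
  proof (rule ptI[where P = "Seq Q R"
        and b = "\<lambda>n. poly r n + (poly h n * (poly q (poly h n + n + b n + 2) + 4) + 4)"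
        and b' = "\<lambda>n. n + b n + 2"])
    fix x :: 'x and s :: store
    assume "s 0 = tc x"
    then obtain n s' where 1: "exec Q s n s'" "s' 0 = tc (l x, x, init x)" "s' 1 = s 1"
      "n \<le> poly r (sz x)"
      by (rule computesE[OF Q])
    have "sz (drop i (l x)) \<le> sz (l x)" for i
      using sz_append[of "take i (l x)" "drop i (l x)"] by simp
    then have "sz (drop i (l x)) \<le> poly h (sz x)" for i
      using h le_trans by blast
    then have "sz (drop i (l x), x, foldl (step x) (init x) (take i (l x))) \<le>
        poly h (sz x) + sz x + b (sz x) + 2" for i
      using add_mono[OF _ b(2)[of x i]] by simp
    from loop[of s' "l x" x "init x", OF 1(2) this] obtain m s'' where 2: "exec R s' m s''"
      "s'' 0 = tc ([] :: 'a list, x, foldl (step x) (init x) (l x))" "s'' 1 = s' 1"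
      "m \<le> length (l x) * (poly q (poly h (sz x) + sz x + b (sz x) + 2) + 4) + 4" by blast
    have "length (l x) \<le> poly h (sz x)" using length_le_sz h le_trans by blast
    then have "m \<le> poly h (sz x) * (poly q (poly h (sz x) + sz x + b (sz x) + 2) + 4) + 4"
      using 2(4) by (meson add_mono le_trans mult_le_mono1 order_refl)
    with 1 2 show "\<exists>n s'. exec (Seq Q R) s n s' \<and>
        s' 0 = tc ([] :: 'a list, x, foldl (step x) (init x) (l x)) \<and> s' 1 = s 1 \<and>
        n \<le> poly r (sz x) + (poly h (sz x) * (poly q (poly h (sz x) + sz x + b (sz x) + 2) + 4) + 4)"
      using exec_Seq[OF 1(1) 2(1)] by (intro exI[of _ "n + m"] exI[of _ s'']) auto
  next
    fix x
    show "sz ([] :: 'a list, x, foldl (step x) (init x) (l x)) \<le> sz x + b (sz x) + 2"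
      using b(2)[of x "length (l x)"] by simp
  qed (intro poly_bounded_intros b(1); fail)+
  from pt_snd[OF pt_snd[OF main]] show ?thesis by simp
qed

lemma polytime_if_pt:
  assumes "pt K" shows "polytime K"
proof -
  obtain P q where P: "\<And>x. computes P q K x" using assms by (rule ptE) (rule that)
  \<comment> \<open>The passage from tree size to \<open>length x + p\<close>: a bit takes at most
    two nodes, one of them in the spine of the list, and the pair takes one more.\<close>
  have "poly_bounded (\<lambda>n. poly q (2 * n + 1))" by (intro poly_bounded_intros)
  then obtain r where r: "\<And>n. poly q (2 * n + 1) \<le> poly r n" unfolding poly_bounded_def by blast
  have "\<exists>n s. exec P ((\<lambda>_. Leaf)(0 := tree_of_pinstance (x, p))) n s \<and>
      s 0 = tree_of_list tree_of_pinstance (K (x, p)) \<and> n \<le> poly r (length x + p)" for x p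
  proof -
    define s0 :: store where "s0 = (\<lambda>_. Leaf)(0 := tree_of_pinstance (x, p))"
    have "s0 0 = tc (x, p)" unfolding s0_def tc_pinstance by simp
    then obtain n s where "exec P s0 n s" "s 0 = tc (K (x, p))" and n: "n \<le> poly q (sz (x, p))"
      by (rule computesE[OF P])
    moreover have "n \<le> poly r (length x + p)"
    proof -
      have "sz (x, p) \<le> 2 * (length x + p) + 1" using sz_bits[of x] by simp
      from order_trans[OF n order_trans[OF poly_nat_mono[OF this] r]] show ?thesis .
    qed
    ultimately show ?thesis unfolding tc_pinstance_list s0_def by (intro exI[of _ n] exI[of _ s]) simp
  qed
  then show ?thesis
    unfolding polytime_def by (intro exI[of _ P] exI[of _ r] allI)
qed

text \<open>If a step adds an amount that depends on \<open>x\<close> but not on the accumulator,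
  the total growth is at most this amount times the length of the list.\<close>

lemma pt_foldl_incr:
  fixes step :: "'x::tree_code \<Rightarrow> 'acc::tree_code \<Rightarrow> 'a::tree_code \<Rightarrow> 'acc"
  assumes step: "pt (\<lambda>z. step (fst z) (fst (snd z)) (snd (snd z)))"
    and init: "pt init" and l: "pt l"
    and r: "poly_bounded r"
      "\<And>x acc a. a \<in> set (l x) \<Longrightarrow> sz (step x acc a) \<le> sz acc + r (sz x)"
  shows "pt (\<lambda>x. foldl (step x) (init x) (l x))"
proof -
  obtain h where h: "\<And>x. sz (l x) \<le> poly h (sz x)" using pt_sz[OF l] by blast
  obtain k where k: "\<And>x. sz (init x) \<le> poly k (sz x)" using pt_sz[OF init] by blast
  have *: "sz (foldl (step x) acc xs) \<le> sz acc + length xs * r (sz x)"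
    if "set xs \<subseteq> set (l x)" for x acc xs
    using that
  proof (induction xs arbitrary: acc)
    case (Cons a xs)
    then have "sz (foldl (step x) (step x acc a) xs) \<le> sz (step x acc a) + length xs * r (sz x)"
      by simp
    also have "sz (step x acc a) \<le> sz acc + r (sz x)" using Cons.prems r(2) by simp
    finally show ?case by simp
  qed simp
  have "sz (foldl (step x) (init x) (take i (l x))) \<le> poly k (sz x) + poly h (sz x) * r (sz x)" for x i
  proof -
    have "length (take i (l x)) \<le> poly h (sz x)"
      using length_le_sz[of "l x"] h[of x] by simp
    then have "length (take i (l x)) * r (sz x) \<le> poly h (sz x) * r (sz x)" by (rule mult_le_mono1)
    with *[of "take i (l x)" x "init x"] k[of x] show ?thesis
      using set_take_subset[of i "l x"] by linarith
  qed
  then show ?thesis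
    by (intro pt_foldl[where b = "\<lambda>n. poly k n + poly h n * r n"] assms poly_bounded_intros)
qed

section \<open>Standard list operations\<close>

lemma pt_comp2:
  assumes "pt (\<lambda>z. f (fst z) (snd z))" "pt a" "pt b"
  shows "pt (\<lambda>x. f (a x) (b x))"
  using pt_comp[OF assms(1) pt_pair[OF assms(2,3)]] by simp

lemma foldl_Cons: "foldl (\<lambda>acc a. a # acc) ys xs = rev xs @ ys"
  by (induction xs arbitrary: ys) auto

lemma foldl_Cons_rev: "foldl (\<lambda>acc a. f a # acc) ys xs = rev (map f xs) @ ys"
  by (induction xs arbitrary: ys) auto

lemma pt_rev: assumes "pt l" shows "pt (\<lambda>x. rev (l x))"
proof -
  obtain h where h: "\<And>x. sz (l x) \<le> poly h (sz x)" using pt_sz[OF assms] by blast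
  have "pt (\<lambda>x. foldl (\<lambda>acc a. a # acc) [] (l x))"
  proof (rule pt_foldl_incr[where r = "\<lambda>n. poly h n + 1"])
    fix x and acc and a
    assume "a \<in> set (l x)"
    then show "sz (a # acc) \<le> sz acc + (poly h (sz x) + 1)"
      using sz_elem_le[of a "l x"] h[of x] by simp
  qed (intro pt_Cons pt_fst pt_snd pt_id pt_const assms poly_bounded_intros)+
  then show ?thesis by (simp add: foldl_Cons)
qed

lemma pt_map:
  assumes f: "pt (\<lambda>z. f (fst z) (snd z))" and l: "pt l"
  shows "pt (\<lambda>x. map (f x) (l x))"
proof -
  obtain q where q: "\<And>x a. sz (f x a) \<le> poly q (sz (x, a))"
  proof -
    from pt_sz[OF f] obtain q where "\<And>z. sz (f (fst z) (snd z)) \<le> poly q (sz z)" by blast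
    from this[of "(_, _)"] that[of q] show ?thesis by simp
  qed
  obtain h where h: "\<And>x. sz (l x) \<le> poly h (sz x)" using pt_sz[OF l] by blast
  have "pt (\<lambda>x. foldl (\<lambda>acc a. f x a # acc) [] (l x))"
  proof (rule pt_foldl_incr[where r = "\<lambda>n. poly q (n + poly h n + 1) + 1"])
    show "pt (\<lambda>z. f (fst z) (snd (snd z)) # fst (snd z))"
      by (intro pt_Cons pt_comp2[OF f] pt_fst pt_snd pt_id)
    fix x and acc :: "'c list" and a
    assume "a \<in> set (l x)"
    then have "sz (x, a) \<le> sz x + poly h (sz x) + 1"
      using sz_elem_le[of a "l x"] h[of x] by simp
    then have "sz (f x a) \<le> poly q (sz x + poly h (sz x) + 1)"
      by (rule order_trans[OF q poly_nat_mono])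
    then show "sz (f x a # acc) \<le> sz acc + (poly q (sz x + poly h (sz x) + 1) + 1)"
      by simp
  qed (intro pt_const l poly_bounded_intros)+
  from pt_rev[OF this] show ?thesis by (simp add: foldl_Cons_rev)
qed

lemma pt_filter:
  assumes P: "pt (\<lambda>z. P (fst z) (snd z))" and l: "pt l"
  shows "pt (\<lambda>x. filter (P x) (l x))"
proof -
  obtain h where h: "\<And>x. sz (l x) \<le> poly h (sz x)" using pt_sz[OF l] by blast
  have *: "foldl (\<lambda>acc a. if Q a then a # acc else acc) ys xs = rev (filter Q xs) @ ys" for Q ys and xs :: "'b list"
    by (induction xs arbitrary: ys) auto
  have "pt (\<lambda>x. foldl (\<lambda>acc a. if P x a then a # acc else acc) [] (l x))"
  proof (rule pt_foldl_incr[where r = "\<lambda>n. poly h n + 1"])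
    show "pt (\<lambda>z. if P (fst z) (snd (snd z)) then snd (snd z) # fst (snd z) else fst (snd z))"
      by (intro pt_if pt_comp2[OF P] pt_Cons pt_fst pt_snd pt_id)
    fix x and acc :: "'b list" and a
    assume "a \<in> set (l x)"
    then show "sz (if P x a then a # acc else acc) \<le> sz acc + (poly h (sz x) + 1)"
      using sz_elem_le[of a "l x"] h[of x] by simp
  qed (intro pt_const l poly_bounded_intros)+
  from pt_rev[OF this] show ?thesis by (simp add: *)
qed

lemma pt_append: assumes "pt f" "pt g" shows "pt (\<lambda>x. f x @ g x)"
proof -
  obtain h where h: "\<And>x. sz (f x) \<le> poly h (sz x)" using pt_sz[OF assms(1)] by blast
  have "pt (\<lambda>x. foldl (\<lambda>acc a. a # acc) (g x) (rev (f x)))"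
  proof (rule pt_foldl_incr[where r = "\<lambda>n. poly h n + 1"])
    fix x and acc and a
    assume "a \<in> set (rev (f x))"
    then show "sz (a # acc) \<le> sz acc + (poly h (sz x) + 1)"
      using sz_elem_le[of a "f x"] h[of x] by simp
  qed (intro pt_Cons pt_fst pt_snd pt_id pt_rev assms poly_bounded_intros)+
  then show ?thesis by (simp add: foldl_Cons)
qed

lemma pt_concat: assumes "pt l" shows "pt (\<lambda>x. concat (l x))"
proof -
  obtain h where h: "\<And>x. sz (l x) \<le> poly h (sz x)" using pt_sz[OF assms] by blast
  have *: "foldl (\<lambda>acc a. acc @ a) ys xs = ys @ concat xs" for ys :: "'b list" and xs
    by (induction xs arbitrary: ys) auto
  have "pt (\<lambda>x. foldl (\<lambda>acc a. acc @ a) [] (l x))"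
  proof (rule pt_foldl_incr[where r = "\<lambda>n. poly h n"])
    fix x and acc and a
    assume "a \<in> set (l x)"
    then show "sz (acc @ a) \<le> sz acc + poly h (sz x)"
      using sz_elem_le[of a "l x"] h[of x] by simp
  qed (intro pt_append pt_fst pt_snd pt_id pt_const assms poly_bounded_intros)+
  then show ?thesis using *[of "[]"] by simp
qed

lemma pt_Bex:
  assumes "pt (\<lambda>z. P (fst z) (snd z))" "pt l"
  shows "pt (\<lambda>x. \<exists>a\<in>set (l x). P x a)"
  by (rule back_subst[of pt, OF pt_not[OF pt_is_Nil[OF pt_filter[OF assms]]]])
    (auto simp: filter_empty_conv)

lemma pt_Ball:
  assumes "pt (\<lambda>z. P (fst z) (snd z))" "pt l"
  shows "pt (\<lambda>x. \<forall>a\<in>set (l x). P x a)"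
  by (rule back_subst[of pt, OF pt_not[OF pt_Bex[OF pt_not[OF assms(1)] assms(2)]]]) auto

subsection \<open>Natural numbers\<close>

text \<open>Since a unary number and the list of as many zeros are the same tree, a counting loop is
  a fold over a list that costs nothing to produce.\<close>

lemma tc_replicate_zero: "tc (replicate n (0::nat)) = tc n"
  by (induction n) auto

lemma pt_replicate: "pt f \<Longrightarrow> pt (\<lambda>x. replicate (f x) (0::nat))"
  by (rule pt_comp[OF pt_expr[where e = "Reg 0" and c = 0]]) (auto simp: tc_replicate_zero)

lemma foldl_replicate: "foldl (\<lambda>acc _. f acc) a (replicate n z) = (f ^^ n) a"
  by (induction n arbitrary: a) (simp_all add: funpow_Suc_right del: funpow.simps(2))

lemma pt_funpow_incr:
  fixes f :: "'x::tree_code \<Rightarrow> 'acc::tree_code \<Rightarrow> 'acc"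
  assumes f: "pt (\<lambda>z. f (fst z) (snd z))" and "pt a" "pt k"
    and "poly_bounded r" "\<And>x acc. sz (f x acc) \<le> sz acc + r (sz x)"
  shows "pt (\<lambda>x. (f x ^^ k x) (a x))"
proof -
  have "pt (\<lambda>x. foldl (\<lambda>acc _. f x acc) (a x) (replicate (k x) (0::nat)))"
    by (rule pt_foldl_incr[where r = r])
      (intro pt_comp2[OF f] pt_fst pt_snd pt_id assms pt_replicate)+
  then show ?thesis by (simp add: foldl_replicate)
qed

lemma pt_add: assumes "pt f" "pt g" shows "pt (\<lambda>x. f x + (g x :: nat))"
proof -
  have "pt (\<lambda>x. (Suc ^^ f x) (g x))"
    by (rule pt_funpow_incr[where r = "\<lambda>_. 1"])
      (simp | intro pt_Suc pt_snd pt_id poly_bounded_const assms)+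
  then show ?thesis by simp
qed

lemma pt_mult: assumes "pt f" "pt g" shows "pt (\<lambda>x. f x * (g x :: nat))"
proof -
  obtain h where h: "\<And>x. g x \<le> poly h (sz x)" using pt_sz[OF assms(2)] by auto
  have "pt (\<lambda>x. ((\<lambda>acc. g x + acc) ^^ f x) 0)"
    by (rule pt_funpow_incr[where r = "poly h"])
      (simp add: h | intro pt_add pt_comp[OF assms(2)] pt_fst pt_snd pt_id pt_const poly_bounded_poly assms)+
  moreover have "((\<lambda>acc. m + acc) ^^ n) 0 = n * m" for m n :: nat
    by (induction n) auto
  ultimately show ?thesis by simp
qed

text \<open>The exponent is a constant of the program; with a variable exponent, the unary result
  could be exponentially large.\<close>

lemma pt_power: assumes "pt f" shows "pt (\<lambda>x. f x ^ k :: nat)"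
  by (induction k) (auto intro: pt_const pt_mult assms)

lemma pt_diff: assumes "pt f" "pt g" shows "pt (\<lambda>x. f x - (g x :: nat))"
proof -
  have "pt (\<lambda>x. ((\<lambda>acc. acc - Suc 0) ^^ g x) (f x))"
    by (rule pt_funpow_incr[where r = "\<lambda>_. 1"])
      (simp | intro pt_pred pt_snd pt_id poly_bounded_const assms)+
  moreover have "((\<lambda>acc. acc - Suc 0) ^^ n) m = m - n" for m n
    by (induction n) auto
  ultimately show ?thesis by simp
qed

lemma pt_le: assumes "pt f" "pt g" shows "pt (\<lambda>x. f x \<le> (g x :: nat))"
  by (rule back_subst[of pt, OF pt_is_Nil[OF pt_replicate[OF pt_diff[OF assms]]]]) auto

lemma pt_less: assumes "pt f" "pt g" shows "pt (\<lambda>x. f x < (g x :: nat))"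
  by (rule back_subst[of pt, OF pt_not[OF pt_le[OF assms(2,1)]]]) auto

lemma pt_eq_nat: assumes "pt f" "pt g" shows "pt (\<lambda>x. f x = (g x :: nat))"
  by (rule back_subst[of pt, OF pt_conj[OF pt_le[OF assms] pt_le[OF assms(2,1)]]]) auto

lemma pt_min: assumes "pt f" "pt g" shows "pt (\<lambda>x. min (f x) (g x :: nat))"
  unfolding min_def by (intro pt_if pt_le assms)

lemma pt_length: assumes "pt l" shows "pt (\<lambda>x. length (l x))"
proof -
  have "pt (\<lambda>x. foldl (\<lambda>acc _. Suc acc) 0 (l x))"
    by (rule pt_foldl_incr[where r = "\<lambda>_. 1"])
      (auto intro!: pt_Suc pt_fst pt_snd pt_id pt_const assms poly_bounded_intros)
  moreover have "foldl (\<lambda>acc _. Suc acc) n xs = n + length xs" for n and xs :: "'b list"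
    by (induction xs arbitrary: n) auto
  ultimately show ?thesis by simp
qed

lemma pt_upt: assumes "pt f" shows "pt (\<lambda>x. [0..<f x])"
proof -
  obtain h where h: "\<And>x. f x \<le> poly h (sz x)" using pt_sz[OF assms] by auto
  have *: "foldl (\<lambda>acc _. acc @ [length acc]) [] (replicate n (0::nat)) = [0..<n]" for n
    unfolding foldl_replicate by (induction n) auto
  have sz: "sz [0..<n] \<le> n * Suc n" for n
    using sz_list_le[of "[0..<n]" n] by auto
  have "pt (\<lambda>x. foldl (\<lambda>acc _. acc @ [length acc]) [] (replicate (f x) (0::nat)))"
  \<comment> \<open>The increment \<open>length acc\<close> depends on the accumulator, so
    \<open>pt_foldl_incr\<close> does not apply. The accumulators are the lists
    \<open>[0..<i]\<close> and are bounded directly.\<close>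
  proof (rule pt_foldl[where b = "\<lambda>n. poly h n * Suc (poly h n)"])
    fix x i
    have "min i (f x) \<le> poly h (sz x)" using h[of x] by simp
    then have "min i (f x) * Suc (min i (f x)) \<le> poly h (sz x) * Suc (poly h (sz x))"
      by (intro mult_le_mono) auto
    then show "sz (foldl (\<lambda>acc _. acc @ [length acc]) [] (take i (replicate (f x) (0::nat)))) \<le>
        poly h (sz x) * Suc (poly h (sz x))"
      unfolding take_replicate * by (rule order_trans[OF sz])
  qed (intro pt_append pt_Cons pt_length pt_fst pt_snd pt_id pt_const pt_replicate assms poly_bounded_intros)+
  then show ?thesis by (simp only: *)
qed

lemma pt_drop: assumes "pt f" "pt l" shows "pt (\<lambda>x. drop (f x) (l x))"
proof -
  have "sz (tl xs) \<le> sz xs" for xs :: "'b list" by (cases xs) auto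
  then have "pt (\<lambda>x. (tl ^^ f x) (l x))"
    by (intro pt_funpow_incr[where r = "\<lambda>_. 0"])
      (simp | intro pt_tl pt_snd pt_id poly_bounded_const assms)+
  moreover have "(tl ^^ n) xs = drop n xs" for n and xs :: "'b list"
    by (induction n) (auto simp: drop_Suc tl_drop)
  ultimately show ?thesis by simp
qed

lemma pt_take: assumes "pt f" "pt l" shows "pt (\<lambda>x. take (f x) (l x))"
proof -
  have "pt (\<lambda>x. rev (drop (length (l x) - f x) (rev (l x))))"
    by (intro pt_rev pt_drop pt_diff pt_length assms)
  moreover have "rev (drop (length xs - n) (rev xs)) = take n xs" for n and xs :: "'b list"
    by (cases "n \<le> length xs") (auto simp: rev_drop)
  ultimately show ?thesis by simp
qed

section \<open>Equality tests and removal of duplicates\<close>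

lemma pt_eq_bool: assumes "pt f" "pt g" shows "pt (\<lambda>x. f x = (g x :: bool))"
  by (rule back_subst[of pt, OF pt_if[OF assms(1) assms(2) pt_not[OF assms(2)]]]) auto

lemma pt_eq_pair:
  assumes "\<And>f g :: 'x::tree_code \<Rightarrow> 'a::tree_code. pt f \<Longrightarrow> pt g \<Longrightarrow> pt (\<lambda>x. f x = g x)"
    and "\<And>f g :: 'x \<Rightarrow> 'b::tree_code. pt f \<Longrightarrow> pt g \<Longrightarrow> pt (\<lambda>x. f x = g x)"
    and "pt f" "pt g"
  shows "pt (\<lambda>x :: 'x. f x = (g x :: 'a \<times> 'b))"
  unfolding prod_eq_iff by (intro pt_conj assms(1,2) pt_fst pt_snd assms(3,4))

lemma pt_eq_list:
  assumes eq: "pt (\<lambda>z :: 'a \<times> 'a. fst z = snd z)"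
    and "pt f" "pt g"
  shows "pt (\<lambda>x. f x = (g x :: 'a::tree_code list))"
proof -
  \<comment> \<open>The accumulator holds the verdict so far and the part of \<open>g x\<close> yet
    to be matched; the lists agree if the verdict is positive and nothing remains.\<close>
  define step where
    "step = (\<lambda>acc (a::'a). ((fst acc \<and> snd acc \<noteq> []) \<and> hd (snd acc) = a, tl (snd acc)))"
  have *: "(fst (foldl step (ok, ys) xs) \<and> snd (foldl step (ok, ys) xs) = []) \<longleftrightarrow> ok \<and> xs = ys"
    for ok xs ys
  proof (induction xs arbitrary: ok ys)
    case (Cons a xs)
    have "foldl step (ok, ys) (a # xs) = foldl step ((ok \<and> ys \<noteq> []) \<and> hd ys = a, tl ys) xs"
      by (simp add: step_def)
    with Cons.IH show ?case by (cases ys) auto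
  qed auto
  have "pt (\<lambda>x. foldl (step) (True, g x) (f x))"
  proof (rule pt_foldl_incr[where r = "\<lambda>_. 1"])
    show "pt (\<lambda>z :: 'b \<times> (bool \<times> 'a list) \<times> 'a. step (fst (snd z)) (snd (snd z)))"
      unfolding step_def
      by (intro pt_pair pt_conj pt_not pt_is_Nil pt_tl pt_comp2[OF eq] pt_hd pt_fst pt_snd pt_id)
    show "sz (step acc a) \<le> sz acc + 1" for acc a
    proof (cases acc)
      case (Pair ok ys)
      then show ?thesis
        by (cases ys; cases ok) (auto simp: step_def intro: le_trans[OF sz_bool_le])
    qed
  qed (intro pt_pair pt_const assms poly_bounded_intros)+
  then have "pt (\<lambda>x. fst (foldl (step) (True, g x) (f x)) \<and> snd (foldl (step) (True, g x) (f x)) = [])"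
    by (intro pt_conj pt_is_Nil pt_fst pt_snd)
  then show ?thesis by (simp only: * simp_thms)
qed

lemma pt_member:
  assumes "\<And>f g :: 'x::tree_code \<times> 'a::tree_code \<Rightarrow> 'a. pt f \<Longrightarrow> pt g \<Longrightarrow> pt (\<lambda>x. f x = g x)"
    and "pt f" "pt l"
  shows "pt (\<lambda>x :: 'x. (f x :: 'a) \<in> set (l x))"
proof -
  have "pt (\<lambda>x. \<exists>a\<in>set (l x). a = f x)"
    by (intro pt_Bex assms(1,3) pt_snd pt_id pt_comp[OF assms(2)] pt_fst)
  then show ?thesis by simp
qed

lemma pt_remdups:
  assumes eq: "pt (\<lambda>z :: 'a \<times> 'a list. fst z \<in> set (snd z))" and l: "pt l"
  shows "pt (\<lambda>x. remdups (l x :: 'a::tree_code list))"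
proof -
  define step where "step = (\<lambda>acc (a::'a). if a \<in> set acc then acc else a # acc)"
  \<comment> \<open>\<open>remdups\<close> keeps last occurrences, which come first in the reversed
    list.\<close>
  have *: "foldl step [] (rev xs) = remdups xs" for xs
    by (induction xs) (auto simp: step_def)
  obtain h where h: "\<And>x. sz (l x) \<le> poly h (sz x)" using pt_sz[OF l] by blast
  have "pt (\<lambda>x. foldl step [] (rev (l x)))"
  proof (rule pt_foldl_incr[where r = "\<lambda>n. poly h n + 1"])
    show "pt (\<lambda>z :: 'b \<times> 'a list \<times> 'a. step (fst (snd z)) (snd (snd z)))"
      unfolding step_def
      by (intro pt_if pt_Cons pt_comp2[OF eq] pt_fst pt_snd pt_id)
    fix x acc a
    assume "a \<in> set (rev (l x))"
    then show "sz (step acc a) \<le> sz acc + (poly h (sz x) + 1)"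
      using sz_elem_le[of a "l x"] h[of x] by (simp add: step_def)
  qed (intro pt_const pt_rev l poly_bounded_intros)+
  then show ?thesis by (simp only: *)
qed

section \<open>Binary representation\<close>

lemma pt_half: assumes "pt f" shows "pt (\<lambda>x. (f x div 2, odd (f x :: nat)))"
proof -
  define step where "step = (\<lambda>a :: nat \<times> bool. if snd a then (Suc (fst a), False) else (fst a, True))"
  have "sz (step acc) \<le> sz acc + 2" for acc
    by (cases acc) (auto simp: step_def intro: le_trans[OF sz_bool_le])
  then have "pt (\<lambda>x. (step ^^ f x) (0, False))"
    by (intro pt_funpow_incr[where r = "\<lambda>_. 2"] pt_const assms poly_bounded_const)
      (unfold step_def, intro pt_if pt_pair pt_Suc pt_fst pt_snd pt_id pt_const)
  moreover have "(step ^^ n) (0, False) = (n div 2, odd n)" for n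
    by (induction n) (auto simp: step_def)
  ultimately show ?thesis by simp
qed

lemma length_bits_le: "length (bits n) \<le> n"
proof (induction n rule: less_induct)
  case (less n)
  show ?case
  proof (cases "n = 0")
    case False
    then have "length (bits (n div 2)) \<le> n div 2" using less by simp
    then show ?thesis using False by (subst bits.simps) auto
  qed (simp add: bits.simps)
qed

lemma pt_bits: assumes "pt f" shows "pt (\<lambda>x. bits (f x))"
proof -
  \<comment> \<open>The halving is iterated \<open>f x\<close> times and idles once 0 is reached;
    for unary numbers this many rounds are polynomial. The bits are collected in reverse
    order.\<close>
  define step where "step = (\<lambda>a :: nat \<times> bool list.
    if fst a = 0 then a else (fst (fst a div 2, odd (fst a)), snd (fst a div 2, odd (fst a)) # snd a))"
  have "sz (step acc) \<le> sz acc + 2" for acc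
    using sz_bool_le[of "odd (fst acc)"] by (cases acc) (auto simp: step_def)
  moreover have "pt (\<lambda>z :: 'a \<times> nat \<times> bool list. step (snd z))"
    unfolding step_def
    by (intro pt_if pt_eq_nat pt_fst[OF pt_half] pt_snd[OF pt_half] pt_pair pt_Cons pt_fst pt_snd pt_id pt_const)
  ultimately have "pt (\<lambda>x. (step ^^ f x) (f x, []))"
    by (intro pt_funpow_incr[where r = "\<lambda>_. 2"] pt_const pt_pair assms poly_bounded_intros)
  then have "pt (\<lambda>x. rev (snd ((step ^^ f x) (f x, []))))" by (intro pt_rev pt_snd)
  moreover have "rev (snd ((step ^^ n) (m, bs))) = rev bs @ bits m" if "m \<le> n" for m n bs
    using that
  proof (induction n arbitrary: m bs)
    case 0
    then show ?case by (simp add: bits.simps)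
  next
    case (Suc n)
    show ?case
    proof (cases "m = 0")
      case True
      then have "step (m, bs) = (m, bs)" by (simp add: step_def)
      with Suc.IH[of 0 bs] True show ?thesis by (simp add: funpow_Suc_right del: funpow.simps)
    next
      case False
      then have "step (m, bs) = (m div 2, odd m # bs)" "m div 2 \<le> n"
        using Suc.prems by (auto simp: step_def)
      then have "rev (snd ((step ^^ Suc n) (m, bs))) = rev (odd m # bs) @ bits (m div 2)"
        using Suc.IH[of "m div 2" "odd m # bs"] by (simp add: funpow_Suc_right del: funpow.simps)
      then show ?thesis using False bits.simps[of m] by simp
    qed
  qed
  then have "rev (snd ((step ^^ n) (n, []))) = bits n" for n by simp
  ultimately show ?thesis by (simp only:)
qed

lemma enc_list_concat: "enc_list h xs = concat (map (\<lambda>a. True # h a) xs) @ [False]"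
  by (induction xs) auto

lemma pt_enc_list:
  assumes "pt (\<lambda>z. h (fst z) (snd z))" "pt l"
  shows "pt (\<lambda>x. enc_list (h x) (l x))"
  unfolding enc_list_concat by (intro pt_append pt_concat pt_map pt_Cons pt_const assms)

lemma pt_enc_nat: "pt f \<Longrightarrow> pt (\<lambda>x. enc_nat (f x))"
  unfolding enc_nat_def by (intro pt_enc_list pt_Cons pt_const pt_snd pt_id pt_bits)

lemma pt_encode: "pt f \<Longrightarrow> pt g \<Longrightarrow> pt (\<lambda>x. encode (f x) (g x))"
  unfolding encode_def by (intro pt_append pt_enc_list pt_enc_nat pt_snd pt_id)

section \<open>The kernelization algorithm\<close>

lemma pt_eq_bits: "pt f \<Longrightarrow> pt g \<Longrightarrow> pt (\<lambda>x. f x = (g x :: bool list))"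
  by (intro pt_eq_list pt_eq_bool pt_fst pt_snd pt_id)

lemma pt_eq_edge: "pt f \<Longrightarrow> pt g \<Longrightarrow> pt (\<lambda>x. f x = (g x :: nat \<times> nat))"
  by (intro pt_eq_pair pt_eq_nat)

lemma pt_eq_pinstance: "pt f \<Longrightarrow> pt g \<Longrightarrow> pt (\<lambda>x. f x = (g x :: pinstance))"
  by (intro pt_eq_pair pt_eq_nat pt_eq_bits)

lemma pt_member_nat: "pt f \<Longrightarrow> pt l \<Longrightarrow> pt (\<lambda>x. (f x :: nat) \<in> set (l x))"
  by (intro pt_member pt_eq_nat)

lemma pt_member_edge: "pt f \<Longrightarrow> pt l \<Longrightarrow> pt (\<lambda>x. (f x :: nat \<times> nat) \<in> set (l x))"
  by (intro pt_member pt_eq_edge)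

lemma pt_member_pinstance: "pt f \<Longrightarrow> pt l \<Longrightarrow> pt (\<lambda>x. (f x :: pinstance) \<in> set (l x))"
  by (intro pt_member pt_eq_pinstance)

lemma pt_remdups_nat: "pt l \<Longrightarrow> pt (\<lambda>x. remdups (l x :: nat list))"
  by (intro pt_remdups pt_member_nat pt_fst pt_snd pt_id)

lemma pt_remdups_pinstance: "pt l \<Longrightarrow> pt (\<lambda>x. remdups (l x :: pinstance list))"
  by (intro pt_remdups pt_member_pinstance pt_fst pt_snd pt_id)

lemma pt_distinct: assumes "pt l" shows "pt (\<lambda>x. distinct (l x :: nat list))"
  by (rule back_subst[of pt, OF pt_eq_nat[OF pt_length[OF pt_remdups_nat] pt_length, OF assms assms]])
    (simp add: remdups_id_iff_distinct)

lemmas pt_intros =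
  pt_id pt_const pt_if pt_let pt_conj pt_disj pt_not pt_is_Nil pt_pair pt_Suc pt_hd pt_tl pt_Cons
  pt_append pt_concat pt_rev pt_length pt_map pt_filter pt_Ball pt_Bex pt_upt pt_take pt_drop
  pt_add pt_mult pt_power pt_diff pt_min pt_le pt_less pt_eq_nat pt_eq_edge pt_eq_bits
  pt_member_nat pt_member_edge pt_remdups_pinstance pt_distinct pt_encode pt_fst pt_snd

subsection \<open>Parsing\<close>

text \<open>Numbers are written most significant bit first here, and they are capped at \<open>L\<close>
  in order to keep their unary representation small.\<close>

definition capped_value :: "nat \<Rightarrow> bool list \<Rightarrow> nat" where
  "capped_value L w = foldl (\<lambda>v b. min L (2 * v + (if b then 1 else 0))) 0 w"

type_synonym parser = "nat \<times> nat list list \<times> nat list \<times> bool list"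

text \<open>The components are the mode, the finished adjacency lists, the current adjacency list
  and the bits of the current number. Modes 0, 1, 2, 4 expect the marker bit of the outer list, of
  an adjacency list, of one of its entries, and of the final number; modes 3 and 5 expect a bit of a
  number.\<close>

definition parse_step :: "nat \<Rightarrow> parser \<Rightarrow> bool \<Rightarrow> parser" where
  "parse_step L s b =
    (let m = fst s; A = fst (snd s); r = fst (snd (snd s)); w = snd (snd (snd s)) in
     if m = 0 then if b then (1, A, [], w) else (4, A, r, [])
     else if m = 1 then if b then (2, A, r, []) else (0, A @ [r], [], w)
     else if m = 2 then if b then (3, A, r, w) else (1, A, r @ [capped_value L w], w)
     else if m = 3 then (2, A, r, b # w)
     else if m = 4 then if b then (5, A, r, w) else (6, A, r, w)
     else (4, A, r, b # w))"

text \<open>There is no error mode: on a string that encodes nothing the result is arbitrary, and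
  \<open>kernel\<close> detects this by encoding the result again. Mode 6 is entered with the last
  bit of an encoding.\<close>

definition parse :: "bool list \<Rightarrow> nat list list \<times> nat" where
  "parse x =
    (let s = foldl (parse_step (length x)) (0, [], [], []) x in
     (fst (snd s), capped_value (length x) (snd (snd (snd s)))))"

lemma capped_value_le: "capped_value L w \<le> L"
  by (induction w rule: rev_induct) (auto simp: capped_value_def)

lemma pt_capped_value: assumes "pt f" "pt g" shows "pt (\<lambda>x. capped_value (f x) (g x))"
proof -
  obtain h where h: "\<And>x. sz (f x) \<le> poly h (sz x)" using pt_sz[OF assms(1)] by blast
  show ?thesis unfolding capped_value_def
  \<comment> \<open>The step doubles its accumulator; only the cap keeps the prefixes small.\<close>
  proof (rule pt_foldl[where b = "poly h"])
    fix x i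
    show "sz (foldl (\<lambda>v b. min (f x) (2 * v + (if b then 1 else 0))) 0 (take i (g x))) \<le> poly h (sz x)"
      using order_trans[OF capped_value_le h[of x, simplified]] by (simp add: capped_value_def)
  qed (intro pt_intros pt_comp[OF assms(1)] assms poly_bounded_intros)+
qed

lemma pt_parse: "pt parse"
proof -
  have "pt (\<lambda>x. foldl (parse_step (length x)) (0, [], [], []) x)"
  proof (rule pt_foldl_incr[where r = "\<lambda>n. n + 10"])
    show "pt (\<lambda>z :: bool list \<times> parser \<times> bool. parse_step (length (fst z)) (fst (snd z)) (snd (snd z)))"
      unfolding parse_step_def Let_def by (intro pt_intros pt_capped_value)
    fix x :: "bool list" and acc :: parser and b
    obtain m A r w where acc: "acc = (m, A, r, w)" by (cases acc) auto
    have "capped_value (length x) w \<le> sz x"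
      using capped_value_le[of "length x" w] length_le_sz[of x] by simp
    then show "sz (parse_step (length x) acc b) \<le> sz acc + (sz x + 10)"
      using sz_bool_le[of b] by (auto simp: acc parse_step_def Let_def)
  qed (intro pt_id pt_const poly_bounded_intros)+
  then show ?thesis unfolding parse_def Let_def by (intro pt_intros pt_capped_value)
qed

text \<open>Capping after every digit has the same effect as capping once at the end, since a value
  that has reached \<open>L\<close> never falls below it again. The reversal is due to
  \<open>bits\<close>, which starts with the least significant bit.\<close>

lemma capped_value_bits: "capped_value L (rev (bits n)) = min L n"
proof (induction n rule: less_induct)
  case (less n)
  show ?case
  proof (cases "n = 0")
    case True
    then show ?thesis by (simp add: bits.simps capped_value_def)
  next
    case False
    have *: "2 * (n div 2) + (if odd n then 1 else 0) = n"
      by (auto simp: odd_two_times_div_two_succ)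
    have "capped_value L (rev (bits n)) =
        min L (2 * capped_value L (rev (bits (n div 2))) + (if odd n then 1 else 0))"
      using False by (subst bits.simps) (simp add: capped_value_def)
    also have "capped_value L (rev (bits (n div 2))) = min L (n div 2)"
      using less False by simp
    also have "min L (2 * min L (n div 2) + (if odd n then 1 else 0)) = min L n"
      using * by (simp split: if_splits)
    finally show ?thesis .
  qed
qed

lemma foldl_parse_entry:
  "foldl (parse_step L) (2, A, r, w) (enc_list (\<lambda>b. [b]) bs @ rest) =
   foldl (parse_step L) (1, A, r @ [capped_value L (rev bs @ w)], rev bs @ w) rest"
  by (induction bs arbitrary: w) (simp_all add: parse_step_def)

text \<open>The bits of the last entry stay in the state until the next number starts, hence the
  unspecified \<open>w'\<close>.\<close>

lemma foldl_parse_row: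
  "\<exists>w'. foldl (parse_step L) (1, A, r, w) (enc_list enc_nat ns @ rest) =
        foldl (parse_step L) (0, A @ [r @ map (min L) ns], [], w') rest"
proof (induction ns arbitrary: r w)
  case Nil
  then show ?case by (auto simp: parse_step_def)
next
  case (Cons n ns)
  have "foldl (parse_step L) (1, A, r, w) (enc_list enc_nat (n # ns) @ rest) =
      foldl (parse_step L) (1, A, r @ [min L n], rev (bits n)) (enc_list enc_nat ns @ rest)"
    by (simp add: enc_nat_def parse_step_def foldl_parse_entry[of _ _ _ "[]", simplified] capped_value_bits)
  with Cons[of "r @ [min L n]" "rev (bits n)"] show ?case by simp
qed

lemma foldl_parse_rows:
  "\<exists>r'. foldl (parse_step L) (0, A, r, w) (enc_list (enc_list enc_nat) B @ rest) =
        foldl (parse_step L) (4, A @ map (map (min L)) B, r', []) rest"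
proof (induction B arbitrary: A r w)
  case Nil
  then show ?case by (auto simp: parse_step_def)
next
  case (Cons ns B)
  have "foldl (parse_step L) (0, A, r, w) (enc_list (enc_list enc_nat) (ns # B) @ rest) =
      foldl (parse_step L) (1, A, [], w) (enc_list enc_nat ns @ enc_list (enc_list enc_nat) B @ rest)"
    by (simp add: parse_step_def)
  with foldl_parse_row[of L A "[]" w ns "enc_list (enc_list enc_nat) B @ rest"]
    Cons[of "A @ [map (min L) ns]" "[]"]
  show ?case by auto
qed

lemma foldl_parse_number:
  "foldl (parse_step L) (4, A, r, w) (enc_list (\<lambda>b. [b]) bs) = (6, A, r, rev bs @ w)"
  by (induction bs arbitrary: w) (simp_all add: parse_step_def)

text \<open>The cap leaves the vertex numbers intact but may cut off \<open>k\<close>. This is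
  harmless, as such a \<open>k\<close> exceeds the number of vertices.\<close>

lemma parse_encode:
  assumes "\<And>row v. row \<in> set A \<Longrightarrow> v \<in> set row \<Longrightarrow> v \<le> length (encode A k)"
  shows "parse (encode A k) = (A, min (length (encode A k)) k)"
proof -
  define L where "L = length (encode A k)"
  obtain r where "foldl (parse_step L) (0, [], [], []) (encode A k) =
      foldl (parse_step L) (4, map (map (min L)) A, r, []) (enc_nat k)"
    using foldl_parse_rows[of L "[]" "[]" "[]" A "enc_nat k"] by (auto simp: encode_def)
  then have "foldl (parse_step L) (0, [], [], []) (encode A k) =
      (6, map (map (min L)) A, r, rev (bits k))"
    by (simp add: enc_nat_def foldl_parse_number)
  moreover have "map (map (min L)) A = A"
    by (intro map_idI min_absorb2) (simp add: L_def assms(1))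
  ultimately show ?thesis by (simp add: parse_def L_def[symmetric] Let_def capped_value_bits)
qed

lemma length_enc_list_ge: "length xs < length (enc_list h xs)"
  by (induction xs) auto

text \<open>A row contributes at least its marker and its closing bit; the closing bits of the outer
  list and of \<open>k\<close> account for the summand 2.\<close>

lemma length_encode_ge: "2 * length A + 2 \<le> length (encode A k)"
proof -
  have "2 * length A + 1 \<le> length (enc_list (enc_list enc_nat) A)"
  proof (induction A)
    case (Cons ns A)
    then show ?case using length_enc_list_ge[of ns enc_nat] by simp
  qed simp
  moreover have "1 \<le> length (enc_nat k)"
    using length_enc_list_ge[of "bits k" "\<lambda>b. [b]"] by (simp add: enc_nat_def)
  ultimately show ?thesis unfolding encode_def length_append by linarith
qed

subsection \<open>Peeling off edges\<close>

text \<open>Stands for \<open>A ! u\<close>, but is composed of functions with a \<open>pt\<close>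
  rule and yields the empty list outside the range. \<open>hd (drop j V)\<close> in
  \<open>induced_lists\<close> replaces \<open>V ! j\<close> for the same reason.\<close>

definition row :: "nat list list \<Rightarrow> nat \<Rightarrow> nat list" where
  "row A u = concat (take 1 (drop u A))"

text \<open>\<open>adjacency_lists\<close> with quantifiers over explicit lists, in the form that
  \<open>pt_Ball\<close> can handle; see \<open>well_formed_iff\<close>.\<close>

definition well_formed :: "nat list list \<Rightarrow> bool" where
  "well_formed A \<longleftrightarrow> (\<forall>u\<in>set [0..<length A]. distinct (row A u) \<and>
     (\<forall>v\<in>set (row A u). (v < length A \<and> \<not> v = u) \<and> u \<in> set (row A v)))"

text \<open>An edge occurs in both orientations, so the neighbours of \<open>u\<close> are exactly
  the \<open>w\<close> with \<open>(u, w)\<close> in the list.\<close>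

definition edge_list :: "nat list list \<Rightarrow> (nat \<times> nat) list" where
  "edge_list A = concat (map (\<lambda>u. map (\<lambda>v. (u, v)) (row A u)) [0..<length A])"

definition community :: "nat \<Rightarrow> (nat \<times> nat) list \<Rightarrow> nat \<times> nat \<Rightarrow> nat list" where
  "community N E e = filter (\<lambda>w. (w = fst e \<or> w = snd e) \<or> (fst e, w) \<in> set E \<and> (snd e, w) \<in> set E) [0..<N]"

definition light_edges :: "nat \<Rightarrow> nat \<Rightarrow> (nat \<times> nat) list \<Rightarrow> (nat \<times> nat) list" where
  "light_edges N D E = filter (\<lambda>e. length (community N E e) \<le> D) E"

definition peel_step ::
    "nat \<Rightarrow> nat \<Rightarrow> (nat \<times> nat) list \<times> nat list list \<Rightarrow> (nat \<times> nat) list \<times> nat list list" where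
  "peel_step N D s =
    (if light_edges N D (fst s) = [] then s
     else let e = hd (light_edges N D (fst s)) in
       (filter (\<lambda>f. \<not> (f = e \<or> f = (snd e, fst e))) (fst s), community N (fst s) e # snd s))"

text \<open>\<open>length E\<close> rounds suffice, since a round is idle or shortens the list of
  edges.\<close>

definition peel :: "nat \<Rightarrow> nat \<Rightarrow> (nat \<times> nat) list \<Rightarrow> (nat \<times> nat) list \<times> nat list list" where
  "peel N D E = (peel_step N D ^^ length E) (E, [])"

text \<open>A group is a concatenation with possible repetitions. The result is sorted and free of
  repetitions, so equal sets yield equal queries.\<close>

definition restrict :: "nat list list \<Rightarrow> nat list \<Rightarrow> nat list" where
  "restrict A W = filter (\<lambda>w. w \<in> set W) [0..<length A]"

text \<open>Vertices are renamed to their positions in \<open>V\<close>. Thus the length of a query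
  is bounded in terms of the number of its vertices alone, whatever their names in the input; this
  is what limits the number of different queries.\<close>

definition induced_lists :: "nat list list \<Rightarrow> nat list \<Rightarrow> nat list list" where
  "induced_lists A V =
     map (\<lambda>u. filter (\<lambda>j. hd (drop j V) \<in> set (row A u)) [0..<length V]) V"

definition query :: "nat list list \<Rightarrow> nat \<Rightarrow> pinstance" where
  "query A k = (encode A k, length (encode A k) * length (encode A k))"

text \<open>Sets with fewer than \<open>k\<close> vertices contain no clique of size
  \<open>k\<close>; dropping them ensures that \<open>k\<close> is at most the number of vertices of
  the query and cannot make it long.\<close>

definition queries :: "nat list list \<Rightarrow> nat \<Rightarrow> nat list list \<Rightarrow> pinstance list" where
  "queries A k Ws = map (\<lambda>W. query (induced_lists A (restrict A W)) k)
     (filter (\<lambda>W. k \<le> length (restrict A W)) Ws)"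

definition groups :: "nat \<Rightarrow> nat list list \<Rightarrow> nat list list" where
  "groups g Ws = map (\<lambda>i. concat (take g (drop (i * g) Ws)))
     (filter (\<lambda>i. i * g < length Ws) [0..<length Ws])"

text \<open>The one-vertex graph with \<open>k = 1\<close> is the yes-instance returned when the
  answer is known to be positive: for \<open>k = 1\<close>, because a single vertex need not lie in
  any recorded set, and if edges remain after peeling, which under the promise implies a clique of
  size \<open>k\<close>. The empty list of queries means no.\<close>

definition kernel :: "nat \<Rightarrow> nat \<Rightarrow> pinstance \<Rightarrow> pinstance list" where
  "kernel d e i =
    (let A = fst (parse (fst i)); k = snd (parse (fst i)) in
     if (encode A k = fst i \<and> well_formed A) \<and> 0 < k \<and> k \<le> length A then
       let s = peel (length A) (2 * snd i + d) (edge_list A);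
         Q1 = remdups (queries A k (snd s)); Q2 = queries A k (groups ((snd i + 1) ^ e) (snd s)) in
       if k = 1 \<or> \<not> fst s = [] then [query [[]] 1]
       else if length Q1 \<le> length Q2 then Q1 else Q2
     else [])"

section \<open>Running time of the kernelization\<close>

lemma pt_row:
  assumes "pt f" "pt g"
  shows "pt (\<lambda>x. row (f x) (g x))"
  unfolding row_def by (intro pt_intros pt_comp[OF assms(1)] pt_comp[OF assms(2)])

lemma pt_well_formed:
  assumes "pt f"
  shows "pt (\<lambda>x. well_formed (f x))"
  unfolding well_formed_def by (intro pt_intros pt_row pt_comp[OF assms])

lemma pt_edge_list:
  assumes "pt f"
  shows "pt (\<lambda>x. edge_list (f x))"
  unfolding edge_list_def by (intro pt_intros pt_row pt_comp[OF assms])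

lemma pt_community:
  assumes "pt f" "pt g" "pt h"
  shows "pt (\<lambda>x. community (f x) (g x) (h x))"
  unfolding community_def by (intro pt_intros pt_comp[OF assms(1)] pt_comp[OF assms(2)] pt_comp[OF assms(3)])

lemma pt_light_edges:
  assumes "pt f" "pt g" "pt h"
  shows "pt (\<lambda>x. light_edges (f x) (g x) (h x))"
  unfolding light_edges_def
  by (intro pt_intros pt_community pt_comp[OF assms(1)] pt_comp[OF assms(2)] pt_comp[OF assms(3)])

lemma pt_restrict:
  assumes "pt f" "pt g"
  shows "pt (\<lambda>x. restrict (f x) (g x))"
  unfolding restrict_def by (intro pt_intros pt_comp[OF assms(1)] pt_comp[OF assms(2)])

lemma pt_induced_lists:
  assumes "pt f" "pt g"
  shows "pt (\<lambda>x. induced_lists (f x) (g x))"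
  unfolding induced_lists_def by (intro pt_intros pt_row pt_comp[OF assms(1)] pt_comp[OF assms(2)])

lemma pt_query:
  assumes "pt f" "pt g"
  shows "pt (\<lambda>x. query (f x) (g x))"
  unfolding query_def by (intro pt_intros pt_comp[OF assms(1)] pt_comp[OF assms(2)])

lemma pt_queries:
  assumes "pt f" "pt g" "pt h"
  shows "pt (\<lambda>x. queries (f x) (g x) (h x))"
  unfolding queries_def
  by (intro pt_intros pt_query pt_induced_lists pt_restrict pt_comp[OF assms(1)] pt_comp[OF assms(2)] pt_comp[OF assms(3)])

lemma pt_groups:
  assumes "pt f" "pt g"
  shows "pt (\<lambda>x. groups (f x) (g x))"
  unfolding groups_def by (intro pt_intros pt_comp[OF assms(1)] pt_comp[OF assms(2)])

lemma sz_upt: "sz [0..<n] \<le> n * Suc n"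
  using sz_list_le[of "[0..<n]" n] by auto

lemma pt_peel:
  assumes "pt f" "pt g" "pt h"
  shows "pt (\<lambda>x. peel (f x) (g x) (h x))"
proof -
  obtain q where q: "\<And>x. f x \<le> poly q (sz x)" using pt_sz[OF assms(1)] by auto
  show ?thesis unfolding peel_def
  proof (rule pt_funpow_incr[where r = "\<lambda>n. poly q n * Suc (poly q n) + 1"])
    show "pt (\<lambda>z. peel_step (f (fst z)) (g (fst z)) (snd z))"
      unfolding peel_step_def
      by (intro pt_intros pt_light_edges pt_community pt_comp[OF assms(1)] pt_comp[OF assms(2)])
    fix x and s :: "(nat \<times> nat) list \<times> nat list list"
    obtain E Ws where s: "s = (E, Ws)" by force
    have "sz (community (f x) E e) \<le> f x * Suc (f x)" for e
      unfolding community_def by (rule order_trans[OF sz_filter_le sz_upt])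
    moreover have "f x * Suc (f x) \<le> poly q (sz x) * Suc (poly q (sz x))"
      using q[of x] by (intro mult_le_mono) auto
    ultimately have c: "sz (community (f x) E e) \<le> poly q (sz x) * Suc (poly q (sz x))" for e
      using order_trans by blast
    have "sz (filter P E) + (sz (community (f x) E e) + w) \<le>
        sz E + (poly q (sz x) * Suc (poly q (sz x)) + w)" for P e w
      using sz_filter_le[of P E] c[of e] by (intro add_mono) auto
    then show "sz (peel_step (f x) (g x) s) \<le> sz s + (poly q (sz x) * Suc (poly q (sz x)) + 1)"
      by (auto simp: s peel_step_def Let_def)
  qed (intro pt_intros assms poly_bounded_intros)+
qed

lemma pt_kernel: "pt (kernel d e)"
  unfolding kernel_def Let_def
  by (intro pt_intros pt_query pt_queries pt_groups pt_peel pt_edge_list pt_well_formed pt_comp[OF pt_parse])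

section \<open>Cycles\<close>

abbreviation adj :: "'a graph \<Rightarrow> 'a \<Rightarrow> 'a \<Rightarrow> bool" where
  "adj G u v \<equiv> {u, v} \<in> edges G"

lemma simple_graph_adjD:
  assumes "simple_graph G" "adj G u v"
  shows "u \<noteq> v" "u \<in> verts G" "v \<in> verts G"
proof -
  have "card {u, v} = 2" "{u, v} \<subseteq> verts G" using assms unfolding simple_graph_def by blast+
  then show "u \<noteq> v" "u \<in> verts G" "v \<in> verts G" by auto
qed

lemma adj_sym: "adj G u v \<longleftrightarrow> adj G v u"
  by (simp add: insert_commute)

lemma finite_min:
  fixes f :: "'a \<Rightarrow> 'b::linorder"
  assumes "finite W" "W \<noteq> {}"
  obtains v where "v \<in> W" "\<And>u. u \<in> W \<Longrightarrow> f v \<le> f u"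
  using arg_min_if_finite[OF assms, of f] by (metis not_less)

lemma finite_max:
  fixes f :: "'a \<Rightarrow> 'b::linorder"
  assumes "finite W" "W \<noteq> {}"
  obtains v where "v \<in> W" "\<And>u. u \<in> W \<Longrightarrow> f u \<le> f v"
proof -
  have "Max (f ` W) \<in> f ` W" using assms by simp
  then obtain v where "v \<in> W" "Max (f ` W) = f v" by auto
  moreover from this have "f u \<le> f v" if "u \<in> W" for u
    using Max_ge[of "f ` W" "f u"] assms(1) that by simp
  ultimately show ?thesis using that by blast
qed

lemma simple_graph_no_loop: "simple_graph G \<Longrightarrow> {v} \<notin> edges G"
  using simple_graph_adjD(1)[of G v v] by auto

lemma simple_graph_edgeE:
  assumes "simple_graph G" "e \<in> edges G"
  obtains u v where "e = {u, v}" "adj G u v"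
proof -
  have "card e = 2" using assms unfolding simple_graph_def by blast
  then show ?thesis using that assms(2) by (auto simp: card_2_iff)
qed

lemma cycle_edges_conv:
  assumes "c \<noteq> []"
  shows "cycle_edges c = insert {last c, hd c} {{c ! i, c ! Suc i} | i. Suc i < length c}"
proof -
  let ?f = "\<lambda>i. {c ! i, c ! (Suc i mod length c)}"
  have "cycle_edges c = ?f ` {i. i < length c}" by (auto simp: cycle_edges_def)
  also have "{i. i < length c} = insert (length c - 1) {i. Suc i < length c}" using assms by auto
  also have "?f ` \<dots> = insert (?f (length c - 1)) (?f ` {i. Suc i < length c})" by (rule image_insert)
  also have "?f (length c - 1) = {last c, hd c}"
    using assms by (simp add: last_conv_nth hd_conv_nth)
  also have "?f ` {i. Suc i < length c} = {{c ! i, c ! Suc i} | i. Suc i < length c}"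
    by (auto simp: image_def)
  finally show ?thesis .
qed

text \<open>Cycles as closed paths: unlike indices modulo the length, \<open>successively\<close> is
  compatible with splitting and appending lists.\<close>

lemma is_cycle_iff:
  "is_cycle G c \<longleftrightarrow> 3 \<le> length c \<and> distinct c \<and> successively (adj G) c \<and> adj G (last c) (hd c)"
proof (cases "c = []")
  case False
  have "cycle_edges c \<subseteq> edges G \<longleftrightarrow> successively (adj G) c \<and> adj G (last c) (hd c)"
    unfolding cycle_edges_conv[OF False] successively_conv_nth by auto
  then show ?thesis by (auto simp: is_cycle_def)
qed (simp add: is_cycle_def)

lemma consecutive_in_cycle_edges: "{u, v} \<in> cycle_edges (xs @ u # v # ys)"
proof -
  define c where "c = xs @ u # v # ys"
  have c: "c \<noteq> []" "Suc (length xs) < length c" "c ! length xs = u" "c ! Suc (length xs) = v"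
    by (simp_all add: c_def nth_append)
  then have "{u, v} \<in> {{c ! i, c ! Suc i} | i. Suc i < length c}" by blast
  then show ?thesis unfolding c_def[symmetric] cycle_edges_conv[OF c(1)] by (rule insertI2)
qed

lemma last_hd_in_cycle_edges: "c \<noteq> [] \<Longrightarrow> {last c, hd c} \<in> cycle_edges c"
  by (simp add: cycle_edges_conv)

lemma is_cycle_set_subset:
  assumes "simple_graph G" "is_cycle G c"
  shows "set c \<subseteq> verts G"
proof
  fix x assume "x \<in> set c"
  then obtain i where i: "i < length c" "x = c ! i" by (metis in_set_conv_nth)
  then have "adj G x (c ! (Suc i mod length c))"
    using assms(2) unfolding is_cycle_def cycle_edges_def by blast
  then show "x \<in> verts G" by (rule simple_graph_adjD(2)[OF assms(1)])
qed

lemma is_cycle_length_le: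
  assumes "simple_graph G" "is_cycle G c"
  shows "length c \<le> card (verts G)"
proof -
  have "length c = card (set c)" using assms(2) by (simp add: is_cycle_def distinct_card)
  also have "\<dots> \<le> card (verts G)"
    using is_cycle_set_subset[OF assms] assms(1) by (intro card_mono) (auto simp: simple_graph_def)
  finally show ?thesis .
qed

lemma neighbours_subset: "simple_graph G \<Longrightarrow> neighbours G v \<subseteq> verts G - {v}"
  unfolding neighbours_def using simple_graph_adjD(1,3)[of G v] by auto

lemma finite_neighbours: "simple_graph G \<Longrightarrow> finite (neighbours G v)"
  using neighbours_subset[of G v] finite_subset[of _ "verts G - {v}"] by (simp add: simple_graph_def)

text \<open>All neighbours of an end vertex of a longest path lie on the path.\<close>

lemma min_degree_cycle:
  assumes G: "simple_graph G" and ne: "verts G \<noteq> {}" and "2 \<le> \<delta>"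
    and deg: "\<And>v. v \<in> verts G \<Longrightarrow> \<delta> \<le> vdegree G v"
  obtains c where "is_cycle G c" "\<delta> < length c"
proof -
  define path where "path p \<longleftrightarrow> p \<noteq> [] \<and> distinct p \<and> set p \<subseteq> verts G \<and> successively (adj G) p" for p
  obtain x0 where "x0 \<in> verts G" using ne by blast
  then have "path [x0]" by (simp add: path_def)
  moreover have "length p < Suc (card (verts G))" if "path p" for p
  proof -
    have "length p = card (set p)" using that by (simp add: path_def distinct_card)
    also have "\<dots> \<le> card (verts G)"
      using that G by (intro card_mono) (auto simp: path_def simple_graph_def)
    finally show ?thesis by simp
  qed
  ultimately obtain p where p: "path p" and max: "\<And>q. path q \<Longrightarrow> length q \<le> length p"
    using ex_has_greatest_nat[of path _ length "Suc (card (verts G))"] by blast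
  define x where "x = hd p"
  have x: "x \<in> verts G" using p by (auto simp: path_def x_def)
  have sub: "neighbours G x \<subseteq> set p"
  proof
    fix y assume y: "y \<in> neighbours G x"
    show "y \<in> set p"
    proof (rule ccontr)
      assume "y \<notin> set p"
      moreover have "adj G x y" using y by (simp add: neighbours_def)
      ultimately have "path (y # p)"
        using p simple_graph_adjD[OF G] unfolding path_def x_def
        by (auto simp: successively_Cons adj_sym)
      from max[OF this] show False by simp
    qed
  qed
  \<comment> \<open>The positions on the path of the neighbours of its first vertex
    \<open>x\<close>. As 0 is not among them, the largest is at least \<open>\<delta>\<close>, and
    the path up to there closes to a cycle with more than \<open>\<delta>\<close> vertices.\<close>
  define J where "J = {j. j < length p \<and> adj G x (p ! j)}"
  have img: "neighbours G x = (!) p ` J"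
  proof
    show "neighbours G x \<subseteq> (!) p ` J"
    proof
      fix y assume "y \<in> neighbours G x"
      then have "y \<in> set p" "adj G x y" using sub by (auto simp: neighbours_def)
      then show "y \<in> (!) p ` J" by (auto simp: J_def in_set_conv_nth)
    qed
  qed (auto simp: J_def neighbours_def)
  have fin: "finite J" by (simp add: J_def)
  have card: "\<delta> \<le> card J"
    using deg[OF x] card_image_le[OF fin, of "(!) p"] by (simp add: vdegree_def img)
  have "0 \<notin> J"
    using p simple_graph_no_loop[OF G] by (simp add: J_def x_def path_def hd_conv_nth)
  then have "J \<subseteq> {1..Max J}" using fin by (auto simp: Suc_le_eq intro: gr0I)
  then have "card J \<le> Max J" using card_mono[of "{1..Max J}" J] by simp
  then have m: "\<delta> \<le> Max J" using card by simp
  have "J \<noteq> {}" using card assms(3) by auto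
  then have mJ: "Max J \<in> J" using fin by simp
  define c where "c = take (Suc (Max J)) p"
  have lc: "length c = Suc (Max J)" using mJ by (simp add: c_def J_def)
  have "p = c @ drop (Suc (Max J)) p" by (simp add: c_def)
  then have "distinct c" "successively (adj G) c"
    using p unfolding path_def by (metis distinct_append, metis successively_append_iff)
  moreover have "last c = p ! Max J" "hd c = x"
    using lc p mJ by (auto simp: last_conv_nth c_def x_def path_def J_def)
  then have "adj G (last c) (hd c)" using mJ by (simp add: J_def adj_sym)
  ultimately have "is_cycle G c" using lc m assms(3) by (simp add: is_cycle_iff)
  with that lc m show ?thesis by simp
qed

text \<open>If an even cycle has an edge with a common neighbour of its ends, then the common neighbour
  extends the cycle, or it splits the cycle into two parts that both can be closed to odd cycles.\<close>

lemma odd_cycle_from_triangle: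
  assumes G: "simple_graph G" and c: "is_cycle G c"
    and w: "adj G w (last c)" "adj G w (hd c)"
  obtains c' where "is_cycle G c'" "odd (length c')" "length c \<le> 2 * length c'"
proof (cases "odd (length c)")
  case True
  with c that show ?thesis by force
next
  case even: False
  have c': "3 \<le> length c" "distinct c" "successively (adj G) c" "adj G (last c) (hd c)" "c \<noteq> []"
    using c by (auto simp: is_cycle_iff)
  show ?thesis
  proof (cases "w \<in> set c")
    case False
    have "is_cycle G (c @ [w])"
      using c' False w by (auto simp: is_cycle_iff successively_append_iff adj_sym)
    with even that[of "c @ [w]"] show ?thesis by simp
  next
    case True
    then obtain xs ys where cs: "c = xs @ w # ys" by (meson split_list)
    have xs: "xs \<noteq> []" using simple_graph_adjD(1)[OF G w(2)] by (auto simp: cs)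
    have ys: "ys \<noteq> []" using simple_graph_adjD(1)[OF G w(1)] by (auto simp: cs)
    define u where "u = last ys"
    define v where "v = hd xs"
    have uv: "adj G u v" "adj G w u" "adj G w v" using c'(4) w xs ys by (simp_all add: u_def v_def cs)
    have mem: "u \<in> set ys" "v \<in> set xs" using xs ys by (auto simp: u_def v_def)
    have dist: "distinct (xs @ w # ys)" and succ: "successively (adj G) (xs @ w # ys)"
      using c' by (simp_all add: cs)
    have sxs: "successively (adj G) xs" "adj G (last xs) w"
      using succ xs by (auto simp: successively_append_iff)
    have sys: "successively (adj G) (w # ys)"
      using succ by (auto simp: successively_append_iff)
    have len: "length c = length xs + length ys + 1" by (simp add: cs)
    have l1: "1 \<le> length xs" "1 \<le> length ys" using xs ys by (simp_all add: Suc_le_eq)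
    show ?thesis
    \<comment> \<open>As \<open>c\<close> is even, exactly one of \<open>length xs\<close> and
      \<open>length ys\<close> is odd. The even part forms an odd cycle with \<open>w\<close>, and
      the odd part does so with \<open>w\<close> and the end of \<open>c\<close> in the other part.
      The cycle through the longer part has at least half of the length of \<open>c\<close>.\<close>
    proof (cases "odd (length xs)")
      case True
      then have "even (length ys)" using even len by auto
      have 1: "is_cycle G (w # ys)" "odd (length (w # ys))" if "length ys > 1"
        using that \<open>even (length ys)\<close> dist sys ys uv by (auto simp: is_cycle_iff u_def adj_sym)
      have 2: "is_cycle G (xs @ [w, u])" "odd (length (xs @ [w, u]))"
        using True l1 dist sxs xs uv mem by (auto simp: is_cycle_iff successively_append_iff v_def)
      have "length ys > 1" using \<open>even (length ys)\<close> l1 by (cases "length ys = 1") auto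
      with 1 2 that[of "w # ys"] that[of "xs @ [w, u]"] len show ?thesis
        by (cases "length xs \<le> length ys") auto
    next
      case False
      then have oy: "odd (length ys)" using even len by auto
      have "length xs > 1" using False l1 by (cases "length xs = 1") auto
      then have 1: "is_cycle G (xs @ [w])" "odd (length (xs @ [w]))"
        using False dist sxs xs uv by (auto simp: is_cycle_iff successively_append_iff v_def)
      have 2: "is_cycle G ((w # ys) @ [v])" "odd (length ((w # ys) @ [v]))"
        using oy l1 dist sys ys uv mem
        unfolding is_cycle_iff successively_append_iff by (auto simp: u_def adj_sym)
      with 1 that[of "xs @ [w]"] that[of "(w # ys) @ [v]"] len show ?thesis
        by (cases "length xs \<le> length ys") auto
    qed
  qed
qed

section \<open>Simplicial vertices\<close>

text \<open>Relative to a vertex set \<open>W\<close>, so that inductions over \<open>W\<close> need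
  no induced subgraphs.\<close>

definition simplicial :: "'a graph \<Rightarrow> 'a set \<Rightarrow> 'a \<Rightarrow> bool" where
  "simplicial G W v \<longleftrightarrow> (\<forall>a\<in>W. \<forall>b\<in>W. adj G v a \<and> adj G v b \<and> a \<noteq> b \<longrightarrow> adj G a b)"

lemma rtrancl_list:
  assumes "(x, y) \<in> {(a, b). R a b}\<^sup>*"
  obtains p where "p \<noteq> []" "hd p = x" "last p = y" "successively R p"
proof -
  have "\<exists>p. p \<noteq> [] \<and> hd p = x \<and> last p = y \<and> successively R p"
    using assms
  proof (induction rule: rtrancl_induct)
    case base
    show ?case by (intro exI[of _ "[x]"]) simp
  next
    case (step y z)
    then obtain p where "p \<noteq> []" "hd p = x" "last p = y" "successively R p" by blast
    with step(2) show ?case by (intro exI[of _ "p @ [z]"]) (auto simp: successively_append_iff)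
  qed
  with that show ?thesis by blast
qed

text \<open>Closing a shortest path from \<open>x\<close> to \<open>y\<close> with inner vertices in \<open>C\<close> by \<open>a\<close>
  yields a cycle without chords.\<close>

lemma chordal_separator_clique:
  assumes G: "simple_graph G" "chordal G"
    and C: "\<And>c. c \<in> C \<Longrightarrow> c \<noteq> a \<and> \<not> adj G a c"
    and x: "adj G a x" and y: "adj G a y" and xy: "x \<noteq> y"
    and path: "p0 \<noteq> []" "hd p0 = x" "last p0 = y" "successively (adj G) p0" "set p0 \<subseteq> C \<union> {x, y}"
  shows "adj G x y"
proof (rule ccontr)
  assume nadj: "\<not> adj G x y"
  define P where "P q \<longleftrightarrow> q \<noteq> [] \<and> hd q = x \<and> last q = y \<and> successively (adj G) q \<and> set q \<subseteq> C \<union> {x, y}" for q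
  have "P p0" using path by (simp add: P_def)
  then obtain q where q: "P q" and min: "\<And>r. P r \<Longrightarrow> length q \<le> length r"
    using ex_has_least_nat[of P p0 length] by blast
  have q': "q \<noteq> []" "hd q = x" "last q = y" "successively (adj G) q" "set q \<subseteq> C \<union> {x, y}"
    using q by (simp_all add: P_def)
  \<comment> \<open>A shortest path has no shortcut: adjacent vertices on it are
    consecutive.\<close>
  have short: "ys = []" if "q = xs @ [u] @ ys @ [v] @ zs" "adj G u v" for xs u ys v zs
  proof (rule ccontr)
    assume "ys \<noteq> []"
    have "P (xs @ [u, v] @ zs)"
    proof -
      have "hd (xs @ [u, v] @ zs) = hd q" by (cases xs) (simp_all add: that(1))
      moreover have "last (xs @ [u, v] @ zs) = last q" by (simp add: that(1))
      moreover have "successively (adj G) (xs @ [u, v] @ zs)"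
      proof -
        have "successively (adj G) (v # zs)"
          using q'(4) successively_append_iff[of _ "xs @ u # ys" "v # zs"] by (simp add: that(1))
        then show ?thesis
          using q'(4) that(2) unfolding that(1) by (simp add: successively_append_iff)
      qed
      ultimately show ?thesis using q' unfolding P_def by (auto simp: that(1))
    qed
    from min[OF this] \<open>ys \<noteq> []\<close> show False by (simp add: that(1))
  qed
  have dist: "distinct q"
  proof (rule ccontr)
    assume "\<not> distinct q"
    then obtain xs u ys zs where d: "q = xs @ [u] @ ys @ [u] @ zs"
      using not_distinct_decomp by blast
    have "P (xs @ [u] @ zs)"
    proof -
      have "hd (xs @ [u] @ zs) = hd q" by (cases xs) (simp_all add: d)
      moreover have "last (xs @ [u] @ zs) = last q" by (simp add: d)
      moreover have "successively (adj G) (xs @ [u] @ zs)"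
      proof -
        have "successively (adj G) (u # zs)"
          using q'(4) successively_append_iff[of _ "xs @ u # ys" "u # zs"] by (simp add: d)
        then show ?thesis using q'(4) unfolding d by (simp add: successively_append_iff)
      qed
      ultimately show ?thesis using q' unfolding P_def by (auto simp: d)
    qed
    from min[OF this] show False by (simp add: d)
  qed
  have "length q \<noteq> 1" using q' xy by (auto simp: length_Suc_conv)
  moreover have "length q \<noteq> 2" using q' nadj by (auto simp: length_Suc_conv numeral_2_eq_2)
  moreover have "length q \<noteq> 0" using q' by simp
  ultimately have len: "3 \<le> length q" by linarith
  have a: "a \<notin> set q"
    using q'(5) C x y simple_graph_adjD(1)[OF G(1)] by fastforce
  have cyc: "is_cycle G (a # q)"
    using len dist a q' x y by (auto simp: is_cycle_iff successively_Cons adj_sym)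
  moreover have "4 \<le> length (a # q)" using len by simp
  ultimately obtain u v where uv: "u \<in> set (a # q)" "v \<in> set (a # q)" "adj G u v"
    "{u, v} \<notin> cycle_edges (a # q)"
    using G(2) unfolding chordal_def by blast
  \<comment> \<open>The only neighbours of \<open>a\<close> on the path are its ends, because
    \<open>C\<close> avoids the neighbourhood of \<open>a\<close>. Together with
    \<open>short\<close>, every edge between vertices of the cycle belongs to the cycle, contrary to
    chordality.\<close>
  have a_edge: "{a, z} \<in> cycle_edges (a # q)" if "z \<in> set q" "adj G a z" for z
  proof -
    have "z = x \<or> z = y" using that q'(5) C by blast
    then show ?thesis
    proof
      assume "z = x"
      obtain r where "q = x # r" using q' by (cases q) auto
      then show ?thesis using consecutive_in_cycle_edges[of a x "[]" r] \<open>z = x\<close> by simp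
    next
      assume "z = y"
      then show ?thesis
        using last_hd_in_cycle_edges[of "a # q"] q' by (simp add: insert_commute)
    qed
  qed
  have "u \<noteq> v" using simple_graph_adjD(1)[OF G(1) uv(3)] .
  have in_q: "{s, t} \<in> cycle_edges (a # q)" if st: "q = xs @ s # ys" "t \<in> set ys" "adj G s t" for s t xs ys
  proof -
    obtain ys1 ys2 where ys: "ys = ys1 @ t # ys2" using st(2) by (meson split_list)
    then have "ys1 = []" using short[of xs s ys1 t ys2] st by simp
    then show ?thesis using consecutive_in_cycle_edges[of s t "a # xs" ys2] st ys by simp
  qed
  show False
  proof (cases "u = a \<or> v = a")
    case True
    then show False using a_edge[of u] a_edge[of v] uv \<open>u \<noteq> v\<close> by (auto simp: insert_commute)
  next
    case False
    then have "u \<in> set q" "v \<in> set q" using uv by auto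
    then obtain xs ys where s: "q = xs @ u # ys" by (meson split_list)
    show False
    proof (cases "v \<in> set ys")
      case True
      then show False using in_q[OF s] uv by blast
    next
      case False
      then have "v \<in> set xs" using \<open>v \<in> set q\<close> \<open>u \<noteq> v\<close> s by auto
      then obtain xs1 xs2 where "xs = xs1 @ v # xs2" by (meson split_list)
      then have "q = xs1 @ v # (xs2 @ u # ys)" using s by simp
      from in_q[OF this, of u] uv show False by (simp add: insert_commute)
    qed
  qed
qed

text \<open>A form of Dirac's theorem on simplicial vertices; prescribing a non-neighbour of
  \<open>a\<close> makes the induction work. \<open>C\<close> is the component of \<open>b\<close>
  among the non-neighbours of \<open>a\<close> in \<open>W\<close>, and \<open>B\<close> is its
  boundary in \<open>W\<close>. By \<open>chordal_separator_clique\<close>, \<open>B\<close> is a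
  clique, and a vertex of \<open>C\<close> that is simplicial in \<open>C \<union> B\<close> is
  simplicial in \<open>W\<close>. As \<open>C \<union> B\<close> misses \<open>a\<close>, the
  induction hypothesis applies to it.\<close>

lemma simplicial_non_neighbour:
  assumes G: "simple_graph G" "chordal G"
    and "finite W" "a \<in> W" "b \<in> W" "b \<noteq> a" "\<not> adj G a b"
  shows "\<exists>s\<in>W. s \<noteq> a \<and> \<not> adj G a s \<and> simplicial G W s"
  using assms(3-)
proof (induction "card W" arbitrary: W a b rule: less_induct)
  case less
  define M where "M = {z \<in> W. z \<noteq> a \<and> \<not> adj G a z}"
  define R where "R z z' \<longleftrightarrow> z \<in> M \<and> z' \<in> M \<and> adj G z z'" for z z'
  define C where "C = {z. (b, z) \<in> {(z, z'). R z z'}\<^sup>*}"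
  define B where "B = {z \<in> W. z \<notin> C \<and> (\<exists>c\<in>C. adj G c z)}"
  have bM: "b \<in> M" using less.prems by (simp add: M_def)
  have CM: "C \<subseteq> M"
  proof
    fix z assume "z \<in> C"
    then have "(b, z) \<in> {(z, z'). R z z'}\<^sup>*" by (simp add: C_def)
    then show "z \<in> M" using bM by (cases rule: rtranclE) (auto simp: R_def)
  qed
  have bC: "b \<in> C" by (simp add: C_def)
  have B_adj: "adj G a z" if z: "z \<in> B" for z
  proof (rule ccontr)
    assume n: "\<not> adj G a z"
    obtain c where c: "c \<in> C" "adj G c z" using z by (auto simp: B_def)
    have "c \<in> M" using c CM by blast
    then have "z \<noteq> a" using c(2) by (auto simp: M_def adj_sym)
    then have "R c z" using n z c \<open>c \<in> M\<close> by (auto simp: R_def M_def B_def)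
    then have "z \<in> C" using c by (auto simp: C_def intro: rtrancl_into_rtrancl)
    then show False using z by (simp add: B_def)
  qed
  have symR: "sym ({(z, z'). R z z'}\<^sup>*)"
    by (rule sym_rtrancl) (auto simp: sym_def R_def adj_sym)
  have B_clique: "adj G x y" if "x \<in> B" "y \<in> B" "x \<noteq> y" for x y
  proof -
    have "\<exists>c\<in>C. adj G c x" "\<exists>d\<in>C. adj G d y" using that by (simp_all add: B_def)
    then obtain c d where c: "c \<in> C" "adj G c x" and d: "d \<in> C" "adj G d y" by blast
    have "(b, c) \<in> {(z, z'). R z z'}\<^sup>*" "(b, d) \<in> {(z, z'). R z z'}\<^sup>*"
      using c(1) d(1) unfolding C_def by simp_all
    then have "(c, d) \<in> {(z, z'). R z z'}\<^sup>*" by (rule rtrancl_trans[OF symD[OF symR]])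
    then obtain p where p: "p \<noteq> []" "hd p = c" "last p = d" "successively R p"
      using rtrancl_list[of c d R] by blast
    have pC: "set p \<subseteq> C"
    proof -
      have "successively R q \<Longrightarrow> q \<noteq> [] \<Longrightarrow> hd q \<in> C \<Longrightarrow> set q \<subseteq> C" for q
      proof (induction q rule: induct_list012)
        case (3 z z' zs)
        then have "z \<in> C" "R z z'" by auto
        then have "z' \<in> C" by (auto simp: C_def intro: rtrancl_into_rtrancl)
        with 3 show ?case by auto
      qed auto
      with p c show ?thesis by blast
    qed
    have "successively (adj G) p"
      using p(4) by (rule successively_mono) (auto simp: R_def)
    then have "successively (adj G) (x # p @ [y])"
      using p c d by (auto simp: successively_append_iff successively_Cons adj_sym)
    then show ?thesis
      using chordal_separator_clique[OF G, of C a x y "x # p @ [y]"] CM B_adj that pC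
      by (auto simp: M_def)
  qed
  define W1 where "W1 = C \<union> B"
  have W1: "W1 \<subseteq> W - {a}" using CM B_adj simple_graph_adjD(1)[OF G(1)]
    by (auto simp: W1_def M_def B_def)
  then have card: "card W1 < card W"
    using less.prems by (metis Diff_subset card_Diff1_less card_mono finite_Diff order_le_less_trans)
  have fin: "finite W1" using W1 less.prems finite_subset by (metis finite_Diff)
  have done_: "\<exists>s\<in>W. s \<noteq> a \<and> \<not> adj G a s \<and> simplicial G W s" if "s \<in> C" "simplicial G W1 s" for s
  proof (intro bexI conjI)
    have "z \<in> W1" if "z \<in> W" "adj G s z" for z
      using that \<open>s \<in> C\<close> by (auto simp: W1_def B_def)
    then show "simplicial G W s" using that(2) unfolding simplicial_def by blast
  qed (use that CM in \<open>auto simp: M_def\<close>)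
  show ?case
  proof (cases "\<forall>c\<in>W1. \<forall>d\<in>W1. c \<noteq> d \<longrightarrow> adj G c d")
    case True
    then have "simplicial G W1 b" by (auto simp: simplicial_def)
    then show ?thesis by (rule done_[OF bC])
  next
    case False
    show ?thesis
    \<comment> \<open>The simplicial vertex must lie outside \<open>B\<close>. It does if it is not
      adjacent to some other vertex of the clique \<open>B\<close>; and if the vertices of
      \<open>B\<close> are adjacent to all of \<open>W1\<close>, then every vertex with a
      non-neighbour in \<open>W1\<close> lies outside \<open>B\<close>.\<close>
    proof (cases "\<exists>x\<in>B. \<exists>d\<in>W1. d \<noteq> x \<and> \<not> adj G x d")
      case True
      then obtain x d where "x \<in> B" "d \<in> W1" "d \<noteq> x" "\<not> adj G x d" by blast
      moreover from this have "x \<in> W1" by (simp add: W1_def)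
      moreover from less.hyps[OF card fin this \<open>d \<in> W1\<close> \<open>d \<noteq> x\<close> \<open>\<not> adj G x d\<close>]
      obtain s where "s \<in> W1" "s \<noteq> x" "\<not> adj G x s" "simplicial G W1 s" by blast
      ultimately have "s \<in> C" using B_clique by (auto simp: W1_def)
      then show ?thesis by (rule done_[OF _ \<open>simplicial G W1 s\<close>])
    next
      case univ: False
      from False obtain c d where cd: "c \<in> W1" "d \<in> W1" "c \<noteq> d" "\<not> adj G c d" by blast
      from less.hyps[OF card fin cd(1,2) cd(3)[symmetric] cd(4)]
      obtain s where s: "s \<in> W1" "s \<noteq> c" "\<not> adj G c s" "simplicial G W1 s" by blast
      have "s \<notin> B"
      proof
        assume "s \<in> B"
        from univ have "\<forall>x\<in>B. \<forall>d\<in>W1. d = x \<or> adj G x d" by simp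
        from bspec[OF bspec[OF this \<open>s \<in> B\<close>] cd(1)] have "adj G s c" using s(2) by simp
        then show False using s(3) by (simp add: insert_commute)
      qed
      then have "s \<in> C" using s(1) by (simp add: W1_def)
      then show ?thesis by (rule done_[OF _ s(4)])
    qed
  qed
qed

lemma chordal_simplicial:
  assumes "simple_graph G" "chordal G" "finite W" "W \<noteq> {}"
  shows "\<exists>s\<in>W. simplicial G W s"
proof (cases "\<exists>a\<in>W. \<exists>b\<in>W. b \<noteq> a \<and> \<not> adj G a b")
  case True
  then show ?thesis using simplicial_non_neighbour[OF assms(1-3)] by blast
next
  case False
  then have "simplicial G W s" for s unfolding simplicial_def by metis
  then show ?thesis using assms(4) by blast
qed

text \<open>Take the interval with the leftmost right end: all intervals that meet it contain this
  end and therefore meet each other.\<close>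

lemma interval_simplicial:
  assumes "simple_graph G" "interval_graph G" "finite W" "W \<noteq> {}" "W \<subseteq> verts G"
  shows "\<exists>s\<in>W. simplicial G W s"
proof -
  obtain l r :: "'a \<Rightarrow> real" where lr: "\<And>v. v \<in> verts G \<Longrightarrow> l v \<le> r v"
    and adj: "\<And>u v. u \<in> verts G \<Longrightarrow> v \<in> verts G \<Longrightarrow> u \<noteq> v \<Longrightarrow>
      adj G u v \<longleftrightarrow> {l u..r u} \<inter> {l v..r v} \<noteq> {}"
    using assms(2) unfolding interval_graph_def by blast
  obtain s where s: "s \<in> W" "\<And>v. v \<in> W \<Longrightarrow> r s \<le> r v"
    using assms(3,4) by (rule finite_min[where f = r]) (rule that)
  have *: "r s \<in> {l v..r v}" if "v \<in> W" "adj G s v" for v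
  proof -
    have "s \<noteq> v" using simple_graph_adjD(1)[OF assms(1) that(2)] .
    then have "{l s..r s} \<inter> {l v..r v} \<noteq> {}" using adj[of s v] that s assms(5) by auto
    then have "l v \<le> r s" by auto
    then show ?thesis using s(2)[OF that(1)] by simp
  qed
  have "adj G a b" if "a \<in> W" "b \<in> W" "adj G s a" "adj G s b" "a \<noteq> b" for a b
  proof -
    have "r s \<in> {l a..r a} \<inter> {l b..r b}" using * that by blast
    then show ?thesis using adj[of a b] that assms(5) by blast
  qed
  with s show ?thesis by (auto simp: simplicial_def)
qed

section \<open>Community degeneracy\<close>

text \<open>This is bounded community degeneracy in the sense of Buchanan et al.\<close>

definition community_degenerate :: "nat \<Rightarrow> 'a graph \<Rightarrow> bool" where
  "community_degenerate D G \<longleftrightarrow>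
     (\<forall>F \<subseteq> edges G. F \<noteq> {} \<longrightarrow> (\<exists>u v. {u, v} \<in> F \<and> card {w. {u, w} \<in> F \<and> {v, w} \<in> F} \<le> D))"

lemma community_degenerate_mono: "community_degenerate D G \<Longrightarrow> D \<le> D' \<Longrightarrow> community_degenerate D' G"
  unfolding community_degenerate_def by (meson le_trans)

text \<open>A vertex \<open>v\<close> of small degree among the vertices covered by \<open>F\<close>
  lies on an edge of \<open>F\<close>, and the common neighbours of the ends of this edge are
  neighbours of \<open>v\<close>.\<close>

lemma community_degenerate_if_degenerate:
  assumes G: "simple_graph G"
    and deg: "\<And>W. W \<subseteq> verts G \<Longrightarrow> finite W \<Longrightarrow> W \<noteq> {} \<Longrightarrow>
      \<exists>v\<in>W. card {u\<in>W. adj G v u} \<le> D"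
  shows "community_degenerate D G"
  unfolding community_degenerate_def
proof (intro allI impI)
  fix F assume F: "F \<subseteq> edges G" "F \<noteq> {}"
  have sub: "\<Union>F \<subseteq> verts G" using F G by (auto simp: simple_graph_def)
  moreover have "finite (\<Union>F)" using sub by (rule finite_subset) (use G in \<open>simp add: simple_graph_def\<close>)
  moreover have "\<Union>F \<noteq> {}"
  proof -
    obtain e where "e \<in> F" using F by blast
    then have "card e = 2" using F G by (auto simp: simple_graph_def)
    then have "e \<noteq> {}" by auto
    then show ?thesis using \<open>e \<in> F\<close> by blast
  qed
  ultimately obtain v where v: "v \<in> \<Union>F" "card {u\<in>\<Union>F. adj G v u} \<le> D" using deg by blast
  then obtain e where e: "e \<in> F" "v \<in> e" by blast
  obtain a b where "e = {a, b}" using simple_graph_edgeE[OF G subsetD[OF F(1) e(1)]] .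
  then obtain u where u: "{v, u} \<in> F" using e by (auto simp: insert_commute)
  have "{w. {v, w} \<in> F \<and> {u, w} \<in> F} \<subseteq> {u\<in>\<Union>F. adj G v u}" using F by blast
  moreover have "finite {u\<in>\<Union>F. adj G v u}"
    by (rule finite_subset[OF _ finite_neighbours[OF G, of v]]) (auto simp: neighbours_def)
  ultimately have "card {w. {v, w} \<in> F \<and> {u, w} \<in> F} \<le> card {u\<in>\<Union>F. adj G v u}"
    by (intro card_mono)
  then show "\<exists>u v. {u, v} \<in> F \<and> card {w. {u, w} \<in> F \<and> {v, w} \<in> F} \<le> D"
    using v(2) u by (intro exI[of _ v] exI[of _ u]) simp
qed

text \<open>An edge of \<open>F\<close> with as many ends outside \<open>S\<close> as possible has
  its common neighbours in \<open>S\<close>. With two such ends this holds because \<open>S\<close>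
  meets the triangle; otherwise the neighbours of one of its ends all lie in
  \<open>S\<close>.\<close>

lemma community_degenerate_if_triangle_hitting:
  assumes G: "simple_graph G" and S: "finite S" "card S \<le> D"
    and tri: "\<And>u v w. u \<notin> S \<Longrightarrow> v \<notin> S \<Longrightarrow> w \<notin> S \<Longrightarrow> adj G u v \<Longrightarrow> adj G u w \<Longrightarrow> adj G v w \<Longrightarrow> False"
  shows "community_degenerate D G"
  unfolding community_degenerate_def
proof (intro allI impI)
  fix F assume F: "F \<subseteq> edges G" "F \<noteq> {}"
  have "\<exists>u v. {u, v} \<in> F \<and> {w. {u, w} \<in> F \<and> {v, w} \<in> F} \<subseteq> S"
  proof (cases "\<exists>u v. {u, v} \<in> F \<and> u \<notin> S \<and> v \<notin> S")
    case True
    then obtain u v where uv: "{u, v} \<in> F" "u \<notin> S" "v \<notin> S" by (elim exE conjE)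
    have "w \<in> S" if "{u, w} \<in> F" "{v, w} \<in> F" for w
      using tri[OF uv(2,3) _ subsetD[OF F(1) uv(1)] subsetD[OF F(1) that(1)] subsetD[OF F(1) that(2)]]
      by (rule ccontr)
    then show ?thesis using uv(1) by (intro exI[of _ u] exI[of _ v]) auto
  next
    case False
    have out: "v \<in> S" if "{u, v} \<in> F" "u \<notin> S" for u v
      by (rule ccontr, rule notE[OF False]) (intro exI[of _ u] exI[of _ v] conjI that; assumption)
    show ?thesis
    proof (cases "\<exists>u v. {u, v} \<in> F \<and> u \<notin> S")
      case True
      then obtain u v where "{u, v} \<in> F" "u \<notin> S" by (elim exE conjE)
      then show ?thesis using out[of u] by (intro exI[of _ u] exI[of _ v]) auto
    next
      case False
      have inside: "u \<in> S" if "{u, v} \<in> F" for u v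
        by (rule ccontr, rule notE[OF False]) (intro exI[of _ u] exI[of _ v] conjI that; assumption)
      obtain e where e: "e \<in> F" using F by auto
      obtain u v where "e = {u, v}" using simple_graph_edgeE[OF G subsetD[OF F(1) e]] .
      moreover have "w \<in> S" if "{u, w} \<in> F" for w
        using inside[of w u] that by (simp add: insert_commute)
      ultimately show ?thesis using e by (intro exI[of _ u] exI[of _ v]) auto
    qed
  qed
  then obtain u v where uv: "{u, v} \<in> F" "{w. {u, w} \<in> F \<and> {v, w} \<in> F} \<subseteq> S"
    by (elim exE conjE)
  then have "card {w. {u, w} \<in> F \<and> {v, w} \<in> F} \<le> D"
    using card_mono[OF S(1) uv(2)] S(2) by simp
  then show "\<exists>u v. {u, v} \<in> F \<and> card {w. {u, w} \<in> F \<and> {v, w} \<in> F} \<le> D"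
    using uv(1) by (intro exI conjI)
qed

text \<open>Many triangles at every edge force a large minimum degree and thus a long cycle, which a
  triangle at one of its edges turns into an odd cycle of at least half the length.\<close>

lemma community_degenerate_if_odd_cycles_bounded:
  assumes G: "simple_graph G" and l: "\<And>c. is_cycle G c \<Longrightarrow> odd (length c) \<Longrightarrow> length c \<le> l"
  shows "community_degenerate (2 * l + 2) G"
  unfolding community_degenerate_def
proof (intro allI impI)
  fix F assume F: "F \<subseteq> edges G" "F \<noteq> {}"
  show "\<exists>u v. {u, v} \<in> F \<and> card {w. {u, w} \<in> F \<and> {v, w} \<in> F} \<le> 2 * l + 2"
  proof (rule ccontr)
    assume "\<not> ?thesis"
    then have many: "2 * l + 2 < card {w. {u, w} \<in> F \<and> {v, w} \<in> F}" if "{u, v} \<in> F" for u v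
      using that by (auto simp: not_le)
    define H where "H = (\<Union>F, F)"
    have sub: "\<Union>F \<subseteq> verts G" using F G by (auto simp: simple_graph_def)
    then have H: "simple_graph H"
      using F G finite_subset unfolding H_def simple_graph_def by auto
    have "verts H \<noteq> {}"
    proof -
      obtain e where "e \<in> F" using F by blast
      moreover from this have "card e = 2" using F G by (auto simp: simple_graph_def)
      then have "e \<noteq> {}" by auto
      ultimately show ?thesis by (auto simp: H_def)
    qed
    moreover have "2 * l + 2 \<le> vdegree H v" if v: "v \<in> verts H" for v
    proof -
      obtain e where e: "e \<in> F" "v \<in> e" using v by (auto simp: H_def)
      obtain a b where "e = {a, b}" using simple_graph_edgeE[OF G subsetD[OF F(1) e(1)]] .
      then obtain u where u: "{v, u} \<in> F" using e by (auto simp: insert_commute)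
      have "card {w. {v, w} \<in> F \<and> {u, w} \<in> F} \<le> vdegree H v"
        unfolding vdegree_def
        by (intro card_mono finite_neighbours[OF H]) (auto simp: neighbours_def H_def)
      then show ?thesis using many[OF u] by simp
    qed
    \<comment> \<open>A common neighbour of the ends of an edge counts for the degree of either end.
      The summand 2 makes the degrees at least 2 even for \<open>l = 0\<close>, and half of a length
      above \<open>2 * l + 2\<close> exceeds \<open>l\<close>.\<close>
    ultimately obtain c where c: "is_cycle H c" "2 * l + 2 < length c"
      using min_degree_cycle[OF H, of "2 * l + 2"] by auto
    then have "is_cycle G c" using F by (auto simp: is_cycle_def H_def)
    moreover obtain w where "{last c, w} \<in> F" "{hd c, w} \<in> F"
    proof -
      have "{last c, hd c} \<in> F" using c by (simp add: is_cycle_iff H_def)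
      from many[OF this] have "{w. {last c, w} \<in> F \<and> {hd c, w} \<in> F} \<noteq> {}"
        by (intro notI) (simp only: card.empty not_less_zero)
      then show ?thesis using that by blast
    qed
    then have "adj G w (last c)" "adj G w (hd c)" using F by (auto simp: insert_commute)
    ultimately obtain c' where "is_cycle G c'" "odd (length c')" "length c \<le> 2 * length c'"
      using odd_cycle_from_triangle[OF G] by blast
    then show False using l[of c'] c(2) by simp
  qed
qed

text \<open>The neighbours of a simplicial vertex outside \<open>S\<close> form a clique, so there
  are fewer than \<open>k\<close> of them; all others lie in \<open>S\<close>.\<close>

lemma simplicial_degenerate:
  assumes G: "simple_graph G" and S: "S \<subseteq> verts G" and clq: "\<not> has_clique G k"
    and simp: "\<And>W. W \<subseteq> verts G - S \<Longrightarrow> W \<noteq> {} \<Longrightarrow> \<exists>s\<in>W. simplicial (del_verts G S) W s"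
  shows "community_degenerate (card S + k) G"
proof (rule community_degenerate_if_degenerate[OF G])
  fix W assume W: "W \<subseteq> verts G" "finite W" "W \<noteq> {}"
  have fin: "finite W" "finite S" using W S G finite_subset unfolding simple_graph_def by blast+
  show "\<exists>v\<in>W. card {u\<in>W. adj G v u} \<le> card S + k"
  proof (cases "W - S = {}")
    case True
    obtain v where "v \<in> W" using W by blast
    moreover have "card {u\<in>W. adj G v u} \<le> card S"
      using True fin by (intro card_mono) auto
    ultimately show ?thesis by force
  next
    case False
    then obtain s where s: "s \<in> W - S" "simplicial (del_verts G S) (W - S) s"
      using simp[of "W - S"] W by blast
    define N where "N = {u\<in>W - S. adj G s u}"
    have finN: "finite N" using fin by (simp add: N_def)
    have clique: "adj G u v" if "u \<in> N" "v \<in> N" "u \<noteq> v" for u v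
      using s that unfolding simplicial_def N_def del_verts_def by auto
    have "card N < k"
    proof (rule ccontr)
      assume "\<not> card N < k"
      then obtain C where C: "C \<subseteq> N" "card C = k" using obtain_subset_with_card_n by (metis not_less)
      then have "has_clique G k"
        using clique W unfolding has_clique_def N_def by (intro exI[of _ C]) blast
      with clq show False by blast
    qed
    moreover have "card {u\<in>W. adj G s u} \<le> card (S \<union> N)"
      using fin finN by (intro card_mono) (auto simp: N_def)
    then have "card {u\<in>W. adj G s u} \<le> card S + card N" using card_Un_le le_trans by blast
    ultimately have "card {u\<in>W. adj G s u} \<le> card S + k" by simp
    then show ?thesis using s by blast
  qed
qed

lemma simple_graph_del_verts: "simple_graph G \<Longrightarrow> simple_graph (del_verts G S)"
  by (auto simp: simple_graph_def del_verts_def)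

section \<open>Tree decompositions\<close>

text \<open>A walk can leave the leaf \<open>t\<close> only to the vertex from which it entered. The
  auxiliary claim therefore records, for a walk that is at \<open>t\<close>, that the neighbour of
  \<open>t\<close> is already reachable without \<open>t\<close>.\<close>

lemma connected_remove_leaf:
  assumes conn: "connected_graph H" and noloop: "{t} \<notin> edges H"
    and leaf: "\<And>y z. adj H t y \<Longrightarrow> adj H t z \<Longrightarrow> y = z" and ne: "verts H - {t} \<noteq> {}"
  shows "connected_graph (del_verts H {t})"
proof -
  define R where "R = {(x, y). adj (del_verts H {t}) x y}"
  have R_step: "(y, z) \<in> R" if "adj H y z" "y \<noteq> t" "z \<noteq> t" for y z
    using that by (auto simp: R_def del_verts_def)
  have *: "(b \<noteq> t \<longrightarrow> (a, b) \<in> R\<^sup>*) \<and> (b = t \<longrightarrow> (\<forall>y. adj H t y \<longrightarrow> (a, y) \<in> R\<^sup>*))"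
    if "(a, b) \<in> {(x, y). adj H x y}\<^sup>*" "a \<noteq> t" for a b
    using that
  proof (induction rule: rtrancl_induct)
    case (step y z)
    have yz: "adj H y z" using step by simp
    show ?case
    proof (cases "y = t")
      case True
      then have "(a, z) \<in> R\<^sup>*" using step yz by blast
      moreover have "z \<noteq> t" using True yz noloop by auto
      ultimately show ?thesis by blast
    next
      case False
      then have ay: "(a, y) \<in> R\<^sup>*" using step by blast
      show ?thesis
      proof (cases "z = t")
        case True
        then have "adj H t y" using yz by (simp add: insert_commute)
        then show ?thesis using leaf ay True by blast
      next
        case z: False
        have "(y, z) \<in> R" using yz False z by (rule R_step)
        then show ?thesis using ay z by (auto intro: rtrancl_into_rtrancl)
      qed
    qed
  qed simp
  show ?thesis
    unfolding connected_graph_def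
  proof (intro conjI ballI)
    show "verts (del_verts H {t}) \<noteq> {}" using ne by (simp add: del_verts_def)
    fix u v assume "u \<in> verts (del_verts H {t})" "v \<in> verts (del_verts H {t})"
    then have uv: "u \<in> verts H" "v \<in> verts H" "u \<noteq> t" "v \<noteq> t" by (auto simp: del_verts_def)
    then have "(u, v) \<in> {(x, y). adj H x y}\<^sup>*" using conn unfolding connected_graph_def by blast
    from *[OF this uv(3)] uv(4) show "(u, v) \<in> {(x, y). adj (del_verts H {t}) x y}\<^sup>*"
      by (simp add: R_def)
  qed
qed

text \<open>Minimum degree 2 would force a cycle. Isolated vertices count as leaves here.\<close>

lemma forest_leaf:
  assumes T: "simple_graph T" "forest T" "verts T \<noteq> {}"
  obtains t where "t \<in> verts T" "\<And>y z. adj T t y \<Longrightarrow> adj T t z \<Longrightarrow> y = z"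
proof -
  have "\<exists>t\<in>verts T. vdegree T t < 2"
  proof (rule ccontr)
    assume "\<not> ?thesis"
    then obtain c where "is_cycle T c"
      using min_degree_cycle[OF T(1,3), of 2] by (auto simp: not_less)
    then show False using T(2) by (simp add: forest_def)
  qed
  then obtain t where t: "t \<in> verts T" "card (neighbours T t) < 2" by (auto simp: vdegree_def)
  have "y = z" if "adj T t y" "adj T t z" for y z
  proof (rule ccontr)
    assume "y \<noteq> z"
    then have "card {y, z} = 2" by simp
    moreover have "card {y, z} \<le> card (neighbours T t)"
      using that by (intro card_mono finite_neighbours T(1)) (auto simp: neighbours_def)
    ultimately show False using t by simp
  qed
  with t that show ?thesis by blast
qed

lemma tree_decomposition_degenerate:
  assumes "simple_graph T" "forest T" "W \<noteq> {}"
    and "\<And>v. v \<in> W \<Longrightarrow> connected_graph (induced T {t\<in>verts T. v \<in> B t})"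
    and "\<And>u v. u \<in> W \<Longrightarrow> v \<in> W \<Longrightarrow> R u v \<Longrightarrow> \<exists>t\<in>verts T. u \<in> B t \<and> v \<in> B t"
  shows "\<exists>v\<in>W. \<exists>t\<in>verts T. v \<in> B t \<and> (\<forall>u\<in>W. R v u \<longrightarrow> u \<in> B t)"
  using assms
proof (induction "card (verts T)" arbitrary: T rule: less_induct)
  case less
  let ?X = "\<lambda>T v. {t\<in>verts T. v \<in> B t}"
  have fin: "finite (verts T)" using less.prems by (simp add: simple_graph_def)
  have ne: "?X T v \<noteq> {}" if "v \<in> W" for v
    using less.prems(4)[OF that] by (simp add: connected_graph_def induced_def)
  then have "verts T \<noteq> {}" using less.prems(3) by blast
  then obtain t where t: "t \<in> verts T" "\<And>y z. adj T t y \<Longrightarrow> adj T t z \<Longrightarrow> y = z"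
    using forest_leaf less.prems(1,2) by blast
  show ?case
  proof (cases "\<exists>v\<in>W. ?X T v = {t}")
    case True
    then obtain v where v: "v \<in> W" "?X T v = {t}" by blast
    have "u \<in> B t" if u: "u \<in> W" "R v u" for u
    proof -
      obtain s where s: "s \<in> verts T" "v \<in> B s" "u \<in> B s" using less.prems(5)[OF v(1) u] by blast
      then have "s \<in> {t}" unfolding v(2)[symmetric] by simp
      then show ?thesis using s by simp
    qed
    moreover have "v \<in> B t" using v(2) by auto
    ultimately have "\<exists>t\<in>verts T. v \<in> B t \<and> (\<forall>u\<in>W. R v u \<longrightarrow> u \<in> B t)"
      using t(1) by blast
    then show ?thesis using v t(1) by blast
  next
    case False
    define T' where "T' = del_verts T {t}"
    have T': "verts T' = verts T - {t}" by (simp add: T'_def del_verts_def)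
    have other: "?X T v - {t} \<noteq> {}" if "v \<in> W" for v using False that ne[OF that] by blast
    have conn: "connected_graph (induced T' (?X T' v))" if "v \<in> W" for v
    proof -
      have eq: "induced T' (?X T' v) = del_verts (induced T (?X T v)) {t}"
        unfolding T'_def by (auto simp: induced_def del_verts_def)
      show ?thesis unfolding eq
        by (rule connected_remove_leaf[OF less.prems(4)[OF that]])
          (use other[OF that] t(2) simple_graph_no_loop[OF less.prems(1)] in \<open>auto simp: induced_def\<close>)
    qed
    \<comment> \<open>The nodes whose bags contain \<open>v\<close> are connected and
      \<open>t\<close> is not the only one, so a neighbour of \<open>t\<close> is among them; as
      \<open>t\<close> is a leaf, it is the same for all \<open>v\<close>.\<close>
    have nb: "\<exists>y. adj T t y \<and> y \<in> ?X T v" if v: "v \<in> W" "v \<in> B t" for v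
    proof -
      obtain s where s: "s \<in> ?X T v" "s \<noteq> t" using other[OF v(1)] by blast
      then have "(t, s) \<in> {(x, y). adj (induced T (?X T v)) x y}\<^sup>*"
        using less.prems(4)[OF v(1)] v t(1) unfolding connected_graph_def by (simp add: induced_def)
      then obtain y where "adj (induced T (?X T v)) t y"
        using s(2) by (cases rule: converse_rtranclE) auto
      then show ?thesis by (auto simp: induced_def)
    qed
    have "\<exists>v\<in>W. \<exists>t\<in>verts T'. v \<in> B t \<and> (\<forall>u\<in>W. R v u \<longrightarrow> u \<in> B t)"
    proof (rule less.hyps[OF _ _ _ less.prems(3) conn])
      show "card (verts T') < card (verts T)"
        unfolding T' using fin t(1) by (intro psubset_card_mono) auto
      show "simple_graph T'" unfolding T'_def by (rule simple_graph_del_verts[OF less.prems(1)])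
      show "forest T'"
        using less.prems(2) by (auto simp: forest_def is_cycle_def T'_def del_verts_def)
      fix u v assume uv: "u \<in> W" "v \<in> W" "R u v"
      from less.prems(5)[OF this] obtain s where s: "s \<in> verts T" "u \<in> B s" "v \<in> B s" by blast
      show "\<exists>t\<in>verts T'. u \<in> B t \<and> v \<in> B t"
      proof (cases "s = t")
        case True
        obtain y where "adj T t y" "y \<in> ?X T u" using nb uv s True by blast
        moreover obtain z where "adj T t z" "z \<in> ?X T v" using nb uv s True by blast
        moreover have "y = z" using t(2) \<open>adj T t y\<close> \<open>adj T t z\<close> by blast
        moreover have "y \<noteq> t" using \<open>adj T t y\<close> simple_graph_no_loop[OF less.prems(1)] by auto
        ultimately show ?thesis unfolding T' by blast
      next
        case False
        then show ?thesis using s T' by blast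
      qed
    qed
    then show ?thesis using T' by blast
  qed
qed

section \<open>Bounds by the graph parameters\<close>

lemma finite_edges: "simple_graph G \<Longrightarrow> finite (edges G)"
  by (rule finite_subset[of _ "Pow (verts G)"]) (auto simp: simple_graph_def)

lemma card_edges_le:
  assumes "simple_graph G" shows "card (edges G) \<le> card (verts G) * card (verts G)"
proof -
  have fin: "finite (verts G \<times> verts G)" using assms by (simp add: simple_graph_def)
  have "edges G \<subseteq> (\<lambda>(u, v). {u, v}) ` (verts G \<times> verts G)"
  proof
    fix e assume "e \<in> edges G"
    then obtain u v where uv: "e = {u, v}" "adj G u v" using simple_graph_edgeE[OF assms] by metis
    then have "(u, v) \<in> verts G \<times> verts G" using simple_graph_adjD[OF assms] by blast
    then show "e \<in> (\<lambda>(u, v). {u, v}) ` (verts G \<times> verts G)" using uv by (intro image_eqI[of _ _ "(u, v)"]) auto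
  qed
  then have "card (edges G) \<le> card ((\<lambda>(u, v). {u, v}) ` (verts G \<times> verts G))"
    using fin by (intro card_mono) auto
  also have "\<dots> \<le> card (verts G \<times> verts G)" by (rule card_image_le[OF fin])
  finally show ?thesis by (simp add: card_cartesian_product)
qed

lemma vdegree_le_card: "simple_graph G \<Longrightarrow> vdegree G v \<le> card (verts G)"
  unfolding vdegree_def using neighbours_subset[of G v]
  by (intro card_mono) (auto simp: simple_graph_def)

lemma max_degree_le_iff:
  "simple_graph G \<Longrightarrow> max_degree G \<le> d \<longleftrightarrow> (\<forall>v\<in>verts G. vdegree G v \<le> d)"
  unfolding max_degree_def by (subst Max_le_iff) (auto simp: simple_graph_def)

lemma adj_set_subset_neighbours: "{u\<in>W. adj G v u} \<subseteq> neighbours G v"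
  by (auto simp: neighbours_def)

subsection \<open>Vertex orderings\<close>

text \<open>The pattern for the parameters defined by \<open>LEAST\<close>: a trivial witness shows
  that the minimum is attained, and its value is the crude bound that later justifies the parameters
  of the queries.\<close>

lemma bandwidth_le:
  assumes "simple_graph G" shows "bandwidth G \<le> card (verts G)"
    and "\<exists>b \<le> bandwidth G. \<exists>\<pi>. bij_betw \<pi> (verts G) {..<card (verts G)} \<and>
      (\<forall>u v. adj G u v \<longrightarrow> \<bar>int (\<pi> u) - int (\<pi> v)\<bar> \<le> int b)"
proof -
  let ?Q = "\<lambda>b. \<exists>\<pi>. bij_betw \<pi> (verts G) {..<card (verts G)} \<and>
      (\<forall>u v. adj G u v \<longrightarrow> \<bar>int (\<pi> u) - int (\<pi> v)\<bar> \<le> int b)"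
  obtain \<pi> where \<pi>: "bij_betw \<pi> (verts G) {..<card (verts G)}"
    using ex_bij_betw_finite_nat[of "verts G"] assms by (auto simp: simple_graph_def atLeast0LessThan)
  have "\<bar>int (\<pi> u) - int (\<pi> v)\<bar> \<le> int (card (verts G))" if "adj G u v" for u v
  proof -
    have "\<pi> u < card (verts G)" "\<pi> v < card (verts G)"
      using bspec[OF bij_betwE[OF \<pi>]] simple_graph_adjD(2,3)[OF assms that] by simp_all
    then show ?thesis by linarith
  qed
  then have Q: "?Q (card (verts G))" using \<pi> by blast
  then show "bandwidth G \<le> card (verts G)" unfolding bandwidth_def by (rule Least_le)
  show "\<exists>b \<le> bandwidth G. ?Q b" using LeastI[of ?Q, OF Q] unfolding bandwidth_def by blast
qed

lemma cutwidth_le: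
  assumes "simple_graph G" shows "cutwidth G \<le> card (edges G)"
    and "\<exists>\<pi> :: 'a \<Rightarrow> nat. bij_betw \<pi> (verts G) {..<card (verts G)} \<and>
     (\<forall>i. card {e \<in> edges G. \<exists>u \<in> e. \<exists>v \<in> e. \<pi> u \<le> i \<and> i < \<pi> v} \<le> cutwidth G)" (is "?Q (cutwidth G)")
proof -
  obtain \<pi> where \<pi>: "bij_betw \<pi> (verts G) {..<card (verts G)}"
    using ex_bij_betw_finite_nat[of "verts G"] assms by (auto simp: simple_graph_def atLeast0LessThan)
  have "card {e \<in> edges G. \<exists>u \<in> e. \<exists>v \<in> e. \<pi> u \<le> i \<and> i < \<pi> v} \<le> card (edges G)" for i
    by (rule card_mono[OF finite_edges[OF assms]]) auto
  then have Q: "?Q (card (edges G))" using \<pi> by blast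
  then show "cutwidth G \<le> card (edges G)" unfolding cutwidth_def by (rule Least_le)
  show "?Q (cutwidth G)" using LeastI[of ?Q, OF Q] unfolding cutwidth_def .
qed

text \<open>The leftmost vertex of \<open>W\<close> has all its neighbours in \<open>W\<close> among
  the next \<open>bandwidth G\<close> positions.\<close>

lemma bandwidth_community:
  assumes G: "simple_graph G"
  shows "community_degenerate (bandwidth G) G"
proof (rule community_degenerate_if_degenerate[OF G])
  fix W assume W: "W \<subseteq> verts G" "finite W" "W \<noteq> {}"
  obtain b \<pi> where b: "b \<le> bandwidth G" and \<pi>: "bij_betw \<pi> (verts G) {..<card (verts G)}"
      "\<And>u v. adj G u v \<Longrightarrow> \<bar>int (\<pi> u) - int (\<pi> v)\<bar> \<le> int b"
    using bandwidth_le(2)[OF G] by blast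
  obtain v where v: "v \<in> W" "\<And>u. u \<in> W \<Longrightarrow> \<pi> v \<le> \<pi> u"
    using W(2,3) by (rule finite_min[where f = \<pi>]) (rule that)
  have inj: "inj_on \<pi> (verts G)" using \<pi>(1) by (simp add: bij_betw_def)
  have "\<pi> ` {u\<in>W. adj G v u} \<subseteq> {\<pi> v<..\<pi> v + b}"
  proof
    fix x assume "x \<in> \<pi> ` {u\<in>W. adj G v u}"
    then obtain u where u: "x = \<pi> u" "u \<in> W" "adj G v u" by blast
    have "v \<noteq> u" using simple_graph_adjD(1)[OF G u(3)] .
    then have "\<pi> v \<noteq> \<pi> u" using inj_onD[OF inj] u v W by blast
    then show "x \<in> {\<pi> v<..\<pi> v + b}" using v(2)[OF u(2)] \<pi>(2)[OF u(3)] u(1) by auto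
  qed
  from card_mono[OF _ this] have "card (\<pi> ` {u\<in>W. adj G v u}) \<le> b" by simp
  moreover have "inj_on \<pi> {u\<in>W. adj G v u}"
    by (rule inj_on_subset[OF inj]) (use W in auto)
  ultimately have "card {u\<in>W. adj G v u} \<le> bandwidth G" using b by (simp add: card_image)
  then show "\<exists>v\<in>W. card {u\<in>W. adj G v u} \<le> bandwidth G" using v by blast
qed

text \<open>All edges from the leftmost vertex of \<open>W\<close> into \<open>W\<close> cross the
  cut right behind this vertex.\<close>

lemma cutwidth_community:
  assumes G: "simple_graph G"
  shows "community_degenerate (cutwidth G) G"
proof (rule community_degenerate_if_degenerate[OF G])
  fix W assume W: "W \<subseteq> verts G" "finite W" "W \<noteq> {}"
  obtain \<pi> where \<pi>: "bij_betw \<pi> (verts G) {..<card (verts G)}"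
      "\<And>i. card {e \<in> edges G. \<exists>u \<in> e. \<exists>v \<in> e. \<pi> u \<le> i \<and> i < \<pi> v} \<le> cutwidth G"
    using cutwidth_le(2)[OF G] by blast
  obtain v where v: "v \<in> W" "\<And>u. u \<in> W \<Longrightarrow> \<pi> v \<le> \<pi> u"
    using W(2,3) by (rule finite_min[where f = \<pi>]) (rule that)
  have inj: "inj_on \<pi> (verts G)" using \<pi>(1) by (simp add: bij_betw_def)
  have "(\<lambda>u. {v, u}) ` {u\<in>W. adj G v u} \<subseteq> {e \<in> edges G. \<exists>x \<in> e. \<exists>y \<in> e. \<pi> x \<le> \<pi> v \<and> \<pi> v < \<pi> y}"
  proof
    fix e assume "e \<in> (\<lambda>u. {v, u}) ` {u\<in>W. adj G v u}"
    then obtain u where u: "e = {v, u}" "u \<in> W" "adj G v u" by blast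
    have "v \<noteq> u" using simple_graph_adjD(1)[OF G u(3)] .
    then have "\<pi> v \<noteq> \<pi> u" using inj_onD[OF inj] u v W by blast
    then show "e \<in> {e \<in> edges G. \<exists>x \<in> e. \<exists>y \<in> e. \<pi> x \<le> \<pi> v \<and> \<pi> v < \<pi> y}"
      using v(2)[OF u(2)] u(1,3) by auto
  qed
  from card_mono[OF _ this] have "card ((\<lambda>u. {v, u}) ` {u\<in>W. adj G v u}) \<le> cutwidth G"
    using finite_edges[OF G] \<pi>(2)[of "\<pi> v"] by simp
  moreover have "inj_on (\<lambda>u. {v, u}) {u\<in>W. adj G v u}" by (auto simp: inj_on_def doubleton_eq_iff)
  ultimately have "card {u\<in>W. adj G v u} \<le> cutwidth G" by (simp add: card_image)
  then show "\<exists>v\<in>W. card {u\<in>W. adj G v u} \<le> cutwidth G" using v by blast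
qed

lemma degeneracy_le:
  assumes "simple_graph G" shows "degeneracy G \<le> card (verts G)"
    and "\<And>H. subgraph H G \<Longrightarrow> verts H \<noteq> {} \<Longrightarrow> \<exists>v\<in>verts H. vdegree H v \<le> degeneracy G"
proof -
  let ?Q = "\<lambda>d. \<forall>H. subgraph H G \<and> verts H \<noteq> {} \<longrightarrow> (\<exists>v \<in> verts H. vdegree H v \<le> d)"
  have Q: "?Q (card (verts G))"
  proof (intro allI impI)
    fix H assume H: "subgraph H G \<and> verts H \<noteq> {}"
    then obtain v where "v \<in> verts H" by blast
    moreover have "vdegree H v \<le> card (verts H)"
      using H by (intro vdegree_le_card) (simp add: subgraph_def)
    moreover have "card (verts H) \<le> card (verts G)"
      using H assms by (intro card_mono) (auto simp: subgraph_def simple_graph_def)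
    ultimately show "\<exists>v \<in> verts H. vdegree H v \<le> card (verts G)" using le_trans by blast
  qed
  then show "degeneracy G \<le> card (verts G)" unfolding degeneracy_def by (rule Least_le)
  have "?Q (degeneracy G)" using LeastI[of ?Q, OF Q] unfolding degeneracy_def .
  then show "\<And>H. subgraph H G \<Longrightarrow> verts H \<noteq> {} \<Longrightarrow> \<exists>v\<in>verts H. vdegree H v \<le> degeneracy G"
    by blast
qed

lemma degeneracy_community:
  assumes G: "simple_graph G"
  shows "community_degenerate (degeneracy G) G"
proof (rule community_degenerate_if_degenerate[OF G])
  fix W assume W: "W \<subseteq> verts G" "finite W" "W \<noteq> {}"
  have "simple_graph (induced G W)"
    using G W finite_subset by (auto simp: simple_graph_def induced_def)
  then have "subgraph (induced G W) G" using W by (auto simp: subgraph_def induced_def)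
  from degeneracy_le(2)[OF G this] obtain v where v: "v \<in> W" "vdegree (induced G W) v \<le> degeneracy G"
    using W by (auto simp: induced_def)
  moreover have "neighbours (induced G W) v = {u\<in>W. adj G v u}"
    using v(1) by (auto simp: neighbours_def induced_def)
  ultimately show "\<exists>v\<in>W. card {u\<in>W. adj G v u} \<le> degeneracy G" by (auto simp: vdegree_def)
qed

lemma max_degree_community:
  assumes G: "simple_graph G"
  shows "community_degenerate (max_degree G) G"
proof (rule community_degenerate_if_degenerate[OF G])
  fix W assume W: "W \<subseteq> verts G" "finite W" "W \<noteq> {}"
  then obtain v where v: "v \<in> W" by blast
  have "card {u\<in>W. adj G v u} \<le> vdegree G v"
    unfolding vdegree_def by (rule card_mono[OF finite_neighbours[OF G] adj_set_subset_neighbours])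
  also have "\<dots> \<le> max_degree G" using max_degree_le_iff[OF G, of "max_degree G"] v W by auto
  finally show "\<exists>v\<in>W. card {u\<in>W. adj G v u} \<le> max_degree G" using v by blast
qed

lemma max_degree_le: "simple_graph G \<Longrightarrow> max_degree G \<le> card (verts G)"
  by (simp add: max_degree_le_iff vdegree_le_card)

subsection \<open>Deletion distances\<close>

lemma vertex_deletion_distance_le:
  assumes "Q (del_verts G (verts G))"
  shows "vertex_deletion_distance Q G \<le> card (verts G)"
    and "\<exists>S\<subseteq>verts G. card S = vertex_deletion_distance Q G \<and> Q (del_verts G S)" (is "?P (vertex_deletion_distance Q G)")
proof -
  have P: "?P (card (verts G))" using assms by blast
  then show "vertex_deletion_distance Q G \<le> card (verts G)"
    unfolding vertex_deletion_distance_def by (rule Least_le)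
  show "?P (vertex_deletion_distance Q G)"
    using LeastI[of ?P, OF P] unfolding vertex_deletion_distance_def .
qed

lemma del_all_verts: "simple_graph G \<Longrightarrow> del_verts G (verts G) = ({}, {})"
proof -
  assume G: "simple_graph G"
  have "e \<inter> verts G \<noteq> {}" if "e \<in> edges G" for e
  proof -
    have "card e = 2" "e \<subseteq> verts G" using G that by (auto simp: simple_graph_def)
    then show ?thesis by (cases "e = {}") auto
  qed
  then show ?thesis by (auto simp: del_verts_def)
qed

lemma deletion_to_empty:
  assumes "simple_graph G"
  shows "forest (del_verts G (verts G))" "bipartite (del_verts G (verts G))"
    "chordal (del_verts G (verts G))" "interval_graph (del_verts G (verts G))"
    "max_degree (del_verts G (verts G)) \<le> d"
  unfolding del_all_verts[OF assms]
  by (auto simp: forest_def bipartite_def chordal_def interval_graph_def max_degree_def is_cycle_iff)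

lemma adj_del_verts: "u \<notin> S \<Longrightarrow> v \<notin> S \<Longrightarrow> adj (del_verts G S) u v \<longleftrightarrow> adj G u v"
  by (auto simp: del_verts_def)

text \<open>A vertex outside the deletion set \<open>S\<close> has at most \<open>d\<close>
  neighbours outside \<open>S\<close>; if \<open>W\<close> lies within \<open>S\<close>, the size of
  \<open>S\<close> is the bound.\<close>

lemma distance_to_bounded_degree_community:
  assumes G: "simple_graph G"
  shows "community_degenerate (distance_to_bounded_degree d G + d) G"
proof (rule community_degenerate_if_degenerate[OF G])
  fix W assume W: "W \<subseteq> verts G" "finite W" "W \<noteq> {}"
  obtain S where S: "S \<subseteq> verts G" "card S = distance_to_bounded_degree d G" "max_degree (del_verts G S) \<le> d"
    using vertex_deletion_distance_le(2)[of "\<lambda>H. max_degree H \<le> d" G] deletion_to_empty(5)[OF G]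
    unfolding distance_to_bounded_degree_def by blast
  have finS: "finite S" using S(1) G finite_subset by (auto simp: simple_graph_def)
  show "\<exists>v\<in>W. card {u\<in>W. adj G v u} \<le> distance_to_bounded_degree d G + d"
  proof (cases "W \<subseteq> S")
    case True
    obtain v where v: "v \<in> W" using W by blast
    have "card {u\<in>W. adj G v u} \<le> card S" using True finS by (intro card_mono) auto
    then show ?thesis using v S(2) by (intro bexI[of _ v]) auto
  next
    case False
    then obtain v where v: "v \<in> W" "v \<notin> S" by blast
    let ?N = "neighbours (del_verts G S) v"
    have dG: "simple_graph (del_verts G S)" by (rule simple_graph_del_verts[OF G])
    have "v \<in> verts (del_verts G S)" using v W by (auto simp: del_verts_def)
    then have N: "card ?N \<le> d"
      using S(3) unfolding max_degree_le_iff[OF dG] vdegree_def by blast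
    have "u \<in> S \<union> ?N" if "adj G v u" for u
      using that v(2) adj_del_verts[of v S u G] by (auto simp: neighbours_def)
    then have "{u\<in>W. adj G v u} \<subseteq> S \<union> ?N" by blast
    then have "card {u\<in>W. adj G v u} \<le> card (S \<union> ?N)"
      using finS finite_neighbours[OF dG] by (intro card_mono) auto
    also have "\<dots> \<le> card S + card ?N" by (rule card_Un_le)
    finally show ?thesis using v N S(2) by (intro bexI[of _ v]) auto
  qed
qed

lemma forest_no_triangle:
  assumes "simple_graph G" "forest G" "adj G u v" "adj G u w" "adj G v w" shows False
proof -
  have "is_cycle G [u, v, w]"
    using assms(3-) simple_graph_adjD(1)[OF assms(1)] by (auto simp: is_cycle_iff adj_sym)
  then show False using assms(2) by (simp add: forest_def)
qed

lemma bipartite_no_triangle: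
  assumes "bipartite G" "adj G u v" "adj G u w" "adj G v w" shows False
proof -
  obtain f :: "'a \<Rightarrow> bool" where f: "\<And>u v. adj G u v \<Longrightarrow> f u \<noteq> f v"
    using assms(1) unfolding bipartite_def by blast
  show False using f[OF assms(2)] f[OF assms(3)] f[OF assms(4)] by auto
qed

lemma triangle_free_deletion_community:
  assumes G: "simple_graph G" and empty: "Q (del_verts G (verts G))"
    and tri: "\<And>H :: 'a graph. \<And>u v w. simple_graph H \<Longrightarrow> Q H \<Longrightarrow> adj H u v \<Longrightarrow> adj H u w \<Longrightarrow> adj H v w \<Longrightarrow> False"
  shows "community_degenerate (vertex_deletion_distance Q G) G"
proof -
  obtain S where S: "S \<subseteq> verts G" "card S = vertex_deletion_distance Q G" "Q (del_verts G S)"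
    using vertex_deletion_distance_le(2)[of Q G, OF empty] by blast
  have "finite S" using S(1) G finite_subset by (auto simp: simple_graph_def)
  then show ?thesis
  proof (rule community_degenerate_if_triangle_hitting[OF G])
    fix u v w assume "u \<notin> S" "v \<notin> S" "w \<notin> S" "adj G u v" "adj G u w" "adj G v w"
    then show False
      using tri[OF simple_graph_del_verts[OF G] S(3), of u v w] adj_del_verts[of _ S _ G] by simp
  qed (simp add: S(2))
qed

text \<open>Complete graphs are chordal and interval graphs, so no bound in terms of the distance
  alone is possible; this is why \<open>k\<close> enters.\<close>

lemma simplicial_deletion_community:
  assumes G: "simple_graph G" and empty: "Q (del_verts G (verts G))"
    and simp: "\<And>H :: 'a graph. \<And>W. simple_graph H \<Longrightarrow> Q H \<Longrightarrow> W \<subseteq> verts H \<Longrightarrow> W \<noteq> {} \<Longrightarrow>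
      \<exists>s\<in>W. simplicial H W s"
  shows "has_clique G k \<or> community_degenerate (k + vertex_deletion_distance Q G) G"
proof (cases "has_clique G k")
  case clq: False
  obtain S where S: "S \<subseteq> verts G" "card S = vertex_deletion_distance Q G" "Q (del_verts G S)"
    using vertex_deletion_distance_le(2)[of Q G, OF empty] by blast
  have "community_degenerate (card S + k) G"
  proof (rule simplicial_degenerate[OF G S(1) clq])
    fix W assume "W \<subseteq> verts G - S" "W \<noteq> {}"
    then show "\<exists>s\<in>W. simplicial (del_verts G S) W s"
      by (intro simp[OF simple_graph_del_verts[OF G] S(3)]) (auto simp: del_verts_def)
  qed
  then show ?thesis by (simp add: S(2) add.commute)
qed simp

lemma edge_bipartization_number_le:
  assumes "simple_graph G"
  shows "edge_bipartization_number G \<le> card (edges G)"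
    and "\<exists>F\<subseteq>edges G. card F = edge_bipartization_number G \<and> bipartite (del_edges G F)" (is "?P (edge_bipartization_number G)")
proof -
  have "bipartite (del_edges G (edges G))" by (simp add: bipartite_def del_edges_def)
  then have P: "?P (card (edges G))" by blast
  then show "edge_bipartization_number G \<le> card (edges G)"
    unfolding edge_bipartization_number_def by (rule Least_le)
  show "?P (edge_bipartization_number G)"
    using LeastI[of ?P, OF P] unfolding edge_bipartization_number_def .
qed

lemma edge_bipartization_community:
  assumes G: "simple_graph G"
  shows "community_degenerate (edge_bipartization_number G) G"
proof -
  obtain F where F: "F \<subseteq> edges G" "card F = edge_bipartization_number G" "bipartite (del_edges G F)"
    using edge_bipartization_number_le(2)[OF G] by blast
  have fin: "finite F" using F(1) finite_edges[OF G] finite_subset by blast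
  have pick: "(SOME x. x \<in> e) \<in> e" if "e \<in> F" for e
  proof -
    have "card e = 2" using that F(1) G by (auto simp: simple_graph_def)
    then have "\<exists>x. x \<in> e" by (metis card.empty ex_in_conv zero_neq_numeral)
    then show ?thesis by (rule someI_ex)
  qed
  \<comment> \<open>One end of every deleted edge: a set that meets all triangles and is no larger
    than \<open>F\<close>.\<close>
  define S where "S = (\<lambda>e. SOME x. x \<in> e) ` F"
  have keep: "adj (del_edges G F) u v" if uv: "u \<notin> S" "v \<notin> S" "adj G u v" for u v
  proof -
    have "{u, v} \<notin> F"
    proof
      assume "{u, v} \<in> F"
      from pick[OF this] imageI[OF this, of "\<lambda>e. SOME x. x \<in> e"]
      obtain x where "x \<in> {u, v}" "x \<in> S" unfolding S_def by blast
      then show False using uv by auto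
    qed
    then show ?thesis using uv(3) by (simp add: del_edges_def)
  qed
  show ?thesis
  proof (rule community_degenerate_if_triangle_hitting[OF G])
    show "finite S" using fin by (simp add: S_def)
    show "card S \<le> edge_bipartization_number G" using card_image_le[OF fin] F(2) by (simp add: S_def)
    fix u v w assume "u \<notin> S" "v \<notin> S" "w \<notin> S" "adj G u v" "adj G u w" "adj G v w"
    then show False using bipartite_no_triangle[OF F(3), of u v w] keep by simp
  qed
qed

lemma vertex_cover_number_le:
  assumes G: "simple_graph G"
  shows "vertex_cover_number G \<le> card (verts G)"
    and "\<exists>S\<subseteq>verts G. card S = vertex_cover_number G \<and> (\<forall>e\<in>edges G. e \<inter> S \<noteq> {})" (is "?P (vertex_cover_number G)")
proof -
  have "e \<inter> verts G \<noteq> {}" if "e \<in> edges G" for e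
  proof -
    have "card e = 2" "e \<subseteq> verts G" using G that by (auto simp: simple_graph_def)
    then show ?thesis by (cases "e = {}") auto
  qed
  then have P: "?P (card (verts G))" by blast
  then show "vertex_cover_number G \<le> card (verts G)"
    unfolding vertex_cover_number_def by (rule Least_le)
  show "?P (vertex_cover_number G)"
    using LeastI[of ?P, OF P] unfolding vertex_cover_number_def .
qed

lemma vertex_cover_community:
  assumes G: "simple_graph G"
  shows "community_degenerate (vertex_cover_number G) G"
proof -
  obtain S where S: "S \<subseteq> verts G" "card S = vertex_cover_number G" "\<And>e. e \<in> edges G \<Longrightarrow> e \<inter> S \<noteq> {}"
    using vertex_cover_number_le(2)[OF G] by blast
  have "finite S" using S(1) G finite_subset by (auto simp: simple_graph_def)
  then show ?thesis
  proof (rule community_degenerate_if_triangle_hitting[OF G])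
    fix u v w assume "u \<notin> S" "v \<notin> S" "adj G u v"
    then show False using S(3)[of "{u, v}"] by simp
  qed (simp add: S(2))
qed

lemma longest_odd_cycle_bounds:
  assumes G: "simple_graph G"
  shows "longest_odd_cycle G \<le> card (verts G)"
    and "\<And>c. is_cycle G c \<Longrightarrow> odd (length c) \<Longrightarrow> length c \<le> longest_odd_cycle G"
proof -
  have *: "{length c | c. is_cycle G c \<and> odd (length c)} \<subseteq> {..card (verts G)}"
    using is_cycle_length_le[OF G] by auto
  then have fin: "finite {length c | c. is_cycle G c \<and> odd (length c)}"
    using finite_subset by blast
  show "longest_odd_cycle G \<le> card (verts G)"
    unfolding longest_odd_cycle_def using fin * by (subst Max_le_iff) auto
  show "length c \<le> longest_odd_cycle G" if "is_cycle G c" "odd (length c)" for c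
    unfolding longest_odd_cycle_def using fin that by (intro Max_ge) auto
qed

lemma longest_odd_cycle_community:
  "simple_graph G \<Longrightarrow> community_degenerate (2 * longest_odd_cycle G + 2) G"
  by (rule community_degenerate_if_odd_cycles_bounded[OF _ longest_odd_cycle_bounds(2)])

subsection \<open>Decompositions\<close>

lemma treedepth_bounds:
  assumes G: "simple_graph G"
  shows "treedepth G \<le> card (verts G)"
    and "\<exists>P. elimination_forest G P \<and> (\<forall>v\<in>verts G. card {u. (u, v) \<in> P\<^sup>*} \<le> treedepth G)" (is "?Q (treedepth G)")
proof -
  have fin: "finite (verts G)" using G by (simp add: simple_graph_def)
  obtain \<pi> where \<pi>: "bij_betw \<pi> (verts G) {..<card (verts G)}"
    using ex_bij_betw_finite_nat[OF fin] by (auto simp: atLeast0LessThan)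
  have inj: "inj_on \<pi> (verts G)" using \<pi> by (simp add: bij_betw_def)
  \<comment> \<open>The vertices in a row, rooted at the first one: any two are comparable, and the
    height is at most the number of vertices.\<close>
  define P where "P = {(u, v). u \<in> verts G \<and> v \<in> verts G \<and> \<pi> v = Suc (\<pi> u)}"
  have path: "(u, v) \<in> P\<^sup>+" if "u \<in> verts G" "v \<in> verts G" "\<pi> v = Suc (\<pi> u + n)" for u v n
    using that
  proof (induction n arbitrary: v)
    case 0
    then show ?case by (auto simp: P_def)
  next
    case (Suc n)
    have "Suc (\<pi> u + n) < card (verts G)"
      using bspec[OF bij_betwE[OF \<pi>] Suc.prems(2)] Suc.prems(3) by simp
    then obtain w where w: "w \<in> verts G" "\<pi> w = Suc (\<pi> u + n)"
      using bij_betw_imp_surj_on[OF \<pi>] by (metis imageE lessThan_iff)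
    then have "(u, w) \<in> P\<^sup>+" using Suc by blast
    moreover have "(w, v) \<in> P" using w Suc.prems by (simp add: P_def)
    ultimately show ?case by (rule trancl_into_trancl)
  qed
  have "elimination_forest G P"
    unfolding elimination_forest_def
  proof (intro conjI allI impI)
    show "P \<subseteq> verts G \<times> verts G" by (auto simp: P_def)
    show "single_valued (P\<inverse>)"
      using inj by (auto simp: single_valued_def P_def inj_on_def)
    show "acyclic P"
      by (rule acyclic_subset[OF wf_acyclic[OF wf_measure[of \<pi>]]]) (auto simp: P_def)
    fix u v assume uv: "adj G u v"
    have mem: "u \<in> verts G" "v \<in> verts G" using simple_graph_adjD[OF G uv] by auto
    have "\<pi> u \<noteq> \<pi> v"
      using inj_onD[OF inj _ mem] simple_graph_adjD(1)[OF G uv] by blast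
    then consider n where "\<pi> v = Suc (\<pi> u + n)" | n where "\<pi> u = Suc (\<pi> v + n)"
      by (metis less_iff_Suc_add nat_neq_iff)
    then show "(u, v) \<in> P\<^sup>+ \<or> (v, u) \<in> P\<^sup>+"
      using path mem by cases blast+
  qed
  moreover have "card {u. (u, v) \<in> P\<^sup>*} \<le> card (verts G)" if "v \<in> verts G" for v
  proof (rule card_mono[OF fin])
    show "{u. (u, v) \<in> P\<^sup>*} \<subseteq> verts G"
    proof
      fix u assume "u \<in> {u. (u, v) \<in> P\<^sup>*}"
      then have "(u, v) \<in> P\<^sup>*" by simp
      then show "u \<in> verts G" using that by (cases rule: converse_rtranclE) (auto simp: P_def)
    qed
  qed
  ultimately have Q: "?Q (card (verts G))" by blast
  then show "treedepth G \<le> card (verts G)" unfolding treedepth_def by (rule Least_le)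
  show "?Q (treedepth G)" using LeastI[of ?Q, OF Q] unfolding treedepth_def .
qed

text \<open>A deepest vertex of a subgraph is adjacent to ancestors only.\<close>

lemma treedepth_community:
  assumes G: "simple_graph G"
  shows "community_degenerate (treedepth G) G"
proof (rule community_degenerate_if_degenerate[OF G])
  fix W assume W: "W \<subseteq> verts G" "finite W" "W \<noteq> {}"
  obtain P where P: "elimination_forest G P"
    and h: "\<And>v. v \<in> verts G \<Longrightarrow> card {u. (u, v) \<in> P\<^sup>*} \<le> treedepth G"
    using treedepth_bounds(2)[OF G] by blast
  have P': "P \<subseteq> verts G \<times> verts G" "acyclic P"
    "\<And>u v. adj G u v \<Longrightarrow> (u, v) \<in> P\<^sup>+ \<or> (v, u) \<in> P\<^sup>+"
    using P unfolding elimination_forest_def by auto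
  let ?anc = "\<lambda>v. {u. (u, v) \<in> P\<^sup>*}"
  have fin: "finite (verts G)" using G by (simp add: simple_graph_def)
  have fanc: "finite (?anc v)" for v
  proof (rule finite_subset[of _ "insert v (verts G)"])
    show "?anc v \<subseteq> insert v (verts G)"
    proof
      fix u assume "u \<in> ?anc v"
      then have "(u, v) \<in> P\<^sup>*" by simp
      then show "u \<in> insert v (verts G)" using P'(1) by (cases rule: converse_rtranclE) auto
    qed
  qed (use fin in simp)
  obtain v where v: "v \<in> W" "\<And>u. u \<in> W \<Longrightarrow> card (?anc u) \<le> card (?anc v)"
    using W(2,3) by (rule finite_max[where f = "\<lambda>v. card (?anc v)"]) (rule that)
  have "{u\<in>W. adj G v u} \<subseteq> ?anc v"
  proof
    fix u assume "u \<in> {u\<in>W. adj G v u}"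
    then have u: "u \<in> W" "adj G v u" by auto
    show "u \<in> ?anc v"
    proof (rule ccontr)
      assume "u \<notin> ?anc v"
      then have "(u, v) \<notin> P\<^sup>+" by (auto dest: trancl_into_rtrancl)
      then have vu: "(v, u) \<in> P\<^sup>+" using P'(3)[OF u(2)] by blast
      have "?anc v \<subseteq> ?anc u" using vu by (auto intro: rtrancl_trans dest: trancl_into_rtrancl)
      then have "?anc v \<subset> ?anc u" using \<open>u \<notin> ?anc v\<close> by auto
      then have "card (?anc v) < card (?anc u)" using fanc psubset_card_mono by blast
      then show False using v(2)[OF u(1)] by simp
    qed
  qed
  from card_mono[OF fanc this] have "card {u\<in>W. adj G v u} \<le> treedepth G"
    using h[of v] v(1) W(1) by fastforce
  then show "\<exists>v\<in>W. card {u\<in>W. adj G v u} \<le> treedepth G" using v(1) by blast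
qed

lemma pathwidth_bounds:
  assumes G: "simple_graph G"
  shows "pathwidth G \<le> card (verts G)"
    and "\<exists>Bs. path_decomposition G Bs \<and> (\<forall>B\<in>set Bs. card B \<le> pathwidth G + 1)" (is "?Q (pathwidth G)")
proof -
  have "path_decomposition G [verts G]"
    using G by (auto simp: path_decomposition_def simple_graph_def)
  then have Q: "?Q (card (verts G))" by (intro exI[of _ "[verts G]"]) simp
  then show "pathwidth G \<le> card (verts G)" unfolding pathwidth_def by (rule Least_le)
  show "?Q (pathwidth G)" using LeastI[of ?Q, OF Q] unfolding pathwidth_def .
qed

text \<open>All neighbours of the vertex whose first bag comes last are in this bag.\<close>

lemma pathwidth_community:
  assumes G: "simple_graph G"
  shows "community_degenerate (pathwidth G + 1) G"
proof (rule community_degenerate_if_degenerate[OF G])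
  fix W assume W: "W \<subseteq> verts G" "finite W" "W \<noteq> {}"
  obtain Bs where Bs: "path_decomposition G Bs"
    and card: "\<And>B. B \<in> set Bs \<Longrightarrow> card B \<le> pathwidth G + 1"
    using pathwidth_bounds(2)[OF G] by blast
  have un: "(\<Union>B \<in> set Bs. B) = verts G"
    and edge: "\<And>e. e \<in> edges G \<Longrightarrow> \<exists>B\<in>set Bs. e \<subseteq> B"
    and int: "\<And>i j l. i \<le> j \<Longrightarrow> j \<le> l \<Longrightarrow> l < length Bs \<Longrightarrow> Bs ! i \<inter> Bs ! l \<subseteq> Bs ! j"
    using Bs unfolding path_decomposition_def by auto
  have fin: "finite (verts G)" using G by (simp add: simple_graph_def)
  define f where "f v = (LEAST i. i < length Bs \<and> v \<in> Bs ! i)" for v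
  have f: "f v < length Bs" "v \<in> Bs ! f v" if "v \<in> W" for v
  proof -
    have "v \<in> (\<Union>B \<in> set Bs. B)" using that W un by blast
    then obtain B where "B \<in> set Bs" "v \<in> B" by blast
    then obtain i where "i < length Bs \<and> v \<in> Bs ! i" by (metis in_set_conv_nth)
    from LeastI[of "\<lambda>i. i < length Bs \<and> v \<in> Bs ! i", OF this]
    show "f v < length Bs" "v \<in> Bs ! f v" by (auto simp: f_def)
  qed
  have f_le: "f v \<le> i" if "i < length Bs" "v \<in> Bs ! i" for v i
    unfolding f_def using that by (intro Least_le) simp
  obtain v where v: "v \<in> W" "\<And>u. u \<in> W \<Longrightarrow> f u \<le> f v"
    using W(2,3) by (rule finite_max[where f = f]) (rule that)
  have "{u\<in>W. adj G v u} \<subseteq> Bs ! f v"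
  proof
    fix u assume "u \<in> {u\<in>W. adj G v u}"
    then have u: "u \<in> W" "adj G v u" by auto
    obtain B where "B \<in> set Bs" "{v, u} \<subseteq> B" using edge[OF u(2)] by blast
    then obtain j where j: "j < length Bs" "v \<in> Bs ! j" "u \<in> Bs ! j"
      by (metis in_set_conv_nth insert_subset)
    \<comment> \<open>Here \<open>f u \<le> f v \<le> j\<close>, and the bags that contain
      \<open>u\<close> are consecutive.\<close>
    have "u \<in> Bs ! f u \<inter> Bs ! j" using f[OF u(1)] j by blast
    then show "u \<in> Bs ! f v" using int[OF v(2)[OF u(1)] f_le[OF j(1,2)] j(1)] by blast
  qed
  moreover have B: "Bs ! f v \<in> set Bs" using f(1)[OF v(1)] by simp
  moreover have "Bs ! f v \<subseteq> verts G" using un B by blast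
  then have "finite (Bs ! f v)" using fin finite_subset by blast
  ultimately have "card {u\<in>W. adj G v u} \<le> pathwidth G + 1"
    using card_mono[of "Bs ! f v" "{u\<in>W. adj G v u}"] card[OF B] by linarith
  then show "\<exists>v\<in>W. card {u\<in>W. adj G v u} \<le> pathwidth G + 1" using v by blast
qed

lemma treewidth_bounds:
  assumes G: "simple_graph G"
  shows "treewidth G \<le> card (verts G)"
    and "\<exists>T B. tree_decomposition G T B \<and> (\<forall>t\<in>verts T. card (B t) \<le> treewidth G + 1)" (is "?Q (treewidth G)")
proof -
  have "tree_decomposition G ({0}, {}) (\<lambda>_. verts G)"
    using G
    by (auto simp: tree_decomposition_def tree_graph_def simple_graph_def connected_graph_def
        forest_def induced_def is_cycle_iff)
  then have Q: "?Q (card (verts G))"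
    by (intro exI[of _ "({0}, {})"] exI[of _ "\<lambda>_. verts G"]) simp
  then show "treewidth G \<le> card (verts G)" unfolding treewidth_def by (rule Least_le)
  show "?Q (treewidth G)" using LeastI[of ?Q, OF Q] unfolding treewidth_def .
qed

lemma treewidth_community:
  assumes G: "simple_graph G"
  shows "community_degenerate (treewidth G + 1) G"
proof (rule community_degenerate_if_degenerate[OF G])
  fix W assume W: "W \<subseteq> verts G" "finite W" "W \<noteq> {}"
  obtain T B where T: "tree_decomposition G T B"
    and card: "\<And>t. t \<in> verts T \<Longrightarrow> card (B t) \<le> treewidth G + 1"
    using treewidth_bounds(2)[OF G] by blast
  have T': "simple_graph T" "forest T" and un: "(\<Union>t\<in>verts T. B t) = verts G"
    and edge: "\<And>e. e \<in> edges G \<Longrightarrow> \<exists>t\<in>verts T. e \<subseteq> B t"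
    and conn: "\<And>v. v \<in> verts G \<Longrightarrow> connected_graph (induced T {t\<in>verts T. v \<in> B t})"
    using T unfolding tree_decomposition_def tree_graph_def by auto
  have "\<exists>v\<in>W. \<exists>t\<in>verts T. v \<in> B t \<and> (\<forall>u\<in>W. adj G v u \<longrightarrow> u \<in> B t)"
  proof (rule tree_decomposition_degenerate[OF T' W(3)])
    show "connected_graph (induced T {t \<in> verts T. v \<in> B t})" if "v \<in> W" for v
      using conn that W by blast
    show "\<exists>t\<in>verts T. u \<in> B t \<and> v \<in> B t" if "adj G u v" for u v
      using edge[OF that] by simp
  qed
  then obtain v t where v: "v \<in> W" "t \<in> verts T" "{u\<in>W. adj G v u} \<subseteq> B t" by blast
  have "B t \<subseteq> verts G" using un v(2) by blast
  then have "finite (B t)" using G finite_subset by (auto simp: simple_graph_def)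
  from card_mono[OF this v(3)] have "card {u\<in>W. adj G v u} \<le> treewidth G + 1"
    using card[OF v(2)] by linarith
  then show "\<exists>v\<in>W. card {u\<in>W. adj G v u} \<le> treewidth G + 1" using v by blast
qed

definition clique_parameters :: "nat \<Rightarrow> ('a graph \<Rightarrow> nat \<Rightarrow> nat) set" where
  "clique_parameters d =
     {\<lambda>G k. bandwidth G, \<lambda>G k. cutwidth G, \<lambda>G k. degeneracy G,
      \<lambda>G k. distance_to_bounded_degree d G, \<lambda>G k. edge_bipartization_number G,
      \<lambda>G k. feedback_vertex_set_number G, \<lambda>G k. k + distance_to_chordal G,
      \<lambda>G k. k + distance_to_interval G, \<lambda>G k. max_degree G,
      \<lambda>G k. odd_cycle_transversal_number G, \<lambda>G k. treedepth G, \<lambda>G k. vertex_cover_number G,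
      \<lambda>G k. longest_odd_cycle G, \<lambda>G k. pathwidth G, \<lambda>G k. treewidth G}"

text \<open>The factor 2 and the summand 2 stem from the longest odd cycle, and \<open>d\<close>
  from the distance to bounded degree. The clique is an alternative for the distances to chordal and
  interval graphs.\<close>

lemma clique_or_community_degenerate:
  assumes "\<kappa> \<in> clique_parameters d" and G: "simple_graph G"
  shows "has_clique G k \<or> community_degenerate (2 * \<kappa> G k + d + 2) G"
proof -
  have mono: "has_clique G k \<or> community_degenerate D' G"
    if "has_clique G k \<or> community_degenerate D G" "D \<le> D'" for D D'
    using that community_degenerate_mono by blast
  have chordal: "has_clique G k \<or> community_degenerate (k + distance_to_chordal G) G"
    unfolding distance_to_chordal_def
    by (rule simplicial_deletion_community[where Q = chordal, OF G deletion_to_empty(3)[OF G]])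
      (rule chordal_simplicial, auto intro: finite_subset simp: simple_graph_def)
  have interval: "has_clique G k \<or> community_degenerate (k + distance_to_interval G) G"
    unfolding distance_to_interval_def
    by (rule simplicial_deletion_community[where Q = interval_graph, OF G deletion_to_empty(4)[OF G]])
      (rule interval_simplicial, auto intro: finite_subset simp: simple_graph_def)
  have fvs: "community_degenerate (feedback_vertex_set_number G) G"
    unfolding feedback_vertex_set_number_def
    by (rule triangle_free_deletion_community[where Q = forest, OF G deletion_to_empty(1)[OF G]])
      (rule forest_no_triangle)
  have oct: "community_degenerate (odd_cycle_transversal_number G) G"
    unfolding odd_cycle_transversal_number_def
    by (rule triangle_free_deletion_community[where Q = bipartite, OF G deletion_to_empty(2)[OF G]])
      (rule bipartite_no_triangle)
  note bounds = bandwidth_community[OF G] cutwidth_community[OF G] degeneracy_community[OF G]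
    distance_to_bounded_degree_community[OF G, of d] edge_bipartization_community[OF G] fvs
    max_degree_community[OF G] oct treedepth_community[OF G] vertex_cover_community[OF G]
    longest_odd_cycle_community[OF G] pathwidth_community[OF G] treewidth_community[OF G]
  note bounds' = bounds[THEN disjI2, THEN mono] chordal[THEN mono] interval[THEN mono]
  show ?thesis
    using assms(1) unfolding clique_parameters_def
    by (elim insertE emptyE; hypsubst) (rule bounds', (simp; fail))+
qed

text \<open>The square accounts for cutwidth and edge bipartization number, which are bounded by the
  number of edges, and \<open>k\<close> for the two parameters that contain it.\<close>

lemma clique_parameters_le:
  assumes "\<kappa> \<in> clique_parameters d" and G: "simple_graph G"
  shows "\<kappa> G k \<le> card (verts G) * card (verts G) + card (verts G) + k"
proof -
  note bounds = bandwidth_le(1)[OF G] order_trans[OF cutwidth_le(1)[OF G] card_edges_le[OF G]]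
    degeneracy_le(1)[OF G] order_trans[OF edge_bipartization_number_le(1)[OF G] card_edges_le[OF G]]
    vertex_deletion_distance_le(1)[where Q = forest, OF deletion_to_empty(1)[OF G]]
    vertex_deletion_distance_le(1)[where Q = bipartite, OF deletion_to_empty(2)[OF G]]
    vertex_deletion_distance_le(1)[where Q = chordal, OF deletion_to_empty(3)[OF G]]
    vertex_deletion_distance_le(1)[where Q = interval_graph, OF deletion_to_empty(4)[OF G]]
    vertex_deletion_distance_le(1)[where Q = "\<lambda>H. max_degree H \<le> d", OF deletion_to_empty(5)[OF G]]
    max_degree_le[OF G] treedepth_bounds(1)[OF G] vertex_cover_number_le(1)[OF G]
    longest_odd_cycle_bounds(1)[OF G] pathwidth_bounds(1)[OF G] treewidth_bounds(1)[OF G]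
  show ?thesis
    using assms(1)
    unfolding clique_parameters_def feedback_vertex_set_number_def odd_cycle_transversal_number_def
      distance_to_chordal_def distance_to_interval_def distance_to_bounded_degree_def
    by (elim insertE emptyE; hypsubst) (use bounds in linarith)+
qed

section \<open>Correctness of the kernelization\<close>

lemma row_nth: "u < length A \<Longrightarrow> row A u = A ! u"
  by (simp add: row_def take_Suc_conv_app_nth hd_drop_conv_nth take_Suc)

lemma well_formed_iff: "well_formed A \<longleftrightarrow> adjacency_lists A"
proof -
  have "v < length A \<Longrightarrow> set (row A v) = set (A ! v)" for v by (simp add: row_nth)
  then show ?thesis
    unfolding well_formed_def adjacency_lists_def set_upt atLeast0LessThan Ball_def lessThan_iff
    by (simp add: row_nth cong: conj_cong imp_cong)
qed

lemma adjacency_listsD: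
  assumes "adjacency_lists A" "u < length A"
  shows "distinct (A ! u)" and "v \<in> set (A ! u) \<Longrightarrow> v < length A \<and> v \<noteq> u \<and> u \<in> set (A ! v)"
proof -
  have *: "distinct (A ! u) \<and> (\<forall>v\<in>set (A ! u). v < length A \<and> v \<noteq> u \<and> u \<in> set (A ! v))"
    using mp[OF spec[OF assms(1)[unfolded adjacency_lists_def]] assms(2)] .
  then show "distinct (A ! u)" by (rule conjunct1)
  show "v \<in> set (A ! u) \<Longrightarrow> v < length A \<and> v \<noteq> u \<and> u \<in> set (A ! v)"
    by (rule bspec[OF conjunct2[OF *]])
qed

lemma adj_graph_of:
  assumes "adjacency_lists A"
  shows "adj (graph_of A) u v \<longleftrightarrow> u < length A \<and> v \<in> set (A ! u)"
proof
  assume "adj (graph_of A) u v"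
  then obtain a b where ab: "{u, v} = {a, b}" "a < length A" "b \<in> set (A ! a)"
    unfolding graph_of_def snd_conv by blast
  moreover have "b < length A" "a \<in> set (A ! b)"
    using adjacency_listsD(2)[OF assms ab(2,3)] by blast+
  ultimately show "u < length A \<and> v \<in> set (A ! u)" unfolding doubleton_eq_iff by blast
next
  assume "u < length A \<and> v \<in> set (A ! u)"
  then show "adj (graph_of A) u v" unfolding graph_of_def snd_conv by blast
qed

lemma verts_graph_of [simp]: "verts (graph_of A) = {..<length A}"
  by (simp add: graph_of_def)

lemma simple_graph_graph_of:
  assumes "adjacency_lists A" shows "simple_graph (graph_of A)"
  unfolding simple_graph_def
proof (intro conjI ballI)
  fix e assume "e \<in> edges (graph_of A)"
  then obtain u v where e: "e = {u, v}" "u < length A" "v \<in> set (A ! u)"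
    unfolding graph_of_def snd_conv by blast
  have "v < length A" "v \<noteq> u" using adjacency_listsD(2)[OF assms e(2,3)] by blast+
  with e show "e \<subseteq> verts (graph_of A)" "card e = 2" by simp_all
qed simp

lemma has_clique_le: "simple_graph G \<Longrightarrow> has_clique G k \<Longrightarrow> k \<le> card (verts G)"
  unfolding has_clique_def simple_graph_def by (metis card_mono)

lemma parse_encode_adjacency_lists:
  assumes "adjacency_lists A"
  shows "parse (encode A k) = (A, min (length (encode A k)) k)"
proof (rule parse_encode)
  fix row v assume "row \<in> set A" "v \<in> set row"
  moreover from this obtain u where "u < length A" "row = A ! u" by (metis in_set_conv_nth)
  ultimately have "v < length A" using adjacency_listsD(2)[OF assms, of u v] by blast
  then show "v \<le> length (encode A k)" using length_encode_ge[of A k] by simp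
qed

text \<open>\<open>parse\<close> inverts \<open>encode\<close> up to the cap, and the cap cannot
  confuse \<open>k\<close> with another value because \<open>k\<close> is smaller than the length of
  the string.\<close>

lemma encodes_instance_unique:
  assumes "adjacency_lists A" "k \<le> length A" "encodes_instance (encode A k) G k'"
  shows "G = graph_of A \<and> k' = k"
proof -
  obtain A' where A': "adjacency_lists A'" "G = graph_of A'" "encode A k = encode A' k'"
    using assms(3) unfolding encodes_instance_def by blast
  have "(A, min (length (encode A k)) k) = (A', min (length (encode A k)) k')"
    by (rule trans[OF parse_encode_adjacency_lists[OF assms(1), of k, symmetric]
          parse_encode_adjacency_lists[OF A'(1), of k', folded A'(3)]])
  moreover have "k < length (encode A k)" using assms(2) length_encode_ge[of A k] by simp
  ultimately show ?thesis using A'(2) by (auto simp: min_def split: if_splits)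
qed

definition valid :: "nat list list \<Rightarrow> nat \<Rightarrow> bool" where
  "valid A k \<longleftrightarrow> adjacency_lists A \<and> 0 < k \<and> k \<le> length A"

lemma encodes_instance_iff:
  assumes "valid A k"
  shows "encodes_instance (encode A k) G k' \<longleftrightarrow> G = graph_of A \<and> k' = k"
  using assms encodes_instance_unique[of A k G k'] by (auto simp: valid_def encodes_instance_def)

lemma mem_Clique_iff:
  "valid A k \<Longrightarrow> (encode A k, p) \<in> Clique \<kappa> \<longleftrightarrow> \<kappa> (graph_of A) k \<le> p \<and> has_clique (graph_of A) k"
  by (simp add: Clique_def encodes_instance_iff del: split_paired_Ex)

lemma mem_Clique_promise_iff:
  "valid A k \<Longrightarrow> (encode A k, p) \<in> Clique_promise \<kappa> \<longleftrightarrow> \<kappa> (graph_of A) k \<le> p"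
  by (simp add: Clique_promise_def encodes_instance_iff del: split_paired_All)

lemma query_correct:
  assumes \<kappa>: "\<kappa> \<in> clique_parameters d" and v: "valid A k"
  shows "query A k \<in> Clique_promise \<kappa>"
    and "query A k \<in> Clique \<kappa> \<longleftrightarrow> has_clique (graph_of A) k"
proof -
  have G: "simple_graph (graph_of A)" using v by (simp add: valid_def simple_graph_graph_of)
  have "\<kappa> (graph_of A) k \<le> length A * length A + length A + k"
    using clique_parameters_le[OF \<kappa> G, of k] by simp
  \<comment> \<open>This uses \<open>k \<le> length A\<close>; the factor
    \<open>2 * length A + 2\<close> is the lower bound from \<open>length_encode_ge\<close>.\<close>
  also have "\<dots> \<le> (2 * length A + 2) * (2 * length A + 2)" using v by (simp add: valid_def algebra_simps)
  also have "\<dots> \<le> length (encode A k) * length (encode A k)"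
    using length_encode_ge[of A k] by (intro mult_le_mono) auto
  finally have le: "\<kappa> (graph_of A) k \<le> length (encode A k) * length (encode A k)" .
  then show "query A k \<in> Clique_promise \<kappa>"
    using mem_Clique_promise_iff[OF v] by (simp add: query_def)
  show "query A k \<in> Clique \<kappa> \<longleftrightarrow> has_clique (graph_of A) k"
    using mem_Clique_iff[OF v] le by (simp add: query_def)
qed

subsection \<open>Induced subgraphs\<close>

lemma restrict_props: "distinct (restrict A W)" "set (restrict A W) = set W \<inter> {..<length A}"
  by (auto simp: restrict_def)

lemma nth_induced_lists:
  assumes "set V \<subseteq> {..<length A}" "i < length V"
  shows "induced_lists A V ! i = filter (\<lambda>j. V ! j \<in> set (A ! (V ! i))) [0..<length V]"
proof -
  have "V ! i < length A" using assms nth_mem by blast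
  then have "induced_lists A V ! i = filter (\<lambda>j. hd (drop j V) \<in> set (A ! (V ! i))) [0..<length V]"
    using assms(2) by (simp add: induced_lists_def row_nth)
  also have "\<dots> = filter (\<lambda>j. V ! j \<in> set (A ! (V ! i))) [0..<length V]"
    by (rule filter_cong) (auto simp: hd_drop_conv_nth)
  finally show ?thesis .
qed

lemma length_induced_lists [simp]: "length (induced_lists A V) = length V"
  by (simp add: induced_lists_def)

lemma adjacency_lists_induced:
  assumes A: "adjacency_lists A" and V: "set V \<subseteq> {..<length A}"
  shows "adjacency_lists (induced_lists A V)"
  unfolding adjacency_lists_def length_induced_lists
proof (intro allI impI conjI ballI)
  fix i assume i: "i < length V"
  then have Vi: "V ! i < length A" using V nth_mem by blast
  show "distinct (induced_lists A V ! i)" by (simp add: nth_induced_lists[OF V i])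
  fix j assume "j \<in> set (induced_lists A V ! i)"
  then have j: "j < length V" "V ! j \<in> set (A ! (V ! i))" by (auto simp: nth_induced_lists[OF V i])
  then show "j < length V" by simp
  have D: "V ! j \<noteq> V ! i" "V ! i \<in> set (A ! (V ! j))" using adjacency_listsD(2)[OF A Vi j(2)] by blast+
  then show "j \<noteq> i" by blast
  show "i \<in> set (induced_lists A V ! j)" using i D(2) by (simp add: nth_induced_lists[OF V j(1)])
qed

lemma has_clique_induced:
  assumes A: "adjacency_lists A" and V: "set V \<subseteq> {..<length A}" "distinct V"
  shows "has_clique (graph_of (induced_lists A V)) k \<longleftrightarrow>
    (\<exists>C\<subseteq>set V. card C = k \<and> (\<forall>u\<in>C. \<forall>v\<in>C. u \<noteq> v \<longrightarrow> adj (graph_of A) u v))"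
proof -
  let ?H = "graph_of (induced_lists A V)"
  have bij: "bij_betw ((!) V) {..<length V} (set V)"
    using bij_betw_nth[OF V(2)] by simp
  then have inj: "inj_on ((!) V) {..<length V}" by (simp add: bij_betw_def)
  have adj: "adj ?H i j \<longleftrightarrow> adj (graph_of A) (V ! i) (V ! j)" if "i < length V" "j < length V" for i j
  proof -
    have "V ! i < length A" using that V(1) nth_mem by blast
    then show ?thesis
      using that by (simp add: adj_graph_of[OF adjacency_lists_induced[OF A V(1)]]
          adj_graph_of[OF A] nth_induced_lists[OF V(1)])
  qed
  show ?thesis
  proof
    assume "has_clique ?H k"
    then obtain C where C: "C \<subseteq> {..<length V}" "card C = k"
      "\<And>i j. i \<in> C \<Longrightarrow> j \<in> C \<Longrightarrow> i \<noteq> j \<Longrightarrow> adj ?H i j"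
      by (auto simp: has_clique_def)
    have "card ((!) V ` C) = k" using C card_image[OF inj_on_subset[OF inj C(1)]] by simp
    moreover have "(!) V ` C \<subseteq> set V" using C(1) by auto
    moreover have "adj (graph_of A) u v" if uv: "u \<in> (!) V ` C" "v \<in> (!) V ` C" "u \<noteq> v" for u v
    proof -
      obtain i j where ij: "i \<in> C" "j \<in> C" "u = V ! i" "v = V ! j" using uv(1,2) by blast
      then have "i \<noteq> j" using uv(3) by blast
      then have "adj ?H i j" using C(3) ij by blast
      moreover have "i < length V" "j < length V" using ij C(1) by auto
      ultimately show ?thesis using adj ij by simp
    qed
    ultimately show "\<exists>C\<subseteq>set V. card C = k \<and> (\<forall>u\<in>C. \<forall>v\<in>C. u \<noteq> v \<longrightarrow> adj (graph_of A) u v)"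
      by (intro exI[of _ "(!) V ` C"]) simp
  next
    assume "\<exists>C\<subseteq>set V. card C = k \<and> (\<forall>u\<in>C. \<forall>v\<in>C. u \<noteq> v \<longrightarrow> adj (graph_of A) u v)"
    then obtain C where C: "C \<subseteq> set V" "card C = k"
      "\<And>u v. u \<in> C \<Longrightarrow> v \<in> C \<Longrightarrow> u \<noteq> v \<Longrightarrow> adj (graph_of A) u v"
      by blast
    define I where "I = {i. i < length V \<and> V ! i \<in> C}"
    have I: "I \<subseteq> {..<length V}" by (auto simp: I_def)
    have img: "(!) V ` I = C"
    proof
      show "C \<subseteq> (!) V ` I"
      proof
        fix u assume "u \<in> C"
        then obtain i where "i < length V" "u = V ! i" using C(1) by (metis in_set_conv_nth subsetD)
        then show "u \<in> (!) V ` I" using \<open>u \<in> C\<close> by (auto simp: I_def)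
      qed
    qed (auto simp: I_def)
    have "card I = k" using card_image[OF inj_on_subset[OF inj I]] img C(2) by simp
    moreover have "adj ?H i j" if ij: "i \<in> I" "j \<in> I" "i \<noteq> j" for i j
    proof -
      have ij': "i < length V" "j < length V" "V ! i \<in> C" "V ! j \<in> C" using ij by (auto simp: I_def)
      then have "V ! i \<noteq> V ! j" using inj_onD[OF inj] ij(3) by blast
      then show ?thesis using adj[OF ij'(1,2)] C(3) ij' by blast
    qed
    ultimately show "has_clique ?H k"
      unfolding has_clique_def using I by (intro exI[of _ I]) simp
  qed
qed

lemma queries_correct:
  assumes \<kappa>: "\<kappa> \<in> clique_parameters d" and v: "valid A k"
  shows "set (queries A k Ws) \<subseteq> Clique_promise \<kappa>"
    and "(\<exists>y\<in>set (queries A k Ws). y \<in> Clique \<kappa>) \<longleftrightarrow>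
      (\<exists>W\<in>set Ws. \<exists>C\<subseteq>set W \<inter> {..<length A}. card C = k \<and>
        (\<forall>u\<in>C. \<forall>v\<in>C. u \<noteq> v \<longrightarrow> adj (graph_of A) u v))"
proof -
  have A: "adjacency_lists A" using v by (simp add: valid_def)
  let ?B = "\<lambda>W. induced_lists A (restrict A W)"
  have sub: "set (restrict A W) \<subseteq> {..<length A}" for W by (simp add: restrict_props)
  have val: "valid (?B W) k" if "k \<le> length (restrict A W)" for W
    using that v adjacency_lists_induced[OF A sub] by (simp add: valid_def)
  have mem: "set (queries A k Ws) = (\<lambda>W. query (?B W) k) ` {W\<in>set Ws. k \<le> length (restrict A W)}"
    by (simp add: queries_def)
  show "set (queries A k Ws) \<subseteq> Clique_promise \<kappa>"
    unfolding mem using query_correct(1)[OF \<kappa> val] by blast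
  have clq: "has_clique (graph_of (?B W)) k \<longleftrightarrow> (\<exists>C\<subseteq>set W \<inter> {..<length A}. card C = k \<and>
        (\<forall>u\<in>C. \<forall>v\<in>C. u \<noteq> v \<longrightarrow> adj (graph_of A) u v))" for W
    using has_clique_induced[OF A sub restrict_props(1), of W k] by (simp add: restrict_props)
  \<comment> \<open>The filter in \<open>queries\<close> drops no set that contains a clique of size
    \<open>k\<close>.\<close>
  have "k \<le> length (restrict A W)" if "has_clique (graph_of (?B W)) k" for W
    using has_clique_le[OF simple_graph_graph_of[OF adjacency_lists_induced[OF A sub]] that] by simp
  then have "(\<exists>y\<in>set (queries A k Ws). y \<in> Clique \<kappa>) \<longleftrightarrow>
      (\<exists>W\<in>set Ws. has_clique (graph_of (?B W)) k)"
    unfolding mem using query_correct(2)[OF \<kappa> val] by blast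
  then show "(\<exists>y\<in>set (queries A k Ws). y \<in> Clique \<kappa>) \<longleftrightarrow>
      (\<exists>W\<in>set Ws. \<exists>C\<subseteq>set W \<inter> {..<length A}. card C = k \<and>
        (\<forall>u\<in>C. \<forall>v\<in>C. u \<noteq> v \<longrightarrow> adj (graph_of A) u v))"
    by (simp add: clq)
qed

lemma groups_cover:
  assumes "0 < g" "W \<in> set Ws"
  shows "\<exists>W'\<in>set (groups g Ws). set W \<subseteq> set W'"
proof -
  obtain j where j: "j < length Ws" "W = Ws ! j" using assms(2) by (metis in_set_conv_nth)
  define i where "i = j div g"
  have le: "i * g \<le> j" "j - i * g < g"
    using assms(1) by (simp_all add: i_def minus_div_mult_eq_mod)
  have "i \<le> j" using le(1) assms(1) by (metis div_le_dividend i_def)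
  then have "concat (take g (drop (i * g) Ws)) \<in> set (groups g Ws)"
    using j le by (auto simp: groups_def)
  moreover have "take g (drop (i * g) Ws) ! (j - i * g) = W" using j le by simp
  then have "W \<in> set (take g (drop (i * g) Ws))" using j le
    by (metis (no_types, lifting) diff_less_mono in_set_conv_nth length_drop length_take min_less_iff_conj)
  ultimately show ?thesis by (intro bexI) auto
qed

lemma length_group_le:
  assumes "W' \<in> set (groups g Ws)" and Ws: "\<And>W. W \<in> set Ws \<Longrightarrow> length W \<le> D"
  shows "length W' \<le> g * D"
proof -
  obtain i where "W' = concat (take g (drop (i * g) Ws))" using assms by (auto simp: groups_def)
  moreover have "length (concat Us) \<le> length Us * D" if "\<And>U. U \<in> set Us \<Longrightarrow> length U \<le> D"
    for Us :: "nat list list"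
    using that by (induction Us) (auto intro: add_mono)
  moreover have "U \<in> set Ws" if "U \<in> set (take g (drop (i * g) Ws))" for U
    using that by (meson in_set_dropD in_set_takeD)
  ultimately have "length W' \<le> length (take g (drop (i * g) Ws)) * D" using Ws by blast
  also have "\<dots> \<le> g * D" by (intro mult_le_mono1) simp
  finally show ?thesis .
qed

lemma length_groups:
  assumes "0 < g" shows "length (groups g Ws) \<le> length Ws div g + 1"
proof -
  have "length (groups g Ws) = card {i. i < length Ws \<and> i * g < length Ws}"
    by (simp add: groups_def length_filter_conv_card) (rule arg_cong[of _ _ card], auto)
  also have "\<dots> \<le> card {..length Ws div g}"
    using assms by (intro card_mono) (auto simp: less_eq_div_iff_mult_less_eq)
  finally show ?thesis by simp
qed

subsection \<open>Peeling\<close>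

text \<open>A clique retains all its edges or is contained in a recorded set; once no edges are
  left, the latter holds for cliques with at least two vertices. The bound on the sum of the two
  lengths limits the number of recorded sets.\<close>

definition peel_inv :: "nat \<Rightarrow> nat \<Rightarrow> (nat \<times> nat) list \<Rightarrow> (nat \<times> nat) list \<times> nat list list \<Rightarrow> bool" where
  "peel_inv N D E0 s \<longleftrightarrow>
     set (fst s) \<subseteq> set E0 \<and> sym (set (fst s)) \<and> length (fst s) + length (snd s) \<le> length E0 \<and>
     (\<forall>W\<in>set (snd s). length W \<le> D) \<and>
     (\<forall>C \<subseteq> {..<N}. (\<forall>u\<in>C. \<forall>v\<in>C. u \<noteq> v \<longrightarrow> (u, v) \<in> set E0) \<longrightarrow>
       (\<forall>u\<in>C. \<forall>v\<in>C. u \<noteq> v \<longrightarrow> (u, v) \<in> set (fst s)) \<or> (\<exists>W\<in>set (snd s). C \<subseteq> set W))"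

lemma peel_step_stuck: "light_edges N D (fst s) = [] \<Longrightarrow> peel_step N D s = s"
  by (simp add: peel_step_def)

lemma peel_step_shorter:
  assumes "light_edges N D (fst s) \<noteq> []"
  shows "length (fst (peel_step N D s)) < length (fst s)"
proof -
  have "hd (light_edges N D (fst s)) \<in> set (fst s)"
    using hd_in_set[OF assms] by (auto simp: light_edges_def)
  then show ?thesis using assms by (auto simp: peel_step_def Let_def intro!: length_filter_less)
qed

lemma peel_inv_step:
  assumes inv: "peel_inv N D E0 s"
  shows "peel_inv N D E0 (peel_step N D s)"
proof (cases "light_edges N D (fst s) = []")
  case True
  then show ?thesis using inv by (simp add: peel_step_stuck)
next
  case False
  obtain E Ws where s: "s = (E, Ws)" by force
  obtain a b where ab: "hd (light_edges N D E) = (a, b)" by force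
  have light: "(a, b) \<in> set E" "length (community N E (a, b)) \<le> D"
  proof -
    have "(a, b) \<in> set (light_edges N D E)"
      using hd_in_set[of "light_edges N D E"] False by (simp add: s ab)
    then show "(a, b) \<in> set E" "length (community N E (a, b)) \<le> D" by (simp_all add: light_edges_def)
  qed
  define E' where "E' = filter (\<lambda>f. \<not> (f = (a, b) \<or> f = (b, a))) E"
  have step: "peel_step N D s = (E', community N E (a, b) # Ws)"
    using False by (simp add: peel_step_def s ab Let_def E'_def)
  have inv': "set E \<subseteq> set E0" "sym (set E)" "length E + length Ws \<le> length E0" "\<forall>W\<in>set Ws. length W \<le> D"
    "\<And>C. C \<subseteq> {..<N} \<Longrightarrow> \<forall>u\<in>C. \<forall>v\<in>C. u \<noteq> v \<longrightarrow> (u, v) \<in> set E0 \<Longrightarrow>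
      (\<forall>u\<in>C. \<forall>v\<in>C. u \<noteq> v \<longrightarrow> (u, v) \<in> set E) \<or> (\<exists>W\<in>set Ws. C \<subseteq> set W)"
    using inv by (simp_all add: peel_inv_def s)
  have "length E' < length E" unfolding E'_def using light(1) by (intro length_filter_less) auto
  moreover have "sym (set E')" using inv'(2) by (auto simp: E'_def sym_def)
  moreover have "(\<forall>u\<in>C. \<forall>v\<in>C. u \<noteq> v \<longrightarrow> (u, v) \<in> set E') \<or>
      (\<exists>W\<in>set (community N E (a, b) # Ws). C \<subseteq> set W)"
    if C: "C \<subseteq> {..<N}" "\<forall>u\<in>C. \<forall>v\<in>C. u \<noteq> v \<longrightarrow> (u, v) \<in> set E0" for C
    using inv'(5)[OF C]
  proof
    assume E: "\<forall>u\<in>C. \<forall>v\<in>C. u \<noteq> v \<longrightarrow> (u, v) \<in> set E"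
    show ?thesis
    \<comment> \<open>Removing the edge affects \<open>C\<close> only if both ends are in
      \<open>C\<close>. Then the other vertices of \<open>C\<close> are common neighbours of
      \<open>a\<close> and \<open>b\<close>, because all edges of \<open>C\<close> are still
      present.\<close>
    proof (cases "a \<in> C \<and> b \<in> C")
      case True
      then have "C \<subseteq> set (community N E (a, b))"
        using E C(1) by (auto simp: community_def)
      then show ?thesis by simp
    next
      case False
      then have "\<forall>u\<in>C. \<forall>v\<in>C. u \<noteq> v \<longrightarrow> (u, v) \<in> set E'" using E by (auto simp: E'_def)
      then show ?thesis ..
    qed
  qed auto
  ultimately show ?thesis
    using inv'(1,3,4) light(2) unfolding peel_inv_def step by (auto simp: E'_def)
qed

lemma peel_props:
  assumes "sym (set E)"
  shows "peel_inv N D E (peel N D E)" and "light_edges N D (fst (peel N D E)) = []"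
proof -
  have "peel_inv N D E ((peel_step N D ^^ n) (E, []))" for n
  proof (induction n)
    case 0
    show ?case by (simp add: peel_inv_def assms)
  next
    case (Suc n)
    from peel_inv_step[OF this] show ?case by simp
  qed
  then show "peel_inv N D E (peel N D E)" by (simp add: peel_def)
  \<comment> \<open>Either peeling is stuck or it has consumed an entry in each round, and then
    nothing is left after \<open>length E\<close> rounds.\<close>
  have "light_edges N D (fst ((peel_step N D ^^ n) (E, []))) = [] \<or>
      length (fst ((peel_step N D ^^ n) (E, []))) + n \<le> length E" for n
  proof (induction n)
    case (Suc n)
    let ?s = "(peel_step N D ^^ n) (E, [])"
    show ?case
    proof (cases "light_edges N D (fst ?s) = []")
      case True
      then show ?thesis by (simp add: peel_step_stuck)
    next
      case False
      then show ?thesis using Suc peel_step_shorter[OF False] by simp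
    qed
  qed simp
  from this[of "length E"] show "light_edges N D (fst (peel N D E)) = []"
    by (auto simp: peel_def light_edges_def)
qed

lemma set_edge_list:
  assumes "adjacency_lists A"
  shows "(u, v) \<in> set (edge_list A) \<longleftrightarrow> adj (graph_of A) u v"
  by (auto simp: edge_list_def adj_graph_of[OF assms] row_nth)

lemma sym_edge_list: "adjacency_lists A \<Longrightarrow> sym (set (edge_list A))"
  by (auto simp: sym_def set_edge_list insert_commute)

text \<open>Every entry of an adjacency list costs at least its marker bit. With
  \<open>peel_inv\<close>, this bounds the number of recorded sets by the input length.\<close>

lemma length_edge_list_le: "length (edge_list A) \<le> length (encode A k)"
proof -
  have "map (\<lambda>u. length (row A u)) [0..<length A] = map length A"
    by (rule nth_equalityI) (simp_all add: row_nth)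
  then have "length (edge_list A) = (\<Sum>ns\<leftarrow>A. length ns)"
    by (simp add: edge_list_def length_concat o_def)
  also have "\<dots> \<le> length (enc_list (enc_list enc_nat) A)"
  proof (induction A)
    case (Cons ns A)
    then show ?case using length_enc_list_ge[of ns enc_nat] by simp
  qed simp
  finally show ?thesis by (simp add: encode_def)
qed

text \<open>If entries remained, community degeneracy of their set of edges would provide another
  light edge. The two ends belong to the community of an edge, hence \<open>D + 2\<close>.\<close>

lemma peel_complete:
  assumes A: "adjacency_lists A" and cd: "community_degenerate D (graph_of A)"
    and "D + 2 \<le> D'"
  shows "fst (peel (length A) D' (edge_list A)) = []"
proof (rule ccontr)
  let ?N = "length A" and ?G = "graph_of A"
  define E where "E = fst (peel ?N D' (edge_list A))"
  assume "\<not> ?thesis"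
  then have ne: "set E \<noteq> {}" by (simp add: E_def)
  note inv = peel_props(1)[OF sym_edge_list[OF A], of ?N D', unfolded peel_inv_def]
  have E: "set E \<subseteq> set (edge_list A)" and sym: "sym (set E)" using inv by (simp_all add: E_def)
  define F where "F = {{u, v} | u v. (u, v) \<in> set E}"
  have F: "{u, v} \<in> F \<longleftrightarrow> (u, v) \<in> set E" for u v
    using sym by (auto simp: F_def doubleton_eq_iff sym_def)
  have "F \<subseteq> edges ?G" using E set_edge_list[OF A] by (auto simp: F_def)
  moreover have "F \<noteq> {}"
  proof -
    obtain e where "e \<in> set E" using ne by (meson ex_in_conv)
    then have "{fst e, snd e} \<in> F" unfolding F by simp
    then show ?thesis by blast
  qed
  ultimately obtain u v where uv: "{u, v} \<in> F" "card {w. {u, w} \<in> F \<and> {v, w} \<in> F} \<le> D"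
    using cd unfolding community_degenerate_def by blast
  have lt: "w < ?N" if "(z, w) \<in> set E" for z w
    using subsetD[OF E that] set_edge_list[OF A] adj_graph_of[OF A] adjacency_listsD(2)[OF A] by metis
  let ?X = "{w. (u, w) \<in> set E \<and> (v, w) \<in> set E}"
  have "finite ?X" by (rule finite_subset[of _ "{..<?N}"]) (use lt in auto)
  moreover have "set (community ?N E (u, v)) \<subseteq> {u, v} \<union> ?X" by (auto simp: community_def)
  ultimately have "card (set (community ?N E (u, v))) \<le> card ({u, v} \<union> ?X)"
    by (intro card_mono) auto
  also have "\<dots> \<le> card {u, v} + card ?X" by (rule card_Un_le)
  also have "\<dots> \<le> 2 + D" using uv(2) by (intro add_mono) (auto simp: F card_insert_if)
  finally have "length (community ?N E (u, v)) \<le> D'"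
    using assms(3) by (simp add: community_def flip: distinct_card)
  then have "(u, v) \<in> set (light_edges ?N D' E)" using uv(1) F by (simp add: light_edges_def)
  then show False using peel_props(2)[OF sym_edge_list[OF A], of ?N D'] by (simp add: E_def)
qed

subsection \<open>Sizes and numbers of queries\<close>

lemma length_enc_list_le:
  "(\<And>x. x \<in> set xs \<Longrightarrow> length (h x) \<le> b) \<Longrightarrow> length (enc_list h xs) \<le> length xs * (b + 1) + 1"
proof (induction xs)
  case (Cons x xs)
  then have "length (h x) \<le> b" "length (enc_list h xs) \<le> length xs * (b + 1) + 1" by auto
  then show ?case by simp
qed simp

lemma length_enc_nat_le: "length (enc_nat n) \<le> 2 * n + 1"
  using length_enc_list_le[of "bits n" "\<lambda>b. [b]" 1] length_bits_le[of n] by (simp add: enc_nat_def)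

text \<open>There are at most \<open>m\<close> rows with at most \<open>m\<close> entries of
  \<open>O(m)\<close> bits each, where the binary length of a number is estimated by the number
  itself. This is the origin of the exponent 3 in the size of the groups.\<close>

lemma length_encode_le:
  assumes "valid A k" "length A \<le> m"
  shows "length (encode A k) \<le> 6 * (m + 1) ^ 3"
proof -
  have row: "length (enc_list enc_nat ns) \<le> m * (2 * m + 2) + 1" if ns: "ns \<in> set A" for ns
  proof -
    obtain u where u: "u < length A" "ns = A ! u" using ns by (metis in_set_conv_nth)
    have A: "adjacency_lists A" using assms(1) by (simp add: valid_def)
    have lt: "v < m" if "v \<in> set ns" for v
    proof -
      have "v < length A" using adjacency_listsD(2)[OF A u(1), of v] that u(2) by blast
      then show ?thesis using assms(2) by simp
    qed
    then have "set ns \<subseteq> {..<m}" by auto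
    from card_mono[OF _ this] have "card (set ns) \<le> m" by simp
    then have len: "length ns \<le> m"
      using adjacency_listsD(1)[OF A u(1)] u(2) by (simp add: distinct_card)
    have "length (enc_nat v) \<le> 2 * m + 1" if "v \<in> set ns" for v
      using length_enc_nat_le[of v] lt[OF that] by simp
    from length_enc_list_le[of ns enc_nat, OF this]
    have "length (enc_list enc_nat ns) \<le> length ns * (2 * m + 2) + 1" by simp
    also have "\<dots> \<le> m * (2 * m + 2) + 1" using len by (intro add_mono mult_le_mono1) auto
    finally show ?thesis .
  qed
  have "length (enc_list (enc_list enc_nat) A) \<le> length A * (m * (2 * m + 2) + 2) + 1"
    using length_enc_list_le[of A "enc_list enc_nat", OF row] by simp
  also have "\<dots> \<le> m * (m * (2 * m + 2) + 2) + 1"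
    using assms(2) by (intro add_mono mult_le_mono1) auto
  finally have "length (encode A k) \<le> m * (m * (2 * m + 2) + 2) + 1 + (2 * m + 1)"
    using length_enc_nat_le[of k] assms by (simp add: encode_def valid_def)
  also have "\<dots> \<le> 6 * (m + 1) ^ 3" by (simp add: power3_eq_cube algebra_simps)
  finally show ?thesis .
qed

lemma queries_size:
  assumes v: "valid A k" and Ws: "\<And>W. W \<in> set Ws \<Longrightarrow> length W \<le> m"
    and "(y, q) \<in> set (queries A k Ws)"
  shows "length y \<le> 6 * (m + 1) ^ 3 \<and> q = length y * length y"
proof -
  obtain W where W: "W \<in> set Ws" "k \<le> length (restrict A W)"
    "(y, q) = query (induced_lists A (restrict A W)) k"
    using assms(3) by (auto simp: queries_def)
  have "length (restrict A W) = card (set W \<inter> {..<length A})"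
    using restrict_props[of A W] by (metis distinct_card)
  also have "\<dots> \<le> card (set W)" by (intro card_mono) auto
  also have "\<dots> \<le> m" using card_length[of W] Ws[OF W(1)] by simp
  finally have m: "length (restrict A W) \<le> m" .
  have "valid (induced_lists A (restrict A W)) k"
    using v W(2) adjacency_lists_induced[of A "restrict A W"] by (simp add: valid_def restrict_props)
  from length_encode_le[OF this, of m] show ?thesis using m W(3) by (simp add: query_def)
qed

lemma card_bit_lists_le: "card {y :: bool list. length y \<le> s} \<le> 2 ^ (s + 1)"
proof -
  have "card {y :: bool list. length y \<le> s} = (\<Sum>i\<le>s. 2 ^ i)"
    using card_lists_length_le[of "UNIV :: bool set" s] by simp
  also have "\<dots> \<le> 2 ^ (s + 1)" by (induction s) auto
  finally show ?thesis .
qed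

text \<open>The parameter of a query is determined by its string, so there are no more different
  queries than short strings.\<close>

lemma length_remdups_queries_le:
  assumes "valid A k" and "\<And>W. W \<in> set Ws \<Longrightarrow> length W \<le> m"
  shows "length (remdups (queries A k Ws)) \<le> 2 ^ (6 * (m + 1) ^ 3 + 1)"
proof -
  let ?Y = "{y :: bool list. length y \<le> 6 * (m + 1) ^ 3}"
  have fin: "finite ?Y" using finite_lists_length_le[of "UNIV :: bool set"] by simp
  have "set (queries A k Ws) \<subseteq> (\<lambda>y. (y, length y * length y)) ` ?Y"
  proof
    fix i assume i: "i \<in> set (queries A k Ws)"
    obtain y q where yq: "i = (y, q)" by force
    then show "i \<in> (\<lambda>y. (y, length y * length y)) ` ?Y"
      using queries_size[OF assms(1), of Ws m y q] assms(2) i by auto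
  qed
  then have "card (set (queries A k Ws)) \<le> card ?Y" by (rule surj_card_le[OF fin])
  also have "\<dots> \<le> 2 ^ (6 * (m + 1) ^ 3 + 1)" by (rule card_bit_lists_le)
  finally show ?thesis by (simp only: length_remdups_card_conv)
qed

text \<open>A rejected string encodes either no instance or one in which \<open>k\<close> exceeds
  the number of vertices, so that there is no clique.\<close>

lemma kernel_cases:
  obtains (invalid) "kernel d e (x, p) = []" "\<And>G k. encodes_instance x G k \<Longrightarrow> \<not> has_clique G k"
  | (valid) A k where "x = encode A k" "valid A k"
      "kernel d e (x, p) =
        (let s = peel (length A) (2 * p + d) (edge_list A);
           Q1 = remdups (queries A k (snd s)); Q2 = queries A k (groups ((p + 1) ^ e) (snd s)) in
         if k = 1 \<or> \<not> fst s = [] then [query [[]] 1]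
         else if length Q1 \<le> length Q2 then Q1 else Q2)"
proof (cases "encode (fst (parse x)) (snd (parse x)) = x \<and> valid (fst (parse x)) (snd (parse x))")
  case True
  then show ?thesis
    by (intro valid[of "fst (parse x)" "snd (parse x)"])
      (auto simp: kernel_def valid_def well_formed_iff Let_def)
next
  case False
  have "\<not> has_clique G k" if inst: "encodes_instance x G k" for G k
  proof
    assume clq: "has_clique G k"
    obtain A where A: "adjacency_lists A" "0 < k" "G = graph_of A" "x = encode A k"
      using inst unfolding encodes_instance_def by blast
    have k: "k \<le> length A" using has_clique_le[OF simple_graph_graph_of[OF A(1)]] clq A(3) by simp
    then have "k \<le> length x" using length_encode_ge[of A k] A(4) by simp
    then have "parse x = (A, k)" using parse_encode_adjacency_lists[OF A(1), of k] A(4) by simp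
    then show False using False A k by (simp add: valid_def)
  qed
  moreover have "kernel d e (x, p) = []"
    using False by (auto simp: kernel_def valid_def well_formed_iff Let_def)
  ultimately show ?thesis by (rule invalid[rotated])
qed

lemma yes_query:
  assumes "\<kappa> \<in> clique_parameters d"
  shows "query [[]] 1 \<in> Clique_promise \<kappa>" "query [[]] 1 \<in> Clique \<kappa>"
proof -
  have v: "valid [[]] 1" by (simp add: valid_def adjacency_lists_def)
  have "has_clique (graph_of [[]]) 1"
    unfolding has_clique_def by (intro exI[of _ "{0}"]) simp
  then show "query [[]] 1 \<in> Clique_promise \<kappa>" "query [[]] 1 \<in> Clique \<kappa>"
    using query_correct[OF assms v] by simp_all
qed

text \<open>\<open>Ws\<close> is any list of sets that covers the recorded ones, such as the
  recorded list itself or its groups. Cliques with fewer than two vertices have no edge that could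
  be peeled off, hence \<open>2 \<le> k\<close>.\<close>

lemma peeled_queries_correct:
  assumes \<kappa>: "\<kappa> \<in> clique_parameters d" and v: "valid A k" and k: "2 \<le> k"
    and empty: "fst (peel (length A) D (edge_list A)) = []"
    and cover: "\<And>W. W \<in> set (snd (peel (length A) D (edge_list A))) \<Longrightarrow> \<exists>W'\<in>set Ws. set W \<subseteq> set W'"
  shows "(\<exists>y\<in>set (queries A k Ws). y \<in> Clique \<kappa>) \<longleftrightarrow> has_clique (graph_of A) k"
proof -
  have A: "adjacency_lists A" using v by (simp add: valid_def)
  let ?clique = "\<lambda>C. card C = k \<and> (\<forall>u\<in>C. \<forall>v\<in>C. u \<noteq> v \<longrightarrow> adj (graph_of A) u v)"
  have cov: "\<forall>C\<subseteq>{..<length A}. (\<forall>u\<in>C. \<forall>v\<in>C. u \<noteq> v \<longrightarrow> (u, v) \<in> set (edge_list A)) \<longrightarrow>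
      (\<forall>u\<in>C. \<forall>v\<in>C. u \<noteq> v \<longrightarrow> (u, v) \<in> set []) \<or>
      (\<exists>W\<in>set (snd (peel (length A) D (edge_list A))). C \<subseteq> set W)"
    using peel_props(1)[OF sym_edge_list[OF A], of "length A" D]
    unfolding peel_inv_def empty by (elim conjE)
  have covered: "\<exists>W\<in>set Ws. C \<subseteq> set W \<inter> {..<length A}" if C: "C \<subseteq> {..<length A}" "?clique C" for C
  proof -
    have "\<forall>u\<in>C. \<forall>v\<in>C. u \<noteq> v \<longrightarrow> (u, v) \<in> set (edge_list A)"
      using C(2) set_edge_list[OF A] by simp
    from mp[OF mp[OF spec[OF cov, of C] C(1)] this]
    have cases: "(\<forall>u\<in>C. \<forall>v\<in>C. u \<noteq> v \<longrightarrow> (u, v) \<in> set []) \<or>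
        (\<exists>W\<in>set (snd (peel (length A) D (edge_list A))). C \<subseteq> set W)" .
    have "\<not> (\<forall>u\<in>C. \<forall>v\<in>C. u \<noteq> v \<longrightarrow> (u, v) \<in> set [])"
    proof
      assume "\<forall>u\<in>C. \<forall>v\<in>C. u \<noteq> v \<longrightarrow> (u, v) \<in> set []"
      then have "\<forall>u\<in>C. \<forall>v\<in>C. u = v" by auto
      moreover have "finite C" by (rule finite_subset[OF C(1)]) simp
      ultimately have "card C \<le> Suc 0" by (simp only: card_le_Suc0_iff_eq)
      then show False using C(2) k by simp
    qed
    from disjE[OF cases notE[OF this]]
    obtain W where W: "W \<in> set (snd (peel (length A) D (edge_list A)))" "C \<subseteq> set W" by blast
    then show ?thesis using cover[OF W(1)] C(1) by blast
  qed
  have "(\<exists>W\<in>set Ws. \<exists>C\<subseteq>set W \<inter> {..<length A}. ?clique C) \<longleftrightarrow> (\<exists>C\<subseteq>{..<length A}. ?clique C)"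
    (is "?L \<longleftrightarrow> ?R")
  proof
    assume ?L
    then obtain W C where C: "C \<subseteq> set W \<inter> {..<length A}" "?clique C" by (elim bexE exE conjE) simp
    then show ?R by (intro exI[of _ C]) simp
  next
    assume ?R
    then obtain C where C: "C \<subseteq> {..<length A}" "?clique C" by (elim exE conjE) simp
    from covered[OF this] obtain W where "W \<in> set Ws" "C \<subseteq> set W \<inter> {..<length A}" by (elim bexE)
    then show ?L by (intro bexI[of _ W] exI[of _ C] conjI[of "C \<subseteq> _"] C(2))
  qed
  then show ?thesis using queries_correct(2)[OF \<kappa> v, of Ws] by (simp add: has_clique_def)
qed

text \<open>\<open>D\<close> is the bound \<open>2 * p + d + 2\<close> from
  \<open>clique_or_community_degenerate\<close> plus 2 for the ends of an edge. Since the shorter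
  list is returned, both bounds on the number of queries apply to it; \<open>\<le> 1\<close> covers
  rejected strings and the trivial yes-instance, whose length is covered by the summand 2 in the
  size bound.\<close>

lemma kernel_correct:
  fixes d e p :: nat
  defines "D \<equiv> 2 * p + (d + 4)"
  assumes \<kappa>: "\<kappa> \<in> clique_parameters d" and promise: "(x, p) \<in> Clique_promise \<kappa>"
  shows "set (kernel (d + 4) e (x, p)) \<subseteq> Clique_promise \<kappa>"
    and "(x, p) \<in> Clique \<kappa> \<longleftrightarrow> (\<exists>i\<in>set (kernel (d + 4) e (x, p)). i \<in> Clique \<kappa>)"
    and "(y, q) \<in> set (kernel (d + 4) e (x, p)) \<Longrightarrow>
      length y \<le> 6 * ((p + 1) ^ e * D + 2) ^ 3 \<and> q = length y * length y"
    and "length (kernel (d + 4) e (x, p)) \<le> 1 \<or>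
      length (kernel (d + 4) e (x, p)) \<le> 2 ^ (6 * (D + 1) ^ 3 + 1) \<and>
      length (kernel (d + 4) e (x, p)) \<le> length x div (p + 1) ^ e + 1"
proof -
  let ?K = "kernel (d + 4) e (x, p)" and ?g = "(p + 1) ^ e"
  have "set ?K \<subseteq> Clique_promise \<kappa> \<and> ((x, p) \<in> Clique \<kappa> \<longleftrightarrow> (\<exists>i\<in>set ?K. i \<in> Clique \<kappa>)) \<and>
    (\<forall>(y, q)\<in>set ?K. length y \<le> 6 * (?g * D + 2) ^ 3 \<and> q = length y * length y) \<and>
    (length ?K \<le> 1 \<or> length ?K \<le> 2 ^ (6 * (D + 1) ^ 3 + 1) \<and> length ?K \<le> length x div ?g + 1)"
  proof (cases rule: kernel_cases[of "d + 4" e x p])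
    case invalid
    then have "(x, p) \<notin> Clique \<kappa>" unfolding Clique_def by blast
    then show ?thesis by (simp add: invalid(1))
  next
    case (valid A k)
    have A: "adjacency_lists A" and k: "0 < k" "k \<le> length A" using valid(2) by (simp_all add: valid_def)
    let ?G = "graph_of A"
    have G: "simple_graph ?G" by (rule simple_graph_graph_of[OF A])
    have le: "\<kappa> ?G k \<le> p" using promise mem_Clique_promise_iff[OF valid(2)] by (simp add: valid(1))
    have L: "(x, p) \<in> Clique \<kappa> \<longleftrightarrow> has_clique ?G k"
      using mem_Clique_iff[OF valid(2)] le by (simp add: valid(1))
    define s where "s = peel (length A) D (edge_list A)"
    define Q1 where "Q1 = remdups (queries A k (snd s))"
    define Q2 where "Q2 = queries A k (groups ?g (snd s))"
    have K: "?K = (if k = 1 \<or> \<not> fst s = [] then [query [[]] 1]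
         else if length Q1 \<le> length Q2 then Q1 else Q2)"
      unfolding valid(3) Let_def s_def Q1_def Q2_def D_def ..
    show ?thesis
    proof (cases "k = 1 \<or> \<not> fst s = []")
      case True
      have "has_clique ?G k"
      proof (cases "k = 1")
        case True
        moreover have "0 < length A" using k by linarith
        ultimately show ?thesis unfolding has_clique_def by (intro exI[of _ "{0}"]) simp
      next
        case False
        then have "fst (peel (length A) D (edge_list A)) \<noteq> []" using True by (simp add: s_def)
        then have "\<not> community_degenerate (2 * p + d + 2) ?G"
          using peel_complete[OF A, of "2 * p + d + 2" D] by (auto simp: D_def)
        then have "\<not> community_degenerate (2 * \<kappa> ?G k + d + 2) ?G"
          using community_degenerate_mono[of "2 * \<kappa> ?G k + d + 2" ?G "2 * p + d + 2"] le by auto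
        then show ?thesis using clique_or_community_degenerate[OF \<kappa> G, of k] by simp
      qed
      moreover have "length (encode [[]] 1) \<le> 6 * (?g * D + 2) ^ 3"
      proof -
        have "valid [[]] 1" by (simp add: valid_def adjacency_lists_def)
        then have "length (encode [[]] 1) \<le> 6 * (1 + 1) ^ 3" by (rule length_encode_le) simp
        also have "\<dots> \<le> 6 * (?g * D + 2) ^ 3" by (intro mult_le_mono2 power_mono) auto
        finally show ?thesis .
      qed
      moreover have "?K = [query [[]] 1]" unfolding K using True by (rule if_P)
      ultimately show ?thesis using yes_query[OF \<kappa>] L by (simp add: query_def)
    next
      case False
      then have empty: "fst (peel (length A) D (edge_list A)) = []" and k2: "2 \<le> k"
        using k(1) by (simp_all add: s_def)
      note inv = peel_props(1)[OF sym_edge_list[OF A], of "length A" D, unfolded peel_inv_def, folded s_def]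
      have len: "length (snd s) \<le> length (edge_list A)" and D: "\<And>W. W \<in> set (snd s) \<Longrightarrow> length W \<le> D"
        using inv by simp_all
      have g: "0 < ?g" by simp
      have D': "length W \<le> ?g * D" if "W \<in> set (groups ?g (snd s))" for W
        by (rule length_group_le[OF that D])
      have D'': "length W \<le> ?g * D" if "W \<in> set (snd s)" for W
        using D[OF that] g by (metis le_trans mult_le_mono1 Suc_leI mult_1 One_nat_def)
      have "(\<exists>i\<in>set (queries A k (snd s)). i \<in> Clique \<kappa>) \<longleftrightarrow> has_clique ?G k"
        by (rule peeled_queries_correct[OF \<kappa> valid(2) k2 empty]) (auto simp: s_def)
      then have Q1: "(\<exists>i\<in>set Q1. i \<in> Clique \<kappa>) \<longleftrightarrow> has_clique ?G k" "set Q1 \<subseteq> Clique_promise \<kappa>"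
        using queries_correct(1)[OF \<kappa> valid(2)] by (simp_all add: Q1_def)
      have Q2: "(\<exists>i\<in>set Q2. i \<in> Clique \<kappa>) \<longleftrightarrow> has_clique ?G k" "set Q2 \<subseteq> Clique_promise \<kappa>"
        using peeled_queries_correct[OF \<kappa> valid(2) k2 empty groups_cover[OF g]]
          queries_correct(1)[OF \<kappa> valid(2)] by (simp_all add: Q2_def s_def)
      have size: "length y \<le> 6 * (?g * D + 2) ^ 3 \<and> q = length y * length y"
        if "(y, q) \<in> set Q1 \<union> set Q2" for y q
      proof -
        have "length y \<le> 6 * (?g * D + 1) ^ 3 \<and> q = length y * length y"
          using that queries_size[OF valid(2) D'', where y = y and q = q]
            queries_size[OF valid(2) D', where y = y and q = q]
          by (auto simp: Q1_def Q2_def)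
        moreover have "6 * (?g * D + 1) ^ 3 \<le> 6 * (?g * D + 2) ^ 3"
          by (intro mult_le_mono2 power_mono) auto
        ultimately show ?thesis by (auto intro: le_trans)
      qed
      have c1: "length Q1 \<le> 2 ^ (6 * (D + 1) ^ 3 + 1)"
        unfolding Q1_def by (rule length_remdups_queries_le[OF valid(2) D])
      have "length Q2 \<le> length (groups ?g (snd s))" by (simp add: Q2_def queries_def)
      also have "\<dots> \<le> length (snd s) div ?g + 1" by (rule length_groups[OF g])
      also have "\<dots> \<le> length x div ?g + 1"
        using len length_edge_list_le[of A k] by (intro add_mono div_le_mono) (auto simp: valid(1))
      finally have c2: "length Q2 \<le> length x div ?g + 1" .
      have "?K = Q1 \<and> length Q1 \<le> length Q2 \<or> ?K = Q2 \<and> length Q2 \<le> length Q1"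
        unfolding K using False by auto
      then show ?thesis
      proof (elim disjE conjE)
        assume "?K = Q1" "length Q1 \<le> length Q2"
        then show ?thesis using Q1 L size c1 c2 by auto
      next
        assume "?K = Q2" "length Q2 \<le> length Q1"
        then show ?thesis using Q2 L size c1 c2 by auto
      qed
    qed
  qed
  then show "set ?K \<subseteq> Clique_promise \<kappa>"
    and "(x, p) \<in> Clique \<kappa> \<longleftrightarrow> (\<exists>i\<in>set ?K. i \<in> Clique \<kappa>)"
    and "(y, q) \<in> set ?K \<Longrightarrow> length y \<le> 6 * (?g * D + 2) ^ 3 \<and> q = length y * length y"
    and "length ?K \<le> 1 \<or> length ?K \<le> 2 ^ (6 * (D + 1) ^ 3 + 1) \<and> length ?K \<le> length x div ?g + 1"
    by blast+
qed

section \<open>Asymptotics of the number of queries\<close>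

text \<open>Whenever there are queries, the length is thus at least 2 and its binary logarithm at
  least 1.\<close>

lemma kernel_short: "length x < 2 \<Longrightarrow> kernel d e (x, p) = []"
proof (cases rule: kernel_cases[of d e x p])
  case (valid A k)
  assume "length x < 2"
  then show ?thesis using length_encode_ge[of A k] by (simp add: valid(1))
qed

text \<open>\<open>(ln n / 2) ^ m / exp (ln n / 2)\<close> tends to 0, and its denominator is
  \<open>sqrt n\<close>; the claim results from multiplication by \<open>sqrt n\<close>.\<close>

lemma sqrt_bigo_over_log_power:
  "(\<lambda>n. sqrt (real n)) \<in> O(\<lambda>n. real n / log 2 (real n) ^ m)"
proof -
  have "filterlim (\<lambda>n::nat. ln (real n) / 2) at_top at_top"
    using filterlim_compose[OF ln_at_top filterlim_real_sequentially]
    by (intro filterlim_at_top_mult_tendsto_pos[of "\<lambda>_. 1/2" "1/2" _ "\<lambda>n. ln (real n)", simplified]) auto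
  from filterlim_compose[OF tendsto_power_div_exp_0[of m] this]
  have "(\<lambda>n. (ln (real n) / 2) ^ m / exp (ln (real n) / 2)) \<longlonglongrightarrow> 0" .
  then have "\<forall>\<^sub>F n in sequentially. (ln (real n) / 2) ^ m / exp (ln (real n) / 2) < 1"
    by (rule order_tendstoD(2)) simp
  then have "\<forall>\<^sub>F n in sequentially. norm (sqrt (real n)) \<le>
      (2 / ln 2) ^ m * norm (real n / log 2 (real n) ^ m)"
    using eventually_gt_at_top[of 1]
  proof eventually_elim
    case (elim n)
    have pos: "0 < ln (real n)" using elim(2) by simp
    have "exp (ln (real n) / 2) = sqrt (real n)"
      using elim(2) by (simp flip: powr_half_sqrt add: powr_def)
    then have "(ln (real n) / 2) ^ m \<le> sqrt (real n)"
      using elim by (simp add: divide_less_eq)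
    then have "sqrt (real n) * (ln (real n) / 2) ^ m \<le> sqrt (real n) * sqrt (real n)"
      by (intro mult_left_mono) auto
    then have "sqrt (real n) * ln (real n) ^ m \<le> 2 ^ m * real n"
      by (simp add: power_divide divide_le_eq mult.commute)
    then have "sqrt (real n) \<le> 2 ^ m * real n / ln (real n) ^ m"
      using pos by (simp add: le_divide_eq)
    also have "\<dots> = (2 / ln 2) ^ m * (real n / log 2 (real n) ^ m)"
      by (simp add: log_def power_divide)
    finally show ?case using pos by (simp add: log_def)
  qed
  then show ?thesis by (rule bigoI)
qed

lemma bigo_over_log_power_mono:
  assumes "c \<le> real m"
  shows "(\<lambda>n. real n / log 2 (real n) ^ m) \<in> O(\<lambda>n. real n / log 2 (real n) powr c)"
proof (rule bigoI[where c = 1])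
  show "\<forall>\<^sub>F n in sequentially. norm (real n / log 2 (real n) ^ m) \<le>
      1 * norm (real n / log 2 (real n) powr c)"
    using eventually_ge_at_top[of 2]
  proof eventually_elim
    case (elim n)
    then have "1 \<le> log 2 (real n)" by simp
    moreover from this have "log 2 (real n) powr c \<le> log 2 (real n) ^ m"
      using powr_mono[OF assms] by (simp flip: powr_realpow)
    ultimately show ?case by (simp add: frac_le)
  qed
qed

theorem theorem3:
  fixes c :: real and d :: nat and \<kappa> :: "nat graph \<Rightarrow> nat \<Rightarrow> nat"
  assumes "\<kappa> \<in> {\<lambda>G k. bandwidth G,
                \<lambda>G k. cutwidth G,
                \<lambda>G k. degeneracy G,
                \<lambda>G k. distance_to_bounded_degree d G,
                \<lambda>G k. edge_bipartization_number G,
                \<lambda>G k. feedback_vertex_set_number G,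
                \<lambda>G k. k + distance_to_chordal G,
                \<lambda>G k. k + distance_to_interval G,
                \<lambda>G k. max_degree G,
                \<lambda>G k. odd_cycle_transversal_number G,
                \<lambda>G k. treedepth G,
                \<lambda>G k. vertex_cover_number G,
                \<lambda>G k. longest_odd_cycle G,
                \<lambda>G k. pathwidth G,
                \<lambda>G k. treewidth G}"
  shows "\<exists>K. poly_OR_kernel (Clique \<kappa>) (Clique_promise \<kappa>)
               (\<lambda>n. real n / log 2 (real n) powr c) K"
proof -
  have \<kappa>: "\<kappa> \<in> clique_parameters d" using assms unfolding clique_parameters_def .
  \<comment> \<open>An integral exponent that is at least \<open>c\<close>; it is 0 for negative
    \<open>c\<close>.\<close>
  define m where "m = nat \<lceil>c\<rceil>"
  define K where "K = kernel (d + 4) (3 * m)"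
  let ?D = "\<lambda>p. 2 * p + (d + 4)"
  let ?B = "\<lambda>p. 6 * ((p + 1) ^ (3 * m) * ?D p + 2) ^ 3"
  have "poly_bounded (\<lambda>p. ?B p + ?B p * ?B p)"
    by (intro poly_bounded_intros)
  then obtain f where f: "\<And>p. ?B p + ?B p * ?B p \<le> poly f p"
    unfolding poly_bounded_def by blast
  have size: "length y + q \<le> poly f p"
    if "(x, p) \<in> Clique_promise \<kappa>" "(y, q) \<in> set (K (x, p))" for x p y q
  proof -
    have y: "length y \<le> ?B p" "q = length y * length y"
      using kernel_correct(3)[OF \<kappa> that(1) that(2)[unfolded K_def]] by simp_all
    show ?thesis
      unfolding y(2) using y(1) by (intro order_trans[OF add_mono[OF y(1) mult_le_mono[OF y(1) y(1)]] f])
  qed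
  \<comment> \<open>The exponent in the number of different queries is at most
    \<open>(6 * (d + 7) ^ 3 + 1) * (p + 1) ^ 3\<close>; the factor 2 is due to the threshold
    \<open>L / 2\<close> below.\<close>
  define b :: nat where "b = 2 * (6 * (d + 7) ^ 3 + 1)"
  define t where "t n = sqrt (real n) + real b ^ m * (real n / log 2 (real n) ^ m) + 1" for n
  have "(\<lambda>n. 1) \<in> O(\<lambda>n. sqrt (real n))"
  proof (rule bigoI[where c = 1])
    show "\<forall>\<^sub>F n in sequentially. norm (1::real) \<le> 1 * norm (sqrt (real n))"
      using eventually_ge_at_top[of 1] by eventually_elim simp
  qed
  then have one: "(\<lambda>n. 1) \<in> O(\<lambda>n. real n / log 2 (real n) ^ m)"
    using sqrt_bigo_over_log_power by (rule landau_o.big_trans)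
  have main: "(\<lambda>n. real b ^ m * (real n / log 2 (real n) ^ m)) \<in> O(\<lambda>n. real n / log 2 (real n) ^ m)"
    by (rule bigoI[where c = "real b ^ m"]) (simp add: abs_mult)
  have "t \<in> O(\<lambda>n. real n / log 2 (real n) ^ m)"
    unfolding t_def by (intro sum_in_bigo(1) sqrt_bigo_over_log_power main one)
  moreover have "c \<le> real m" by (simp add: m_def) linarith
  ultimately have t: "t \<in> O(\<lambda>n. real n / log 2 (real n) powr c)"
    using landau_o.big_trans bigo_over_log_power_mono by blast
  have count: "real (length (K (x, p))) \<le> t (length x)" if promise: "(x, p) \<in> Clique_promise \<kappa>" for x p
  proof (cases "length (K (x, p)) \<le> 1")
    case True
    \<comment> \<open>For the empty string the numerator vanishes, whatever the logarithm
      is.\<close>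
    have "0 \<le> sqrt (real (length x)) + real b ^ m * (real (length x) / log 2 (real (length x)) ^ m)"
    proof (cases "x = []")
      case False
      then have "0 < length x" by simp
      then have "1 \<le> real (length x)" "0 < real (length x)" by linarith+
      then have "0 \<le> log 2 (real (length x))" by (subst zero_le_log_cancel_iff) linarith+
      then show ?thesis by (intro add_nonneg_nonneg mult_nonneg_nonneg divide_nonneg_nonneg) simp_all
    qed simp
    then show ?thesis using True unfolding t_def by linarith
  next
    case False
    then have c1: "length (K (x, p)) \<le> 2 ^ (6 * (?D p + 1) ^ 3 + 1)"
      and c2: "length (K (x, p)) \<le> length x div (p + 1) ^ (3 * m) + 1"
      using kernel_correct(4)[OF \<kappa> promise, of "3 * m"] by (auto simp: K_def)
    let ?n = "real (length x)"
    have n: "2 \<le> length x"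
    proof (rule ccontr)
      assume "\<not> 2 \<le> length x"
      then have "K (x, p) = []" unfolding K_def by (intro kernel_short) simp
      then show False using False by simp
    qed
    then have log: "1 \<le> log 2 ?n" by (subst one_le_log_cancel_iff) linarith+
    define L where "L = log 2 ?n"
    have exponent: "6 * (?D p + 1) ^ 3 + 1 \<le> (6 * (d + 7) ^ 3 + 1) * (p + 1) ^ 3"
    proof -
      have "?D p + 1 \<le> (d + 7) * (p + 1)" by (simp add: algebra_simps)
      then have "(?D p + 1) ^ 3 \<le> (d + 7) ^ 3 * (p + 1) ^ 3"
        by (metis power_mono power_mult_distrib zero_le)
      moreover have "1 \<le> (p + 1) ^ 3" by simp
      ultimately have "6 * (?D p + 1) ^ 3 + 1 \<le> 6 * ((d + 7) ^ 3 * (p + 1) ^ 3) + (p + 1) ^ 3"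
        by (intro add_mono mult_le_mono2)
      then show ?thesis by (simp add: algebra_simps)
    qed
    show ?thesis
    \<comment> \<open>Up to the threshold, there are at most \<open>2 powr (L / 2)\<close>, that is
      \<open>sqrt n\<close>, different queries. Above it, \<open>L < b * (p + 1) ^ 3\<close>, so the
      group size \<open>(p + 1) ^ (3 * m)\<close> is at least \<open>(L / b) ^ m\<close>.\<close>
    proof (cases "real (6 * (?D p + 1) ^ 3 + 1) \<le> L / 2")
      case True
      have "real (length (K (x, p))) \<le> 2 ^ (6 * (?D p + 1) ^ 3 + 1)"
        using c1 by (metis of_nat_le_iff of_nat_numeral of_nat_power)
      also have "\<dots> = 2 powr real (6 * (?D p + 1) ^ 3 + 1)" by (subst powr_realpow) auto
      also have "\<dots> \<le> 2 powr (L / 2)" using True by (intro powr_mono) auto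
      also have "\<dots> = (2 powr L) powr (1 / 2)" by (simp add: powr_powr)
      also have "2 powr L = ?n" unfolding L_def by (rule powr_log_cancel) (use n in linarith)+
      also have "?n powr (1 / 2) = sqrt ?n" by (rule powr_half_sqrt) simp
      also have "\<dots> \<le> t (length x)" using log by (auto simp: t_def)
      finally show ?thesis .
    next
      case False
      have "L < 2 * real (6 * (?D p + 1) ^ 3 + 1)" using False by simp
      also have "\<dots> \<le> 2 * real ((6 * (d + 7) ^ 3 + 1) * (p + 1) ^ 3)"
        using exponent by (intro mult_left_mono) (simp_all only: of_nat_le_iff)
      also have "\<dots> = real b * real ((p + 1) ^ 3)" by (simp only: b_def of_nat_mult of_nat_numeral)
      finally have "L ^ m \<le> (real b * real ((p + 1) ^ 3)) ^ m"
        using log by (intro power_mono) (auto simp: L_def)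
      also have "\<dots> = real b ^ m * real ((p + 1) ^ (3 * m))"
        by (simp add: power_mult_distrib power_mult)
      finally have g: "L ^ m \<le> real b ^ m * real ((p + 1) ^ (3 * m))" .
      have gpos: "0 < real ((p + 1) ^ (3 * m))" by simp
      have "real (length (K (x, p))) \<le> real (length x div (p + 1) ^ (3 * m)) + 1"
        using c2 by (metis of_nat_le_iff of_nat_add of_nat_1)
      also have "real (length x div (p + 1) ^ (3 * m)) \<le> ?n / real ((p + 1) ^ (3 * m))"
        by (rule of_nat_div_le_of_nat)
      also have "\<dots> \<le> real b ^ m * (?n / L ^ m)"
      proof -
        have "a / G \<le> B * (a / M)" if "M \<le> B * G" "0 < M" "0 < G" "0 \<le> a" for a B G M :: real
          using mult_left_mono[OF that(1,4)] that by (simp add: field_simps)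
        from this[OF g _ gpos] show ?thesis using log by (simp add: L_def)
      qed
      also have "real b ^ m * (?n / L ^ m) + 1 \<le> t (length x)"
        by (simp add: t_def L_def)
      finally show ?thesis by simp
    qed
  qed
  have "polytime K" unfolding K_def by (rule polytime_if_pt[OF pt_kernel])
  moreover have "\<exists>f :: nat poly. \<forall>(x, p) \<in> Clique_promise \<kappa>. \<forall>(y, q) \<in> set (K (x, p)). length y + q \<le> poly f p"
    using size by (intro exI[of _ f]) blast
  moreover have "\<forall>(x, p) \<in> Clique_promise \<kappa>. set (K (x, p)) \<subseteq> Clique_promise \<kappa>"
    using kernel_correct(1)[OF \<kappa>] unfolding K_def by blast
  moreover have "\<forall>(x, p) \<in> Clique_promise \<kappa>. (x, p) \<in> Clique \<kappa> \<longleftrightarrow> (\<exists>(y, q) \<in> set (K (x, p)). (y, q) \<in> Clique \<kappa>)"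
    using kernel_correct(2)[OF \<kappa>] unfolding K_def by auto
  moreover have "\<exists>t :: nat \<Rightarrow> real. t \<in> O(\<lambda>n. real n / log 2 (real n) powr c) \<and>
      (\<forall>(x, p) \<in> Clique_promise \<kappa>. real (length (K (x, p))) \<le> t (length x))"
    using t count by (intro exI[of _ t]) blast
  ultimately show ?thesis unfolding poly_OR_kernel_def by (intro exI[of _ K] conjI)
qed

end
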